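(* Let $m\ge 2$ and $n\ge 3$ be integers, let $K$ be a field and let $G$ be a connected simple graph on the vertex set $[n]$. Then $J_m(G)$ is an almost complete intersection if and only if $m=2$ and one of the following holds: (1) $G$ is a tree which is not a path, and $G$ is obtained by adding an edge between two vertices of two paths (i.e. from two vertex-disjoint paths by adding one edge joining a vertex of the first to a vertex of the second); or (2) $G$ is not a tree, and $G$ is obtained either by adding an edge between two vertices of a path or by attaching a path to each vertex of a triangle.
   Context: $[n]=\{1,\dots,n\}$. $R=K[x_{ij}: i\in[m], j\in[n]]$ is the polynomial ring in $mn$ variables over the field $K$. For a simple graph $G$ on $[n]$, the generalized binomial edge ideal $J_m(G)\subset R$ is the ideal generated by all $x_{ki}x_{lj}-x_{kj}x_{li}$ with $1\le k<l\le m$ and $\{i,j\}$ an edge of $G$, $i<j$. $J_m(G)$ is an almost complete intersection if $\mu(J_m(G))=\mathrm{ht}(J_m(G))+1$, where $\mu$ denotes the minimal number of generators and $\mathrm{ht}$ the height. A path may consist of a single vertex. Adding an edge between two vertices of a path means joining two distinct non-adjacent vertices of the path. Attaching a path to a vertex $v$ means identifying an endpoint of a path (otherwise disjoint from the graph) with $v$. *)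

theory Defs
  imports "HOL-Algebra.Ideal" "HOL-Library.Poly_Mapping" "HOL-Library.Extended_Nat"
begin

text \<open>Meaningful for finitely generated \<open>I\<close> only.\<close>

definition min_num_gens :: "('a, 'b) ring_scheme \<Rightarrow> 'a set \<Rightarrow> nat" where
  "min_num_gens R I =
     (LEAST k. \<exists>S. S \<subseteq> carrier R \<and> finite S \<and> card S = k \<and> genideal R S = I)"

definition prime_height :: "('a, 'b) ring_scheme \<Rightarrow> 'a set \<Rightarrow> enat" where
  "prime_height R P =
     Sup {enat k | k. \<exists>Q :: nat \<Rightarrow> 'a set.
            (\<forall>i\<le>k. primeideal (Q i) R) \<and> (\<forall>i<k. Q i \<subset> Q (Suc i)) \<and> Q k = P}"

text \<open>The unit ideal lies in no prime ideal, so its height is \<open>\<infinity>\<close>.\<close>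

definition ideal_height :: "('a, 'b) ring_scheme \<Rightarrow> 'a set \<Rightarrow> enat" where
  "ideal_height R I = Inf {prime_height R P | P. primeideal P R \<and> I \<subseteq> P}"

definition almost_complete_intersection :: "('a, 'b) ring_scheme \<Rightarrow> 'a set \<Rightarrow> bool" where
  "almost_complete_intersection R I \<longleftrightarrow> enat (min_num_gens R I) = ideal_height R I + 1"

text \<open>
  A polynomial is a finitely supported map from monomials to coefficients, and a monomial is
  a finitely supported map from variable indices to exponents. Indices are arbitrary pairs of
  naturals at the level of types; the carrier of \<open>poly_ring m n\<close> consists of the
  polynomials involving only the variables indexed by \<open>{1..m} \<times> {1..n}\<close>.
\<close>

type_synonym 'k mpoly = "((nat \<times> nat) \<Rightarrow>\<^sub>0 nat) \<Rightarrow>\<^sub>0 'k"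

definition poly_ring :: "nat \<Rightarrow> nat \<Rightarrow> ('k::field) mpoly ring" where
  "poly_ring m n =
     \<lparr>carrier = {p. \<forall>t \<in> Poly_Mapping.keys p. Poly_Mapping.keys t \<subseteq> {1..m} \<times> {1..n}},
      mult = (*), one = 1, zero = 0, add = (+)\<rparr>"

definition var :: "nat \<Rightarrow> nat \<Rightarrow> ('k::field) mpoly" where
  "var k i = Poly_Mapping.single (Poly_Mapping.single (k, i) 1) 1"

lemma poly_ring_cring: "cring (poly_ring m n :: ('k::field) mpoly ring)"
proof -
  let ?R = "poly_ring m n :: 'k mpoly ring"
  have add_closed: "p + q \<in> carrier ?R" if "p \<in> carrier ?R" "q \<in> carrier ?R" for p q
    using that Poly_Mapping.keys_add[of p q] unfolding poly_ring_def by fastforce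
  have mult_closed: "p * q \<in> carrier ?R" if p: "p \<in> carrier ?R" and q: "q \<in> carrier ?R" for p q
  proof -
    have "Poly_Mapping.keys t \<subseteq> {1..m} \<times> {1..n}" if t: "t \<in> Poly_Mapping.keys (p * q)" for t
    proof -
      obtain a b where ab: "t = a + b" "a \<in> Poly_Mapping.keys p" "b \<in> Poly_Mapping.keys q"
        using t keys_mult[of p q] by auto
      have "Poly_Mapping.keys a \<subseteq> {1..m} \<times> {1..n}" "Poly_Mapping.keys b \<subseteq> {1..m} \<times> {1..n}"
        using p q ab unfolding poly_ring_def by simp_all
      then show ?thesis
        using Poly_Mapping.keys_add[of a b] unfolding ab(1) by blast
    qed
    then show ?thesis
      unfolding poly_ring_def by auto
  qed
  have minus_closed: "- p \<in> carrier ?R" if "p \<in> carrier ?R" for p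
    using that unfolding poly_ring_def by simp
  show ?thesis
  proof (rule cringI)
    show "abelian_group ?R"
    proof (rule abelian_groupI)
      fix x assume "x \<in> carrier ?R"
      then show "\<exists>y \<in> carrier ?R. y \<oplus>\<^bsub>?R\<^esub> x = \<zero>\<^bsub>?R\<^esub>"
        using minus_closed by (intro bexI[of _ "- x"]) (simp_all add: poly_ring_def)
    next
      fix x y assume "x \<in> carrier ?R" "y \<in> carrier ?R"
      then show "x \<oplus>\<^bsub>?R\<^esub> y \<in> carrier ?R"
        using add_closed[of x y] by (simp add: poly_ring_def)
    qed (simp_all add: poly_ring_def ac_simps)
    show "Group.comm_monoid ?R"
    proof (rule comm_monoidI)
      fix x y assume "x \<in> carrier ?R" "y \<in> carrier ?R"
      then show "x \<otimes>\<^bsub>?R\<^esub> y \<in> carrier ?R"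
        using mult_closed[of x y] by (simp add: poly_ring_def)
    qed (simp_all add: poly_ring_def ac_simps)
  qed (simp add: poly_ring_def distrib_right)
qed

lemma var_in_carrier: "k \<in> {1..m} \<Longrightarrow> i \<in> {1..n} \<Longrightarrow> var k i \<in> carrier (poly_ring m n)"
  by (auto simp: var_def poly_ring_def)

text \<open>A graph is given by its vertex set \<open>V\<close> and its set \<open>E\<close> of two-element edges.\<close>

definition simple_graph :: "'a set \<Rightarrow> 'a set set \<Rightarrow> bool" where
  "simple_graph V E \<longleftrightarrow> E \<subseteq> {{u, v} | u v. u \<in> V \<and> v \<in> V \<and> u \<noteq> v}"

definition connected_graph :: "'a set \<Rightarrow> 'a set set \<Rightarrow> bool" where
  "connected_graph V E \<longleftrightarrow> V \<noteq> {} \<and> (\<forall>u\<in>V. \<forall>v\<in>V. (u, v) \<in> {(a, b). {a, b} \<in> E}\<^sup>*)"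

definition is_cycle :: "'a set set \<Rightarrow> 'a list \<Rightarrow> bool" where
  "is_cycle E vs \<longleftrightarrow> length vs \<ge> 3 \<and> distinct vs \<and>
     (\<forall>i<length vs. {vs ! i, vs ! (Suc i mod length vs)} \<in> E)"

definition tree_graph :: "'a set \<Rightarrow> 'a set set \<Rightarrow> bool" where
  "tree_graph V E \<longleftrightarrow> simple_graph V E \<and> connected_graph V E \<and> (\<nexists>vs. is_cycle E vs)"

definition path_on :: "'a list \<Rightarrow> 'a set \<Rightarrow> 'a set set \<Rightarrow> bool" where
  "path_on vs V E \<longleftrightarrow> vs \<noteq> [] \<and> distinct vs \<and> V = set vs \<and>
     E = {{vs ! i, vs ! Suc i} | i. Suc i < length vs}"

definition path_graph :: "'a set \<Rightarrow> 'a set set \<Rightarrow> bool" where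
  "path_graph V E \<longleftrightarrow> (\<exists>vs. path_on vs V E)"

text \<open>Since reversing \<open>vs\<close> gives the same path, taking the head covers both endpoints.\<close>

definition path_with_endpoint :: "'a \<Rightarrow> 'a set \<Rightarrow> 'a set set \<Rightarrow> bool" where
  "path_with_endpoint v V E \<longleftrightarrow> (\<exists>vs. path_on vs V E \<and> hd vs = v)"

definition two_paths_plus_edge :: "'a set \<Rightarrow> 'a set set \<Rightarrow> bool" where
  "two_paths_plus_edge V E \<longleftrightarrow>
     (\<exists>V1 E1 V2 E2 u v. path_graph V1 E1 \<and> path_graph V2 E2 \<and> V1 \<inter> V2 = {} \<and>
        u \<in> V1 \<and> v \<in> V2 \<and> V = V1 \<union> V2 \<and> E = insert {u, v} (E1 \<union> E2))"

definition path_plus_edge :: "'a set \<Rightarrow> 'a set set \<Rightarrow> bool" where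
  "path_plus_edge V E \<longleftrightarrow>
     (\<exists>E0 u v. path_graph V E0 \<and> u \<in> V \<and> v \<in> V \<and> u \<noteq> v \<and> {u, v} \<notin> E0 \<and>
        E = insert {u, v} E0)"

definition attach_path :: "'a \<Rightarrow> 'a set \<Rightarrow> 'a set set \<Rightarrow> 'a set \<Rightarrow> 'a set set \<Rightarrow> bool" where
  "attach_path v V E V' E' \<longleftrightarrow> v \<in> V \<and>
     (\<exists>W F. path_with_endpoint v W F \<and> V \<inter> W = {v} \<and> V' = V \<union> W \<and> E' = E \<union> F)"

definition triangle_with_paths :: "'a set \<Rightarrow> 'a set set \<Rightarrow> bool" where
  "triangle_with_paths V E \<longleftrightarrow>
     (\<exists>a b c V1 E1 V2 E2. a \<noteq> b \<and> b \<noteq> c \<and> a \<noteq> c \<and>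
        attach_path a {a, b, c} {{a, b}, {b, c}, {a, c}} V1 E1 \<and>
        attach_path b V1 E1 V2 E2 \<and>
        attach_path c V2 E2 V E)"

definition gen_binomial_edge_ideal :: "nat \<Rightarrow> nat \<Rightarrow> nat set set \<Rightarrow> ('k::field) mpoly set" where
  "gen_binomial_edge_ideal m n E =
     genideal (poly_ring m n)
       {var k i * var l j - var k j * var l i | k l i j.
          1 \<le> k \<and> k < l \<and> l \<le> m \<and> {i, j} \<in> E \<and> i < j}"

end

theory Submission
  imports Defs "HOL-Computational_Algebra.Polynomial" "HOL-Library.Product_Lexorder"
    "HOL-Library.Transitive_Closure_Table"
begin

text \<open>
  The minors generating \<open>J\<^sub>m(G)\<close> are linearly independent quadrics, so \<open>\<mu>(J\<^sub>m(G)) = (m choose 2) |E|\<close>,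
  whereas the matrices of rank one show \<open>ht(J\<^sub>m(G)) \<le> (m - 1) (n - 1)\<close>; as \<open>|E| \<ge> n - 1\<close>, this forces
  \<open>m = 2\<close>. For \<open>m = 2\<close> let \<open>c(S)\<close> be the number of components of \<open>G - S\<close>; then \<open>ht(J\<^sub>2(G))\<close> is the
  minimum of \<open>n + |S| - c(S)\<close> over all sets \<open>S\<close> of vertices.

  For the upper bound, take the prime of matrices whose columns in \<open>S\<close> vanish and whose columns in each
  component of \<open>G - S\<close> are proportional. Modulo it, \<open>n - |S| + c(S)\<close> variables are algebraically
  independent, and a chain of \<open>k\<close> strict inclusions below it gives \<open>k\<close> further independent elements,
  while counting monomials shows that more than \<open>2n\<close> elements are dependent. For the lower bound, let a
  prime \<open>P\<close> contain \<open>J\<^sub>2(G)\<close> and let \<open>S\<close> be the set of columns contained in \<open>P\<close>. In every component of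
  \<open>G - S\<close> some row consists of nonmembers of \<open>P\<close>, so \<open>P\<close> contains \<open>n + |S| - c(S)\<close> elements each linear
  in a variable of its own with coefficient outside \<open>P\<close>; eliminating these variables one at a time
  builds a chain of primes below \<open>P\<close>.

  So \<open>J\<^sub>2(G)\<close> is an almost complete intersection iff the minimum is \<open>|E| - 1\<close>. Sets \<open>S\<close> with at most two
  elements then show that \<open>|E| \<le> n\<close>, that all degrees are at most three, that vertices of degree three
  are pairwise adjacent, and that they lie on the cycle if there is one. Hence they are covered by a
  single edge, whose deletion leaves one or two paths, or they form a triangle.
\<close>

section \<open>Polynomials in restricted sets of variables\<close>

text \<open>For \<open>m = 2\<close> only the inequality \<open>ht \<ge> |E| - 1\<close> restricts
  the graph: it says \<open>c(S) + |E| \<le> n + |S| + 1\<close> for every \<open>S\<close>. The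
  reverse inequality merely rules out paths, whose height is \<open>|E|\<close>: with at least
  \<open>n\<close> edges it follows from \<open>S = {}\<close>, and in a tree with a vertex
  \<open>w\<close> of degree three from \<open>S = {w}\<close>.

  Components are estimated through one invariant. Adding an edge to a graph with edge set
  \<open>F\<close> raises \<open>|F| + c(F)\<close> by zero or one, and by zero exactly when the
  edge joins different components; so \<open>|F| + c(F)\<close> exceeds the number of vertices by
  the number of independent cycles. Deleting a vertex that carries many edges thus forces many
  components, and a cycle that survives the deletion forces one more.

  Heights are handled on chains of primes inside one fixed ring. Eliminating a variable therefore
  means contracting a prime to the polynomials without it and extending the result back to the whole
  ring.\<close>

definition mvar :: "nat \<times> nat \<Rightarrow> ('k::field) mpoly" where
  "mvar v = Poly_Mapping.single (Poly_Mapping.single v 1) 1"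

lemma var_eq_mvar: "var k i = mvar (k, i)"
  by (simp add: var_def mvar_def)

definition mpolys :: "(nat \<times> nat) set \<Rightarrow> ('k::field) mpoly set" where
  "mpolys Z = {p. \<forall>t \<in> Poly_Mapping.keys p. Poly_Mapping.keys t \<subseteq> Z}"

definition grid :: "nat \<Rightarrow> nat \<Rightarrow> (nat \<times> nat) set" where
  "grid m n = {1..m} \<times> {1..n}"

lemma poly_ring_simps:
  "carrier (poly_ring m n) = mpolys (grid m n)"
  "x \<otimes>\<^bsub>poly_ring m n\<^esub> y = x * y" "x \<oplus>\<^bsub>poly_ring m n\<^esub> y = x + y"
  "\<one>\<^bsub>poly_ring m n\<^esub> = 1" "\<zero>\<^bsub>poly_ring m n\<^esub> = 0"
  by (simp_all add: poly_ring_def mpolys_def grid_def)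

lemma mpolys_single: "Poly_Mapping.keys t \<subseteq> Z \<Longrightarrow> Poly_Mapping.single t c \<in> mpolys Z"
  by (auto simp: mpolys_def)

lemma mpolys_const: "Poly_Mapping.single 0 c \<in> mpolys Z"
  by (simp add: mpolys_single)

lemma mpolys_0: "0 \<in> mpolys Z" and mpolys_1: "1 \<in> mpolys Z"
  by (auto simp: mpolys_def)

lemma mpolys_mvar: "v \<in> Z \<Longrightarrow> mvar v \<in> mpolys Z"
  by (auto simp: mpolys_def mvar_def)

lemma mpolys_add: "p \<in> mpolys Z \<Longrightarrow> q \<in> mpolys Z \<Longrightarrow> p + q \<in> mpolys Z"
  using Poly_Mapping.keys_add[of p q] unfolding mpolys_def by fastforce

lemma mpolys_mult: 
  assumes "p \<in> mpolys Z" "q \<in> mpolys Z" shows "p * q \<in> mpolys Z"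
  unfolding mpolys_def
proof safe
  fix t a b assume t: "t \<in> Poly_Mapping.keys (p * q)" "(a, b) \<in> Poly_Mapping.keys t"
  then obtain r s where "t = r + s" "r \<in> Poly_Mapping.keys p" "s \<in> Poly_Mapping.keys q"
    using keys_mult[of p q] by auto
  then show "(a, b) \<in> Z"
    using Poly_Mapping.keys_add[of r s] t(2) assms unfolding mpolys_def by blast
qed

lemma mpolys_uminus: "p \<in> mpolys Z \<Longrightarrow> - p \<in> mpolys Z"
  unfolding mpolys_def by (simp add: in_keys_iff)

lemma mpolys_diff: "p \<in> mpolys Z \<Longrightarrow> q \<in> mpolys Z \<Longrightarrow> p - q \<in> mpolys Z"
  using mpolys_add[OF _ mpolys_uminus, of p Z q] by simp

lemma mpolys_power: "p \<in> mpolys Z \<Longrightarrow> p ^ k \<in> mpolys Z"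
  by (induction k) (auto intro: mpolys_mult mpolys_1)

lemma mpolys_sum: "(\<And>i. i \<in> I \<Longrightarrow> f i \<in> mpolys Z) \<Longrightarrow> sum f I \<in> mpolys Z"
  by (induction I rule: infinite_finite_induct) (auto intro: mpolys_add mpolys_0)

lemma mpolys_mono: "Z \<subseteq> Z' \<Longrightarrow> mpolys Z \<subseteq> mpolys Z'"
  by (auto simp: mpolys_def)

lemmas mpolys_closed = mpolys_const mpolys_0 mpolys_1 mpolys_mvar mpolys_add mpolys_mult
  mpolys_uminus mpolys_diff mpolys_power mpolys_sum

lemma poly_mapping_sum_singles:
  "p = (\<Sum>t\<in>Poly_Mapping.keys p. Poly_Mapping.single t (Poly_Mapping.lookup p t))"
  by (rule poly_mapping_eqI)
     (auto simp: lookup_sum lookup_single when_def in_keys_iff sum.If_cases)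

text \<open>The case \<open>single\<close> is restricted to monomials of \<open>p\<close> itself, so
  that a condition on the support of \<open>p\<close>, such as membership in
  \<open>mpolys Z\<close>, remains available there.\<close>

lemma poly_mapping_add_induct [case_names zero single add]:
  fixes p :: "'a \<Rightarrow>\<^sub>0 'b::comm_monoid_add"
  assumes "P 0" "\<And>t c. t \<in> Poly_Mapping.keys p \<Longrightarrow> P (Poly_Mapping.single t c)"
    "\<And>a b. P a \<Longrightarrow> P b \<Longrightarrow> P (a + b)"
  shows "P p"
proof -
  have "P (\<Sum>t\<in>T. Poly_Mapping.single t (Poly_Mapping.lookup p t))"
    if "finite T" "T \<subseteq> Poly_Mapping.keys p" for T
    using that by (induction T rule: finite_induct) (auto intro: assms)
  then show ?thesis
    by (metis poly_mapping_sum_singles finite_keys subset_refl)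
qed

lemma single_as_prod:
  "Poly_Mapping.single t c = Poly_Mapping.single 0 c *
     (\<Prod>v\<in>Poly_Mapping.keys t. mvar v ^ Poly_Mapping.lookup t v)"
proof -
  have pow: "(mvar v :: 'a mpoly) ^ k = Poly_Mapping.single (Poly_Mapping.single v k) 1" for v k
  proof (induction k)
    case (Suc k)
    then show ?case by (simp add: mvar_def mult_single single_add[symmetric])
  qed simp
  have "(\<Prod>v\<in>T. (mvar v :: 'a mpoly) ^ Poly_Mapping.lookup t v) =
      Poly_Mapping.single (\<Sum>v\<in>T. Poly_Mapping.single v (Poly_Mapping.lookup t v)) 1" for T
    by (induction T rule: infinite_finite_induct) (auto simp: pow mult_single)
  then show ?thesis
    by (simp add: mult_single flip: poly_mapping_sum_singles[of t])
qed

text \<open>\<open>mpolys Z\<close> is the \<open>K\<close>-algebra generated by the variables in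
  \<open>Z\<close>, so identities between homomorphisms and closure under coefficients need checking
  on generators only.\<close>

lemma mpolys_induct [consumes 1, case_names const mvar add mult]:
  assumes p: "p \<in> mpolys Z"
    and const: "\<And>c. P (Poly_Mapping.single 0 c)" and mvar: "\<And>v. v \<in> Z \<Longrightarrow> P (mvar v)"
    and add: "\<And>a b. a \<in> mpolys Z \<Longrightarrow> b \<in> mpolys Z \<Longrightarrow> P a \<Longrightarrow> P b \<Longrightarrow> P (a + b)"
    and mult: "\<And>a b. a \<in> mpolys Z \<Longrightarrow> b \<in> mpolys Z \<Longrightarrow> P a \<Longrightarrow> P b \<Longrightarrow> P (a * b)"
  shows "P p"
proof -
  have one: "P 1" using const[of 1] by simp
  have pow: "P (mvar v ^ k)" if "v \<in> Z" for v k
    by (induction k) (auto intro!: one mult mvar mpolys_closed that)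
  have pr: "P (\<Prod>v\<in>T. mvar v ^ e v) \<and> (\<Prod>v\<in>T. mvar v ^ e v) \<in> (mpolys Z :: 'a mpoly set)"
    if "T \<subseteq> Z" for T and e :: "nat \<times> nat \<Rightarrow> nat"
    using that
    by (induction T rule: infinite_finite_induct) (auto intro!: one mult pow mpolys_closed)
  \<comment> \<open>Membership is carried along because \<open>add\<close> and \<open>mult\<close>
    demand it of both arguments.\<close>
  have "P p \<and> p \<in> mpolys Z"
  proof (induction p rule: poly_mapping_add_induct)
    case zero
    show ?case using const[of 0] by (auto intro: mpolys_0)
  next
    case (single t c)
    have t: "Poly_Mapping.keys t \<subseteq> Z" using single p by (auto simp: mpolys_def)
    show ?case
      unfolding single_as_prod[of t c] using pr[OF t, of "Poly_Mapping.lookup t"]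
      by (auto intro!: mult const mpolys_closed)
  qed (auto intro!: add mpolys_closed)
  then show ?thesis by simp
qed

text \<open>The homomorphism that is \<open>c\<close> on constants and sends the variable
  \<open>v\<close> to \<open>h v\<close>. The target is left open since two are needed: univariate
  polynomials over \<open>'k mpoly\<close>, to single out one variable, and \<open>'k mpoly\<close>
  itself, for substitutions.\<close>

locale mpoly_eval =
  fixes c :: "'k::field \<Rightarrow> 'b::comm_ring_1" and h :: "nat \<times> nat \<Rightarrow> 'b"
  assumes c_add: "c (x + y) = c x + c y" and c_mult: "c (x * y) = c x * c y" and c_1: "c 1 = 1"
begin

lemma c_0: "c 0 = 0"
  using c_add[of 0 0] by simp

definition eval_mon :: "((nat \<times> nat) \<Rightarrow>\<^sub>0 nat) \<Rightarrow> 'b" where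
  "eval_mon t = (\<Prod>v\<in>Poly_Mapping.keys t. h v ^ Poly_Mapping.lookup t v)"

definition eval :: "'k mpoly \<Rightarrow> 'b" where
  "eval p = (\<Sum>t\<in>Poly_Mapping.keys p. c (Poly_Mapping.lookup p t) * eval_mon t)"

lemma eval_mon_superset:
  "finite T \<Longrightarrow> Poly_Mapping.keys t \<subseteq> T \<Longrightarrow> eval_mon t = (\<Prod>v\<in>T. h v ^ Poly_Mapping.lookup t v)"
  unfolding eval_mon_def by (rule prod.mono_neutral_left) (auto simp: in_keys_iff)

lemma eval_mon_add: "eval_mon (s + t) = eval_mon s * eval_mon t"
proof -
  let ?T = "Poly_Mapping.keys s \<union> Poly_Mapping.keys t"
  show ?thesis
    using Poly_Mapping.keys_add[of s t] eval_mon_superset[of ?T s] eval_mon_superset[of ?T t]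
      eval_mon_superset[of ?T "s + t"]
    by (simp add: lookup_add power_add prod.distrib)
qed

lemma eval_superset:
  "finite T \<Longrightarrow> Poly_Mapping.keys p \<subseteq> T \<Longrightarrow>
    eval p = (\<Sum>t\<in>T. c (Poly_Mapping.lookup p t) * eval_mon t)"
  unfolding eval_def by (rule sum.mono_neutral_left) (auto simp: in_keys_iff c_0)

lemma eval_add: "eval (p + q) = eval p + eval q"
proof -
  let ?T = "Poly_Mapping.keys p \<union> Poly_Mapping.keys q"
  show ?thesis
    using Poly_Mapping.keys_add[of p q] eval_superset[of ?T p] eval_superset[of ?T q]
      eval_superset[of ?T "p + q"]
    by (simp add: lookup_add c_add distrib_right sum.distrib)
qed

lemma eval_single: "eval (Poly_Mapping.single t a) = c a * eval_mon t"
  by (simp add: eval_def c_0)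

lemma eval_const: "eval (Poly_Mapping.single 0 a) = c a"
  by (simp add: eval_single eval_mon_def)

lemma eval_0: "eval 0 = 0" and eval_1: "eval 1 = 1"
  using eval_const[of 1] by (simp_all add: eval_def c_1)

lemma eval_mvar: "eval (mvar v) = h v"
  by (simp add: mvar_def eval_single eval_mon_def c_1)

lemma eval_mult: "eval (p * q) = eval p * eval q"
proof (induction p rule: poly_mapping_add_induct)
  case (single s a)
  show ?case
    by (induction q rule: poly_mapping_add_induct)
       (simp_all add: eval_0 eval_single mult_single eval_mon_add c_mult eval_add algebra_simps)
qed (simp_all add: eval_0 eval_add algebra_simps)

lemma eval_uminus: "eval (- p) = - eval p"
  using eval_add[of p "- p"] by (simp add: eval_0 add_eq_0_iff)

lemma eval_diff: "eval (p - q) = eval p - eval q"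
  using eval_add[of p "- q"] by (simp add: eval_uminus)

lemmas eval_simps = eval_add eval_const eval_0 eval_1 eval_mvar eval_mult eval_uminus eval_diff

end

section \<open>Ideals and prime ideals of the polynomial ring as plain sets of polynomials\<close>

lemma ideal_poly_ringI:
  assumes "I \<subseteq> mpolys (grid m n)" "0 \<in> I" "\<And>a b. a \<in> I \<Longrightarrow> b \<in> I \<Longrightarrow> a + b \<in> I"
    and mult: "\<And>r a. r \<in> mpolys (grid m n) \<Longrightarrow> a \<in> I \<Longrightarrow> r * a \<in> I"
  shows "ideal I (poly_ring m n)"
proof -
  interpret cring "poly_ring m n :: 'a mpoly ring" by (rule poly_ring_cring)
  have neg: "\<ominus>\<^bsub>poly_ring m n\<^esub> a = - a" if "a \<in> mpolys (grid m n)" for a :: "'a mpoly"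
    by (rule minus_equality) (auto simp: poly_ring_simps that mpolys_closed)
  show ?thesis
  proof (rule idealI[OF cring.axioms(1)[OF poly_ring_cring]])
    have "- a \<in> I" if "a \<in> I" for a
      using mult[OF _ that, of "- 1"] by (simp add: mpolys_closed)
    then show "subgroup I (add_monoid (poly_ring m n))"
      using assms neg by (intro add.subgroupI) (auto simp: poly_ring_simps a_inv_def[symmetric])
    show "a \<otimes>\<^bsub>poly_ring m n\<^esub> r \<in> I" if "a \<in> I" "r \<in> carrier (poly_ring m n)" for a r
      using mult[of r a] that by (simp add: poly_ring_simps mult.commute)
  qed (use mult in \<open>auto simp: poly_ring_simps\<close>)
qed

lemma ideal_poly_ringD:
  assumes "ideal I (poly_ring m n)"
  shows "I \<subseteq> mpolys (grid m n)" "0 \<in> I" "\<And>a b. a \<in> I \<Longrightarrow> b \<in> I \<Longrightarrow> a + b \<in> I"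
    "\<And>r a. r \<in> mpolys (grid m n) \<Longrightarrow> a \<in> I \<Longrightarrow> r * a \<in> I"
    "\<And>a. a \<in> I \<Longrightarrow> - a \<in> I" "\<And>a b. a \<in> I \<Longrightarrow> b \<in> I \<Longrightarrow> a - b \<in> I"
    "\<And>f A. (\<And>i. i \<in> A \<Longrightarrow> f i \<in> I) \<Longrightarrow> sum f A \<in> I"
proof -
  interpret ideal I "poly_ring m n" by (rule assms)
  show "I \<subseteq> mpolys (grid m n)" and zero: "0 \<in> I"
    using a_subset additive_subgroup.zero_closed[OF is_additive_subgroup]
    by (auto simp: poly_ring_simps)
  show add: "a + b \<in> I" if "a \<in> I" "b \<in> I" for a b
    using additive_subgroup.a_closed[OF is_additive_subgroup that] by (simp add: poly_ring_simps)
  show mult: "r * a \<in> I" if "r \<in> mpolys (grid m n)" "a \<in> I" for r a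
    using I_l_closed[of a r] that by (simp add: poly_ring_simps)
  show neg: "- a \<in> I" if "a \<in> I" for a
    using mult[OF _ that, of "- 1"] by (simp add: mpolys_closed)
  show "a - b \<in> I" if "a \<in> I" "b \<in> I" for a b
    using add[OF that(1) neg[OF that(2)]] by simp
  show "sum f A \<in> I" if "\<And>i. i \<in> A \<Longrightarrow> f i \<in> I" for f :: "'c \<Rightarrow> _" and A
    using that by (induction A rule: infinite_finite_induct) (auto intro: zero add)
qed

lemma primeideal_poly_ringI:
  assumes "ideal P (poly_ring m n)" "1 \<notin> P"
    and "\<And>a b. a \<in> mpolys (grid m n) \<Longrightarrow> b \<in> mpolys (grid m n) \<Longrightarrow> a * b \<in> P \<Longrightarrow>
      a \<in> P \<or> b \<in> P"
  shows "primeideal P (poly_ring m n)"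
  using assms by (intro primeidealI poly_ring_cring) (auto simp: poly_ring_simps mpolys_1)

lemma primeideal_poly_ringD:
  assumes "primeideal P (poly_ring m n)"
  shows "ideal P (poly_ring m n)" "1 \<notin> P"
    "\<And>a b. a \<in> mpolys (grid m n) \<Longrightarrow> b \<in> mpolys (grid m n) \<Longrightarrow> a * b \<in> P \<Longrightarrow>
      a \<in> P \<or> b \<in> P"
proof -
  interpret primeideal P "poly_ring m n" by (rule assms)
  show "ideal P (poly_ring m n)" by (rule is_ideal)
  show "1 \<notin> P"
    using I_notcarr one_imp_carrier by (auto simp: poly_ring_simps)
  show "a \<in> P \<or> b \<in> P" if "a \<in> mpolys (grid m n)" "b \<in> mpolys (grid m n)" "a * b \<in> P" for a b
    using I_prime[of a b] that by (simp add: poly_ring_simps)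
qed

section \<open>Lower bounds for the height of a prime\<close>

text \<open>The identification of \<open>R\<close> with \<open>R'[x_v]\<close>, where
  \<open>R'\<close> is the ring in the other variables. The coefficients keep the type
  \<open>'k mpoly\<close>, so that they can be tested for membership in an ideal of
  \<open>R\<close>.\<close>

definition as_poly :: "nat \<times> nat \<Rightarrow> ('k::field) mpoly \<Rightarrow> 'k mpoly poly" where
  "as_poly v = mpoly_eval.eval (\<lambda>a. [:Poly_Mapping.single 0 a:])
     (\<lambda>w. if w = v then [:0, 1:] else [:mvar w:])"

lemma as_poly_hom: "mpoly_eval (\<lambda>a :: 'k::field. [:Poly_Mapping.single 0 a :: 'k mpoly:])"
  by unfold_locales (simp_all add: single_add mult_single mult.commute)

lemmas as_poly_simps =
  mpoly_eval.eval_simps[OF as_poly_hom, where h = "\<lambda>w. if w = v then [:0, 1:] else [:mvar w:]" for v,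
    folded as_poly_def]

lemma as_poly_free: "p \<in> mpolys Z \<Longrightarrow> v \<notin> Z \<Longrightarrow> as_poly v p = [:p:]"
  by (induction rule: mpolys_induct) (auto simp: as_poly_simps)

lemma poly_as_poly: "poly (as_poly v p) (mvar v) = p"
proof -
  have "p \<in> mpolys UNIV" by (simp add: mpolys_def)
  then show ?thesis
    by (induction rule: mpolys_induct) (auto simp: as_poly_simps)
qed

lemma coeff_as_poly_closed: "p \<in> mpolys Z \<Longrightarrow> coeff (as_poly v p) i \<in> mpolys Z"
proof (induction arbitrary: i rule: mpolys_induct)
  case (mult a b)
  then show ?case by (auto simp: as_poly_simps coeff_mult intro!: mpolys_closed)
qed (auto simp: as_poly_simps coeff_pCons intro!: mpolys_closed split: nat.split)

text \<open>The extension to \<open>R\<close> of the contraction of \<open>P\<close> to the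
  polynomials free of \<open>v\<close>. Phrasing it through coefficients avoids a second
  ring.\<close>

definition contract_extend :: "nat \<Rightarrow> nat \<Rightarrow> nat \<times> nat \<Rightarrow> ('k::field) mpoly set \<Rightarrow> 'k mpoly set" where
  "contract_extend m n v P = {p \<in> mpolys (grid m n). \<forall>i. coeff (as_poly v p) i \<in> P}"

text \<open>Extending a prime to a polynomial ring keeps it prime, by the argument of Gauss' lemma: in a
  product, the lowest coefficients outside \<open>P\<close> produce a coefficient outside \<open>P\<close>.\<close>

lemma primeideal_contract_extend:
  assumes P: "primeideal P (poly_ring m n)"
  shows "primeideal (contract_extend m n v P) (poly_ring m n)"
proof -
  note PD = primeideal_poly_ringD[OF P] ideal_poly_ringD[OF primeideal_poly_ringD(1)[OF P]]
  let ?Q = "contract_extend m n v P"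
  show ?thesis
  proof (rule primeideal_poly_ringI[OF ideal_poly_ringI])
    fix r a :: "'a mpoly" assume "r \<in> mpolys (grid m n)" "a \<in> ?Q"
    then show "r * a \<in> ?Q"
      by (auto simp: contract_extend_def as_poly_simps coeff_mult
          intro!: PD(10) PD(7) coeff_as_poly_closed mpolys_mult)
  next
    fix a b :: "'a mpoly"
    assume a: "a \<in> mpolys (grid m n)" and b: "b \<in> mpolys (grid m n)" and ab: "a * b \<in> ?Q"
    show "a \<in> ?Q \<or> b \<in> ?Q"
    proof (rule ccontr)
      assume "\<not> (a \<in> ?Q \<or> b \<in> ?Q)"
      then have ex: "\<exists>i. coeff (as_poly v a) i \<notin> P" "\<exists>j. coeff (as_poly v b) j \<notin> P"
        using a b by (auto simp: contract_extend_def)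
      define i where "i = (LEAST i. coeff (as_poly v a) i \<notin> P)"
      define j where "j = (LEAST j. coeff (as_poly v b) j \<notin> P)"
      have i: "coeff (as_poly v a) i \<notin> P" "\<And>k. k < i \<Longrightarrow> coeff (as_poly v a) k \<in> P"
        unfolding i_def using LeastI_ex[OF ex(1)] not_less_Least by blast+
      have j: "coeff (as_poly v b) j \<notin> P" "\<And>k. k < j \<Longrightarrow> coeff (as_poly v b) k \<in> P"
        unfolding j_def using LeastI_ex[OF ex(2)] not_less_Least by blast+
      let ?t = "\<lambda>k. coeff (as_poly v a) k * coeff (as_poly v b) (i + j - k)"
      have "?t k \<in> P" if "k \<in> {..i + j} - {i}" for k
      proof (cases "k < i")
        case True
        then show ?thesis
          unfolding mult.commute[of "coeff (as_poly v a) k"]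
          by (intro PD(7) coeff_as_poly_closed[OF b] i(2))
      next
        case False
        then have "i + j - k < j" using that by auto
        then show ?thesis using PD(7)[OF coeff_as_poly_closed[OF a] j(2)] by simp
      qed
      then have rest: "(\<Sum>k\<in>{..i + j} - {i}. ?t k) \<in> P" by (rule PD(10))
      have "(\<Sum>k\<le>i + j. ?t k) \<in> P"
        using ab by (auto simp: contract_extend_def as_poly_simps coeff_mult)
      moreover have "(\<Sum>k\<le>i + j. ?t k) = ?t i + (\<Sum>k\<in>{..i + j} - {i}. ?t k)"
        by (rule sum.remove) auto
      ultimately have "?t i \<in> P" using PD(9)[OF _ rest] by fastforce
      then show False
        using PD(3)[OF coeff_as_poly_closed[OF a] coeff_as_poly_closed[OF b]] i(1) j(1) by fastforce
    qed
  qed (use PD in \<open>auto simp: contract_extend_def as_poly_simps coeff_pCons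
         intro!: mpolys_closed split: nat.splits\<close>)
qed

text \<open>A polynomial is a combination, with powers of the variable \<open>v\<close> as
  multipliers, of its coefficients, which lie in \<open>P\<close>.\<close>

lemma contract_extend_subset:
  assumes P: "primeideal P (poly_ring m n)" and v: "v \<in> grid m n"
  shows "contract_extend m n v P \<subseteq> P"
proof
  note PD = ideal_poly_ringD[OF primeideal_poly_ringD(1)[OF P]]
  fix p assume p: "p \<in> contract_extend m n v P"
  have "p = (\<Sum>i\<le>degree (as_poly v p). mvar v ^ i * coeff (as_poly v p) i)"
    using poly_as_poly[of v p] by (simp add: poly_altdef mult.commute)
  moreover have "\<dots> \<in> P"
    using p v by (intro PD(7) PD(4)) (auto simp: contract_extend_def intro: mpolys_closed)
  ultimately show "p \<in> P" by simp
qed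

lemma contract_extend_free:
  "p \<in> P \<Longrightarrow> p \<in> mpolys (grid m n) \<Longrightarrow> p \<in> mpolys Z \<Longrightarrow> v \<notin> Z \<Longrightarrow> 0 \<in> P \<Longrightarrow>
     p \<in> contract_extend m n v P"
  by (auto simp: contract_extend_def as_poly_free coeff_pCons split: nat.split)

text \<open>One contraction per variable. Since \<open>a\<close> and \<open>b\<close> avoid all of
  \<open>X\<close>, the relations of the other variables do not involve \<open>v\<close> and survive
  the contraction along \<open>v\<close>; the relation of \<open>v\<close> itself has the
  coefficient \<open>a\<close> outside \<open>P\<close> and is lost, so the inclusion is
  strict.\<close>

lemma prime_chain_of_linear_relations:
  fixes P :: "('k::field) mpoly set"
  assumes "finite X" "X \<subseteq> grid m n" "primeideal P (poly_ring m n)"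
    and "\<And>v. v \<in> X \<Longrightarrow> \<exists>a b. a \<in> mpolys (grid m n - X) \<and> b \<in> mpolys (grid m n - X) \<and>
      a \<notin> P \<and> a * mvar v + b \<in> P"
  shows "\<exists>Q :: nat \<Rightarrow> 'k mpoly set. (\<forall>i\<le>card X. primeideal (Q i) (poly_ring m n)) \<and>
    (\<forall>i<card X. Q i \<subset> Q (Suc i)) \<and> Q (card X) = P"
  using assms
proof (induction X arbitrary: P rule: finite_induct)
  case empty
  then show ?case by (intro exI[of _ "\<lambda>_. P"]) auto
next
  case (insert v X)
  let ?P' = "contract_extend m n v P"
  note PD = primeideal_poly_ringD[OF insert.prems(2)]
    ideal_poly_ringD[OF primeideal_poly_ringD(1)[OF insert.prems(2)]]
  have v: "v \<in> grid m n" and P': "primeideal ?P' (poly_ring m n)" "?P' \<subseteq> P"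
    using insert.prems(1,2) contract_extend_subset[OF insert.prems(2), of v]
    by (auto intro!: primeideal_contract_extend)
  have "\<exists>Q :: nat \<Rightarrow> 'k mpoly set. (\<forall>i\<le>card X. primeideal (Q i) (poly_ring m n)) \<and>
    (\<forall>i<card X. Q i \<subset> Q (Suc i)) \<and> Q (card X) = ?P'"
  proof (rule insert.IH)
    fix w assume w: "w \<in> X"
    obtain a b where ab: "a \<in> mpolys (grid m n - insert v X)" "b \<in> mpolys (grid m n - insert v X)"
      "a \<notin> P" "a * mvar w + b \<in> P"
      using insert.prems(3)[of w] w by auto
    have "a \<in> mpolys (grid m n - {v})" "b \<in> mpolys (grid m n - {v})"
      "mvar w \<in> mpolys (grid m n - {v})"
      using ab(1,2) mpolys_mono[of "grid m n - insert v X" "grid m n - {v}"] w insert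
      by (auto intro: mpolys_mvar)
    then have "a * mvar w + b \<in> ?P'"
      by (intro contract_extend_free[where Z = "grid m n - {v}"] subsetD[OF PD(4) ab(4)] ab(4) PD(5)
          mpolys_add mpolys_mult) auto
    moreover have "a \<in> mpolys (grid m n - X)" "b \<in> mpolys (grid m n - X)"
      using ab(1,2) mpolys_mono[of "grid m n - insert v X" "grid m n - X"] by auto
    ultimately show "\<exists>a b. a \<in> mpolys (grid m n - X) \<and> b \<in> mpolys (grid m n - X) \<and>
        a \<notin> ?P' \<and> a * mvar w + b \<in> ?P'"
      using ab(3) P'(2) by blast
  qed (use insert P' in auto)
  then obtain Q where Q: "\<forall>i\<le>card X. primeideal (Q i) (poly_ring m n)"
    "\<forall>i<card X. Q i \<subset> Q (Suc i)" "Q (card X) = ?P'" by blast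
  obtain a b where ab: "a \<in> mpolys (grid m n - insert v X)" "b \<in> mpolys (grid m n - insert v X)"
    "a \<notin> P" "a * mvar v + b \<in> P"
    using insert.prems(3)[of v] by auto
  have "coeff (as_poly v (a * mvar v + b)) 1 = a"
    using ab as_poly_free[of a "grid m n - insert v X" v] as_poly_free[of b "grid m n - insert v X" v]
    by (simp add: as_poly_simps)
  then have "a * mvar v + b \<notin> ?P'"
    using ab(3) unfolding contract_extend_def by (metis (mono_tags, lifting) mem_Collect_eq)
  then have "?P' \<subset> P" using P'(2) ab(4) by blast
  then show ?case
    using Q insert.prems(2) insert.hyps
    by (intro exI[of _ "\<lambda>i. if i \<le> card X then Q i else P"])
       (auto simp: le_Suc_eq less_Suc_eq Suc_le_eq)
qed

lemma prime_height_of_linear_relations: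
  fixes P :: "('k::field) mpoly set"
  assumes "finite X" "X \<subseteq> grid m n" "primeideal P (poly_ring m n)"
    and "\<And>v. v \<in> X \<Longrightarrow> \<exists>a b. a \<in> mpolys (grid m n - X) \<and> b \<in> mpolys (grid m n - X) \<and>
      a \<notin> P \<and> a * mvar v + b \<in> P"
  shows "enat (card X) \<le> prime_height (poly_ring m n) P"
  unfolding prime_height_def
  using prime_chain_of_linear_relations[OF assms] by (intro Sup_upper) blast

section \<open>Upper bounds for the height of a prime\<close>

text \<open>Gaussian elimination, one equation at a time: the \<open>j\<close>-th equation is solved
  for a pivot unknown \<open>p\<close>, which leaves one equation and one unknown fewer. Both the
  count of monomials and the count of generators rest on it.\<close>

lemma homogeneous_system_nontrivial_solution:
  fixes a :: "'j \<Rightarrow> 'i \<Rightarrow> 'k::field"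
  assumes "finite J" "finite I" "card J < card I"
  shows "\<exists>x. (\<exists>i\<in>I. x i \<noteq> 0) \<and> (\<forall>j\<in>J. (\<Sum>i\<in>I. a j i * x i) = 0)"
  using assms
proof (induction J arbitrary: I a rule: finite_induct)
  case empty
  then obtain i where "i \<in> I" by fastforce
  then show ?case by (intro exI[of _ "\<lambda>_. 1"]) auto
next
  case (insert j J)
  show ?case
  proof (cases "\<forall>i\<in>I. a j i = 0")
    case True
    then show ?thesis using insert.IH[of I a] insert.prems insert.hyps by auto
  next
    case False
    then obtain p where p: "p \<in> I" "a j p \<noteq> 0" by blast
    let ?I = "I - {p}"
    have "card J < card ?I" using insert p by simp
    from insert.IH[OF _ this, of "\<lambda>j' i. a j' i - a j' p * a j i / a j p"] obtain x where
      x: "\<exists>i\<in>?I. x i \<noteq> 0" "\<forall>j'\<in>J. (\<Sum>i\<in>?I. (a j' i - a j' p * a j i / a j p) * x i) = 0"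
      using insert by auto
    \<comment> \<open>The value at the pivot is the one dictated by the \<open>j\<close>-th
      equation.\<close>
    define y where "y = (\<lambda>i. if i = p then - (\<Sum>i\<in>?I. a j i * x i) / a j p else x i)"
    have split: "(\<Sum>i\<in>I. a j' i * y i) =
        a j' p * (- (\<Sum>i\<in>?I. a j i * x i) / a j p) + (\<Sum>i\<in>?I. a j' i * x i)" for j'
      using insert.prems(1) p by (subst sum.remove[of _ p]) (auto simp: y_def)
    have "(\<Sum>i\<in>I. a j' i * y i) = 0" if "j' \<in> J" for j'
    proof -
      have "(\<Sum>i\<in>?I. (a j' i - a j' p * a j i / a j p) * x i) =
          (\<Sum>i\<in>?I. a j' i * x i) - a j' p * (\<Sum>i\<in>?I. a j i * x i) / a j p"
        by (simp add: left_diff_distrib sum_subtractf sum_distrib_left sum_divide_distrib mult.assoc)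
      then show ?thesis using x(2) that by (simp add: split)
    qed
    moreover have "(\<Sum>i\<in>I. a j i * y i) = 0" using p by (simp add: split)
    moreover have "\<exists>i\<in>I. y i \<noteq> 0" using x(1) by (auto simp: y_def)
    ultimately show ?thesis by blast
  qed
qed

text \<open>Each exponent is bounded separately and strictly, so that the number of monomials is a
  power of \<open>D\<close>.\<close>

definition monomials :: "'v set \<Rightarrow> nat \<Rightarrow> ('v \<Rightarrow>\<^sub>0 nat) set" where
  "monomials Y D = {t. Poly_Mapping.keys t \<subseteq> Y \<and> (\<forall>v. Poly_Mapping.lookup t v < D)}"

lemma card_monomials:
  assumes "finite Y" "D > 0"
  shows "finite (monomials Y D)" "card (monomials Y D) = D ^ card Y"
proof -
  have fin: "finite {x. (if x \<in> Y then f x else (0::nat)) \<noteq> 0}" for f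
    by (rule finite_subset[OF _ assms(1)]) auto
  have look: "Poly_Mapping.lookup (Abs_poly_mapping (\<lambda>v. if v \<in> Y then f v else 0)) =
      (\<lambda>v. if v \<in> Y then f v else (0::nat))" for f
    by (rule lookup_Abs_poly_mapping[OF fin])
  have "bij_betw (\<lambda>t. restrict (Poly_Mapping.lookup t) Y) (monomials Y D) (Y \<rightarrow>\<^sub>E {..<D})"
    by (rule bij_betw_byWitness[where f' = "\<lambda>f. Abs_poly_mapping (\<lambda>v. if v \<in> Y then f v else 0)"])
       (auto simp: monomials_def look in_keys_iff assms(2) fun_eq_iff PiE_def extensional_def
         intro!: poly_mapping_eqI split: if_splits)
  then show "finite (monomials Y D)" "card (monomials Y D) = D ^ card Y"
    using assms(1) by (auto simp: bij_betw_finite finite_PiE bij_betw_same_card card_PiE)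
qed

definition exponents_le :: "nat \<Rightarrow> (('v \<Rightarrow>\<^sub>0 nat) \<Rightarrow>\<^sub>0 'k::comm_ring_1) \<Rightarrow> bool" where
  "exponents_le d p \<longleftrightarrow> (\<forall>t\<in>Poly_Mapping.keys p. \<forall>v. Poly_Mapping.lookup t v \<le> d)"

lemma exponents_le_mult:
  assumes "exponents_le d p" "exponents_le e q" shows "exponents_le (d + e) (p * q)"
  unfolding exponents_le_def
proof (intro ballI allI)
  fix t v assume "t \<in> Poly_Mapping.keys (p * q)"
  then obtain r s where "t = r + s" "r \<in> Poly_Mapping.keys p" "s \<in> Poly_Mapping.keys q"
    using keys_mult[of p q] by auto
  then show "Poly_Mapping.lookup t v \<le> d + e"
    using assms by (auto simp: exponents_le_def lookup_add intro!: add_mono)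
qed

lemma exponents_le_power: "exponents_le d p \<Longrightarrow> exponents_le (k * d) (p ^ k)"
  by (induction k) (simp_all add: exponents_le_mult exponents_le_def[of _ 1])

lemma exponents_le_exists: "\<exists>d. \<forall>i<(k::nat). exponents_le d (f i)"
proof (intro exI allI impI)
  fix i assume i: "i < k"
  \<comment> \<open>The sum of all exponents that occur anywhere is a crude common bound.\<close>
  let ?d = "\<Sum>i<k. \<Sum>t\<in>Poly_Mapping.keys (f i). \<Sum>v\<in>Poly_Mapping.keys t. Poly_Mapping.lookup t v"
  show "exponents_le ?d (f i)"
    unfolding exponents_le_def
  proof (intro ballI allI)
    fix t v assume t: "t \<in> Poly_Mapping.keys (f i)"
    have "Poly_Mapping.lookup t v \<le> (\<Sum>v\<in>Poly_Mapping.keys t. Poly_Mapping.lookup t v)"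
    proof (cases "v \<in> Poly_Mapping.keys t")
      case True
      then show ?thesis using member_le_sum[of v "Poly_Mapping.keys t" "Poly_Mapping.lookup t"] by simp
    qed (simp add: in_keys_iff)
    also have "\<dots> \<le> (\<Sum>t\<in>Poly_Mapping.keys (f i). \<Sum>v\<in>Poly_Mapping.keys t. Poly_Mapping.lookup t v)"
      by (rule member_le_sum) (use t in auto)
    also have "\<dots> \<le> ?d"
      using i by (intro member_le_sum[of i "{..<k}"
        "\<lambda>i. \<Sum>t\<in>Poly_Mapping.keys (f i). \<Sum>v\<in>Poly_Mapping.keys t. Poly_Mapping.lookup t v"]) auto
    finally show "Poly_Mapping.lookup t v \<le> ?d" .
  qed
qed

text \<open>Exponent vectors are lists so that an induction along a chain of primes can strip the
  first witness together with its exponent.\<close>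

fun power_product :: "(nat \<Rightarrow> 'b::comm_ring_1) \<Rightarrow> nat list \<Rightarrow> 'b" where
  "power_product f [] = 1"
| "power_product f (x # xs) = f 0 ^ x * power_product (\<lambda>i. f (Suc i)) xs"

lemma power_product_closed:
  "(\<And>i. i < length xs \<Longrightarrow> f i \<in> mpolys Z) \<Longrightarrow> power_product f xs \<in> mpolys Z"
  by (induction xs arbitrary: f) (auto intro!: mpolys_closed)

lemma exponents_le_power_product:
  "(\<And>i. i < length xs \<Longrightarrow> exponents_le d (f i)) \<Longrightarrow>
    exponents_le (sum_list xs * d) (power_product f xs)"
proof (induction xs arbitrary: f)
  case (Cons x xs)
  have "exponents_le (sum_list xs * d) (power_product (\<lambda>i. f (Suc i)) xs)"
    by (rule Cons.IH) (use Cons.prems in auto)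
  moreover have "exponents_le (x * d) (f 0 ^ x)"
    using Cons.prems[of 0] by (auto intro: exponents_le_power)
  ultimately show ?case
    using exponents_le_mult by (fastforce simp: distrib_right)
qed (simp add: exponents_le_def)

text \<open>Elements witnessing the strict inclusions of a chain of primes are algebraically independent:
  in a relation whose value lies in the smallest prime one may cancel the lowest power of the first
  witness, and what remains without that witness lies in the next prime of the chain.\<close>

lemma chain_witnesses_independent:
  fixes Q :: "nat \<Rightarrow> ('k::field) mpoly set"
  assumes "\<And>i. i \<le> k \<Longrightarrow> primeideal (Q i) (poly_ring m n)"
    and "\<And>i. i < k \<Longrightarrow> Q i \<subseteq> Q (Suc i)" "\<And>i. i < k \<Longrightarrow> f i \<in> Q (Suc i)" "\<And>i. i < k \<Longrightarrow> f i \<notin> Q i"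
    and "finite A" "\<And>a. a \<in> A \<Longrightarrow> length a = k"
    and "\<And>a. a \<in> A \<Longrightarrow> c a \<in> mpolys (grid m n)" "\<And>a. a \<in> A \<Longrightarrow> c a \<in> Q k \<Longrightarrow> c a = 0"
    and "(\<Sum>a\<in>A. c a * power_product f a) \<in> Q 0" "a \<in> A"
  shows "c a = 0"
  using assms
proof (induction k arbitrary: Q f A c a)
  case 0
  \<comment> \<open>Without witnesses the relation consists of a single coefficient in
    \<open>Q 0\<close>, which is now also the largest prime \<open>Q k\<close>.\<close>
  then have "A = {[]}" by auto
  with 0 show ?case by auto
next
  case (Suc k)
  note prems = Suc.prems
  note PD = primeideal_poly_ringD[OF prems(1)] ideal_poly_ringD[OF primeideal_poly_ringD(1)[OF prems(1)]]
  have fc: "f i \<in> mpolys (grid m n)" if "i < Suc k" for i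
    using prems(3)[OF that] PD(4)[of "Suc i"] that by auto
  have ppc: "power_product (\<lambda>i. f (Suc i)) (tl a) \<in> mpolys (grid m n)" if "a \<in> A" for a
    using prems(6)[OF that] fc by (intro power_product_closed) auto
  show ?case
  proof (rule ccontr)
    assume "c a \<noteq> 0"
    define x where "x = (LEAST x. \<exists>a\<in>A. hd a = x \<and> c a \<noteq> 0)"
    have "\<exists>a\<in>A. hd a = x \<and> c a \<noteq> 0"
      unfolding x_def by (rule LeastI[of _ "hd a"]) (use prems \<open>c a \<noteq> 0\<close> in auto)
    then obtain a' where a': "a' \<in> A" "hd a' = x" "c a' \<noteq> 0" by blast
    have below: "c a = 0" if "a \<in> A" "hd a < x" for a
      using not_less_Least[of "hd a" "\<lambda>x. \<exists>a\<in>A. hd a = x \<and> c a \<noteq> 0"] that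
      unfolding x_def[symmetric] by auto
    let ?p = "\<lambda>a. power_product (\<lambda>i. f (Suc i)) (tl a)"
    have Cons: "a = hd a # tl a" if "a \<in> A" for a
      using prems(6)[OF that] by (cases a) auto
    have pp: "power_product f a = f 0 ^ hd a * ?p a" if "a \<in> A" for a
      by (subst Cons[OF that]) simp
    \<comment> \<open>After division by \<open>f 0 ^ x\<close>, \<open>?h\<close> collects the terms
      free of \<open>f 0\<close>, and \<open>?g\<close> is the quotient of the remaining ones by
      \<open>f 0\<close>. As \<open>f 0\<close> lies in \<open>Q 1\<close>, only \<open>?h\<close>
      is left modulo \<open>Q 1\<close>.\<close>
    let ?g = "\<lambda>a. if hd a > x then c a * (f 0 ^ (hd a - Suc x) * ?p a) else 0"
    let ?h = "\<lambda>a. if hd a = x then c a * ?p a else 0"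
    have "c a * power_product f a = f 0 ^ x * (?h a + f 0 * ?g a)" if a: "a \<in> A" for a
    proof -
      consider "hd a < x" | "hd a = x" | "hd a > x" by linarith
      then show ?thesis
      proof cases
        case 1
        then show ?thesis using below[OF a] by simp
      next
        case 2
        then show ?thesis by (simp add: pp[OF a])
      next
        case 3
        then have "f 0 ^ hd a = f 0 ^ x * (f 0 * f 0 ^ (hd a - Suc x))"
          by (metis Suc_leI le_add_diff_inverse mult.assoc power_Suc2 power_add)
        then show ?thesis using 3 by (simp add: pp[OF a] ac_simps)
      qed
    qed
    then have "(\<Sum>a\<in>A. c a * power_product f a) = f 0 ^ x * (sum ?h A + f 0 * sum ?g A)"
      by (simp add: sum_distrib_left sum.distrib distrib_left)
    then have prod: "f 0 ^ x * (sum ?h A + f 0 * sum ?g A) \<in> Q 0" using prems(9) by simp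
    have gh: "sum ?h A \<in> mpolys (grid m n)" "sum ?g A \<in> mpolys (grid m n)"
      using ppc prems(7) fc[of 0] by (auto intro!: mpolys_closed)
    have "f 0 ^ y \<notin> Q 0" for y
    proof (induction y)
      case (Suc y)
      then show ?case using PD(3)[of 0 "f 0" "f 0 ^ y"] prems(4)[of 0] fc[of 0]
        by (auto intro: mpolys_closed)
    qed (use PD(2)[of 0] in simp)
    then have "sum ?h A + f 0 * sum ?g A \<in> Q 0"
      using PD(3)[OF _ _ _ prod] gh fc[of 0] by (auto intro: mpolys_closed)
    then have "sum ?h A + f 0 * sum ?g A \<in> Q 1" using prems(2)[of 0] by auto
    moreover have "sum ?g A * f 0 \<in> Q 1" using PD(7)[OF _ gh(2)] prems(3)[of 0] by simp
    ultimately have h: "sum ?h A \<in> Q 1"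
      using PD(9)[of 1 "sum ?h A + f 0 * sum ?g A" "f 0 * sum ?g A"] by (simp add: mult.commute)
    \<comment> \<open>Dropping the common head \<open>x\<close> turns \<open>?h\<close> into a
      relation for the shifted chain, with one witness fewer.\<close>
    let ?B = "(\<lambda>b. x # b) -` A"
    have A_x: "{a \<in> A. hd a = x} = (\<lambda>b. x # b) ` ?B"
      using Cons by (auto simp: image_iff)
    have "sum ?h A = (\<Sum>a\<in>{a \<in> A. hd a = x}. c a * ?p a)"
      using prems(5) by (simp add: sum.If_cases Int_def)
    also have "\<dots> = (\<Sum>b\<in>?B. c (x # b) * power_product (\<lambda>i. f (Suc i)) b)"
      unfolding A_x by (subst sum.reindex) (auto intro: inj_onI)
    finally have "(\<Sum>b\<in>?B. c (x # b) * power_product (\<lambda>i. f (Suc i)) b) \<in> Q (Suc 0)"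
      using h by simp
    moreover have "length b = k" if "x # b \<in> A" for b
      using prems(6)[OF that] by simp
    ultimately have "c (x # tl a') = 0"
      using prems Cons[OF a'(1)] a'(1,2)
      by (intro Suc.IH[of "\<lambda>i. Q (Suc i)" "\<lambda>i. f (Suc i)" ?B "\<lambda>b. c (x # b)" "tl a'"])
         (auto intro: finite_vimageI simp: inj_def)
    then show False using a' Cons[OF a'(1)] by simp
  qed
qed

lemma lookup_const_mult:
  "Poly_Mapping.lookup (Poly_Mapping.single 0 c * p) t = c * Poly_Mapping.lookup p t"
  for p :: "'v::comm_monoid_add \<Rightarrow>\<^sub>0 'k::field"
  unfolding mult_map_scale_conv_mult[symmetric] by (simp add: map.rep_eq when_def)

text \<open>A dimension count in place of transcendence degree: the products of powers of the
  \<open>f i\<close> and of variables in \<open>Y\<close>, all exponents below \<open>D\<close>,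
  number \<open>D ^ (k + card Y)\<close>, but they are combinations of only
  \<open>(C * D) ^ card Z\<close> monomials. As \<open>k + card Y > card Z\<close>, a large
  \<open>D\<close> forces a linear relation.\<close>

lemma power_product_monomial_relation:
  fixes f :: "nat \<Rightarrow> ('k::field) mpoly"
  assumes f: "\<And>i. i < k \<Longrightarrow> f i \<in> mpolys Z" "\<And>i. i < k \<Longrightarrow> exponents_le d (f i)"
    and Y: "Y \<subseteq> Z" and Z: "finite Z" "card Z < k + card Y"
  shows "\<exists>A c. finite A \<and> (\<forall>a\<in>A. length a = k \<and> c a \<in> mpolys Y) \<and>
    (\<exists>a\<in>A. c a \<noteq> 0) \<and> (\<Sum>a\<in>A. c a * power_product f a) = 0"
proof -
  \<comment> \<open>In each variable the powers of the \<open>f i\<close> contribute an exponent at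
    most \<open>k * D * d\<close>, and the monomial in \<open>Y\<close> one below \<open>D\<close>,
    whence \<open>C\<close>. The choice of \<open>D\<close> gives
    \<open>C ^ card Z * D ^ card Z < D ^ (card Z + 1)\<close>.\<close>
  define C where "C = k * d + 1"
  define D where "D = C ^ card Z + 1"
  define A where "A = {a :: nat list. set a \<subseteq> {..<D} \<and> length a = k}"
  let ?I = "A \<times> monomials Y D" and ?J = "monomials Z (C * D)"
  let ?v = "\<lambda>(a, t). power_product f a * Poly_Mapping.single t 1"
  have finY: "finite Y" using Y Z(1) finite_subset by auto
  have A: "finite A" "card A = D ^ k"
    unfolding A_def by (simp_all add: finite_lists_length_eq card_lists_length_eq)
  have pos: "D > 0" "C > 0" by (simp_all add: D_def C_def)
  note mY = card_monomials[OF finY pos(1)]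
  have fin: "finite ?I" "finite ?J" using A mY card_monomials[OF Z(1)] pos by auto
  have "card ?J = C ^ card Z * D ^ card Z"
    using card_monomials(2)[OF Z(1), of "C * D"] pos by (simp add: power_mult_distrib)
  also have "\<dots> < D * D ^ card Z" using pos by (intro mult_strict_right_mono) (auto simp: D_def)
  also have "\<dots> = D ^ Suc (card Z)" by simp
  also have "\<dots> \<le> D ^ (k + card Y)" using Z(2) pos by (intro power_increasing) auto
  also have "\<dots> = card ?I" using A mY by (simp add: card_cartesian_product power_add)
  finally have "card ?J < card ?I" .
  from homogeneous_system_nontrivial_solution[OF fin(2,1) this, of "\<lambda>j i. Poly_Mapping.lookup (?v i) j"]
  obtain x where x: "\<exists>i\<in>?I. x i \<noteq> 0" "\<forall>j\<in>?J. (\<Sum>i\<in>?I. Poly_Mapping.lookup (?v i) j * x i) = 0"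
    by blast
  have keys: "j \<in> ?J" if at: "(a, t) \<in> ?I" and j: "j \<in> Poly_Mapping.keys (?v (a, t))" for a t j
  proof -
    have a: "length a = k" "set a \<subseteq> {..<D}" and t: "t \<in> monomials Y D" using at by (auto simp: A_def)
    have "power_product f a \<in> mpolys Z" using f(1) a by (intro power_product_closed) auto
    moreover have "exponents_le (sum_list a * d) (power_product f a)"
      using f(2) a by (intro exponents_le_power_product) auto
    moreover obtain s where "j = s + t" "s \<in> Poly_Mapping.keys (power_product f a)"
      using j keys_mult[of "power_product f a" "Poly_Mapping.single t 1"] by auto
    ultimately have s: "j = s + t" "Poly_Mapping.keys s \<subseteq> Z"
        "\<And>v. Poly_Mapping.lookup s v \<le> sum_list a * d"
      by (auto simp: mpolys_def exponents_le_def)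
    have "sum_list a \<le> k * D"
      using sum_list_mono[of a "\<lambda>x. x" "\<lambda>_. D"] a by (force simp: sum_list_triv)
    then have "sum_list a * d \<le> k * D * d" by simp
    then have "Poly_Mapping.lookup j v < C * D" for v
    proof -
      have "Poly_Mapping.lookup t v < D" using t unfolding monomials_def by blast
      then have "Poly_Mapping.lookup j v < k * D * d + D"
        using s(3)[of v] \<open>sum_list a * d \<le> k * D * d\<close> unfolding s(1) lookup_add by linarith
      then show ?thesis by (simp add: C_def algebra_simps)
    qed
    moreover have "Poly_Mapping.keys j \<subseteq> Z"
      using s(2) Poly_Mapping.keys_add[of s t] t Y unfolding s(1) monomials_def by blast
    ultimately show ?thesis by (simp add: monomials_def)
  qed
  \<comment> \<open>Grouping the scalar relation by the exponents of the \<open>f i\<close> produces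
    coefficients that are polynomials in the variables \<open>Y\<close>.\<close>
  define c where "c = (\<lambda>a. \<Sum>t\<in>monomials Y D. Poly_Mapping.single t (x (a, t)))"
  have c_lookup: "Poly_Mapping.lookup (c a) t = x (a, t)" if "t \<in> monomials Y D" for a t
    using that mY(1) by (simp add: c_def lookup_sum lookup_single when_def)
  have single_eq: "Poly_Mapping.single t e * p = Poly_Mapping.single 0 e * (p * Poly_Mapping.single t 1)"
    for t e and p :: "'k mpoly"
    by (simp add: mult.left_commute[of _ p] mult_single mult.commute[of p])
  have "(\<Sum>a\<in>A. c a * power_product f a) =
      (\<Sum>a\<in>A. \<Sum>t\<in>monomials Y D. Poly_Mapping.single 0 (x (a, t)) * ?v (a, t))"
    unfolding c_def sum_distrib_right prod.case by (intro sum.cong refl single_eq)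
  also have "\<dots> = (\<Sum>i\<in>?I. Poly_Mapping.single 0 (x i) * ?v i)"
    unfolding sum.cartesian_product by (rule sum.cong) auto
  also have "\<dots> = 0"
  proof (rule poly_mapping_eqI)
    fix j
    show "Poly_Mapping.lookup (\<Sum>i\<in>?I. Poly_Mapping.single 0 (x i) * ?v i) j = Poly_Mapping.lookup 0 j"
    proof (cases "j \<in> ?J")
      case True
      then show ?thesis using x(2) by (simp add: lookup_sum lookup_const_mult mult.commute)
    next
      case False
      then have "Poly_Mapping.lookup (?v i) j = 0" if "i \<in> ?I" for i
        using keys[of "fst i" "snd i" j] that by (auto simp: in_keys_iff)
      then show ?thesis by (simp add: lookup_sum lookup_const_mult)
    qed
  qed
  finally have "(\<Sum>a\<in>A. c a * power_product f a) = 0" .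
  moreover have "\<exists>a\<in>A. c a \<noteq> 0"
  proof -
    obtain a t where "a \<in> A" "t \<in> monomials Y D" "x (a, t) \<noteq> 0" using x(1) by auto
    then show ?thesis using c_lookup[of t a] by force
  qed
  moreover have "c a \<in> mpolys Y" for a
    unfolding c_def by (auto intro!: mpolys_sum mpolys_single simp: monomials_def)
  ultimately show ?thesis using A by (intro exI[of _ A] exI[of _ c]) (auto simp: A_def)
qed

text \<open>Otherwise the witnesses of the strict inclusions and the variables in \<open>Y\<close>
  together outnumber the variables of the ring and satisfy a relation. Its coefficients lie in
  \<open>mpolys Y\<close>, which meets \<open>Q k\<close> trivially, so independence of the
  witnesses makes all of them vanish.\<close>

lemma prime_chain_length_le:
  fixes Q :: "nat \<Rightarrow> ('k::field) mpoly set"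
  assumes Q: "\<And>i. i \<le> k \<Longrightarrow> primeideal (Q i) (poly_ring m n)" "\<And>i. i < k \<Longrightarrow> Q i \<subset> Q (Suc i)"
    and Y: "Y \<subseteq> grid m n" "Q k \<inter> mpolys Y \<subseteq> {0}"
  shows "k + card Y \<le> m * n"
proof (rule ccontr)
  assume "\<not> k + card Y \<le> m * n"
  moreover have Z: "finite (grid m n)" "card (grid m n) = m * n"
    by (simp_all add: grid_def card_cartesian_product)
  ultimately have less: "card (grid m n) < k + card Y" by simp
  have "\<forall>i. \<exists>g. i < k \<longrightarrow> g \<in> Q (Suc i) - Q i" using Q(2) by blast
  then obtain f where f: "\<And>i. i < k \<Longrightarrow> f i \<in> Q (Suc i) - Q i" by metis
  have fc: "f i \<in> mpolys (grid m n)" if "i < k" for i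
    using f[OF that] ideal_poly_ringD(1)[OF primeideal_poly_ringD(1)[OF Q(1)[of "Suc i"]]] that by auto
  obtain d where "\<forall>i<k. exponents_le d (f i)" using exponents_le_exists by blast
  with power_product_monomial_relation[of k f "grid m n" d Y] fc Y(1) Z(1) less
  obtain A c where A: "finite A" "\<forall>a\<in>A. length a = k \<and> c a \<in> mpolys Y" "\<exists>a\<in>A. c a \<noteq> 0"
    "(\<Sum>a\<in>A. c a * power_product f a) = 0" by blast
  have "c a = 0" if "a \<in> A" for a
  proof (rule chain_witnesses_independent[where Q = Q and f = f and k = k and A = A and c = c])
    show "(\<Sum>a\<in>A. c a * power_product f a) \<in> Q 0"
      using A(4) ideal_poly_ringD(2)[OF primeideal_poly_ringD(1)[OF Q(1)[of 0]]] by simp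
    show "c a \<in> mpolys (grid m n)" if "a \<in> A" for a
      using A(2) that mpolys_mono[OF Y(1)] by auto
  qed (use Q f A Y that in auto)
  then show False using A(3) by blast
qed

lemma prime_height_le_of_independent_variables:
  fixes P :: "('k::field) mpoly set"
  assumes "Y \<subseteq> grid m n" "P \<inter> mpolys Y \<subseteq> {0}"
  shows "prime_height (poly_ring m n) P \<le> enat (m * n - card Y)"
  unfolding prime_height_def
proof (rule Sup_least, safe)
  fix k and Q :: "nat \<Rightarrow> 'k mpoly set"
  assume Q: "\<forall>i\<le>k. primeideal (Q i) (poly_ring m n)" "\<forall>i<k. Q i \<subset> Q (Suc i)" "P = Q k"
  have "k + card Y \<le> m * n"
    by (rule prime_chain_length_le[of k Q]) (use Q assms in auto)
  then show "enat k \<le> enat (m * n - card Y)" by simp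
qed

section \<open>The number of generators\<close>

definition total_degree :: "('v \<Rightarrow>\<^sub>0 nat) \<Rightarrow> nat" where
  "total_degree t = (\<Sum>v\<in>Poly_Mapping.keys t. Poly_Mapping.lookup t v)"

lemma total_degree_add: "total_degree (s + t) = total_degree s + total_degree t"
proof -
  let ?T = "Poly_Mapping.keys s \<union> Poly_Mapping.keys t"
  have sup: "total_degree u = (\<Sum>v\<in>?T. Poly_Mapping.lookup u v)" if "Poly_Mapping.keys u \<subseteq> ?T" for u
    unfolding total_degree_def by (rule sum.mono_neutral_left) (use that in \<open>auto simp: in_keys_iff\<close>)
  show ?thesis
    using Poly_Mapping.keys_add[of s t] by (simp add: sup lookup_add sum.distrib)
qed

lemma total_degree_eq_0: "total_degree t = 0 \<longleftrightarrow> t = 0"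
  by (auto simp: total_degree_def in_keys_iff intro!: poly_mapping_eqI)

lemma total_degree_single: "total_degree (Poly_Mapping.single v k) = k"
  by (simp add: total_degree_def)

definition minor_index :: "nat \<Rightarrow> nat set set \<Rightarrow> (nat \<times> nat \<times> nat \<times> nat) set" where
  "minor_index m E = {(k, l, i, j). 1 \<le> k \<and> k < l \<and> l \<le> m \<and> {i, j} \<in> E \<and> i < j}"

definition minor :: "nat \<times> nat \<times> nat \<times> nat \<Rightarrow> ('k::field) mpoly" where
  "minor = (\<lambda>(k, l, i, j). mvar (k, i) * mvar (l, j) - mvar (k, j) * mvar (l, i))"

definition diagonal_monomial :: "nat \<times> nat \<times> nat \<times> nat \<Rightarrow> ((nat \<times> nat) \<Rightarrow>\<^sub>0 nat)" where
  "diagonal_monomial = (\<lambda>(k, l, i, j). Poly_Mapping.single (k, i) 1 + Poly_Mapping.single (l, j) 1)"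

lemma gen_binomial_edge_ideal_eq:
  "gen_binomial_edge_ideal m n E =
    genideal (poly_ring m n) (minor ` minor_index m E :: ('k::field) mpoly set)"
proof -
  have "(minor ` minor_index m E :: 'k mpoly set) =
      {minor (k, l, i, j) | k l i j. (k, l, i, j) \<in> minor_index m E}"
    by (simp add: image_def Bex_def split_paired_Ex conj_commute)
  also have "\<dots> = {var k i * var l j - var k j * var l i | k l i j.
          1 \<le> k \<and> k < l \<and> l \<le> m \<and> {i, j} \<in> E \<and> i < j}"
    unfolding minor_def minor_index_def var_eq_mvar by simp
  finally show ?thesis by (simp only: gen_binomial_edge_ideal_def)
qed

lemma two_variable_monomial_eq:
  fixes a b c d :: "nat \<times> nat"
  assumes "fst a < fst b" "fst c < fst d"
    and "Poly_Mapping.single a (1::nat) + Poly_Mapping.single b 1 =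
      Poly_Mapping.single c 1 + Poly_Mapping.single d 1"
  shows "a = c \<and> b = d"
proof -
  have keys: "Poly_Mapping.keys (Poly_Mapping.single x (1::nat) + Poly_Mapping.single y 1) = {x, y}"
    for x y :: "nat \<times> nat"
    by (auto simp: in_keys_iff lookup_add lookup_single when_def split: if_splits)
  have "{a, b} = {c, d}" using keys[of a b] keys[of c d] assms(3) by simp
  then show ?thesis using assms(1,2) by (auto simp: doubleton_eq_iff)
qed

text \<open>A diagonal term determines its minor, since \<open>k < l\<close> tells its two variables
  apart, and it is no antidiagonal term, since \<open>i < j\<close>. Reading off coefficients at
  diagonal terms is thus a dual basis to the minors.\<close>

lemma lookup_minor:
  assumes "e \<in> minor_index m E" "e' \<in> minor_index m E"
  shows "Poly_Mapping.lookup (minor e) (diagonal_monomial e') = (if e = e' then 1 else 0)"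
proof -
  obtain k l i j where e: "e = (k, l, i, j)" "k < l" "i < j"
    using assms(1) by (auto simp: minor_index_def)
  obtain k' l' i' j' where e': "e' = (k', l', i', j')" "k' < l'" "i' < j'"
    using assms(2) by (auto simp: minor_index_def)
  have "diagonal_monomial (k, l, i, j) = diagonal_monomial e' \<longleftrightarrow> e = e'"
    using two_variable_monomial_eq[of "(k, i)" "(l, j)" "(k', i')" "(l', j')"] e e'
    by (auto simp: diagonal_monomial_def)
  moreover have "diagonal_monomial (k, l, j, i) \<noteq> diagonal_monomial e'"
    using two_variable_monomial_eq[of "(k, j)" "(l, i)" "(k', i')" "(l', j')"] e e'
    by (auto simp: diagonal_monomial_def)
  ultimately show ?thesis
    using e e' by (auto simp: minor_def mvar_def mult_single lookup_minus lookup_single when_def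
        diagonal_monomial_def)
qed

lemma keys_minor_degree:
  "t \<in> Poly_Mapping.keys (minor e :: ('k::field) mpoly) \<Longrightarrow> total_degree t = 2"
proof -
  assume t: "t \<in> Poly_Mapping.keys (minor e :: 'k mpoly)"
  obtain k l i j where e: "e = (k, l, i, j)" by (cases e) auto
  have "t = diagonal_monomial (k, l, i, j) \<or> t = diagonal_monomial (k, l, j, i)"
    using t by (auto simp: e minor_def mvar_def mult_single in_keys_iff lookup_minus lookup_single
        when_def diagonal_monomial_def split: if_splits)
  then show ?thesis by (auto simp: diagonal_monomial_def total_degree_add total_degree_single)
qed

text \<open>One linear condition on degree-two coefficients, imposed on the square of the ideal
  generated by all variables; \<open>x = 0\<close> imposes no condition.\<close>

definition degree_two_ideal ::
    "nat \<Rightarrow> nat \<Rightarrow> 'e set \<Rightarrow> ('e \<Rightarrow> ((nat \<times> nat) \<Rightarrow>\<^sub>0 nat)) \<Rightarrow> ('e \<Rightarrow> 'k::field) \<Rightarrow> 'k mpoly set" where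
  "degree_two_ideal m n T d x = {f \<in> mpolys (grid m n). (\<forall>t\<in>Poly_Mapping.keys f. 2 \<le> total_degree t) \<and>
     (\<Sum>e\<in>T. x e * Poly_Mapping.lookup f (d e)) = 0}"

text \<open>On polynomials without terms of degree below two, multiplication by \<open>r\<close> scales the degree-two
  part by the constant coefficient of \<open>r\<close>.\<close>

lemma ideal_degree_two_ideal:
  assumes d: "\<And>e. e \<in> T \<Longrightarrow> total_degree (d e) = 2"
  shows "ideal (degree_two_ideal m n T d (x :: 'e \<Rightarrow> 'k::field)) (poly_ring m n)"
proof (rule ideal_poly_ringI)
  let ?I = "degree_two_ideal m n T d x"
  show add: "a + b \<in> ?I" if "a \<in> ?I" "b \<in> ?I" for a b
    using that Poly_Mapping.keys_add[of a b]
    by (auto simp: degree_two_ideal_def lookup_add distrib_left sum.distrib intro: mpolys_add)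
  fix r f :: "'k mpoly" assume r: "r \<in> mpolys (grid m n)" and f: "f \<in> ?I"
  show "r * f \<in> ?I"
  proof (induction r rule: poly_mapping_add_induct)
    case (single s c)
    have "Poly_Mapping.keys s \<subseteq> grid m n" using single r by (auto simp: mpolys_def)
    then have "Poly_Mapping.single s c * f \<in> mpolys (grid m n)"
      using f by (auto simp: degree_two_ideal_def intro!: mpolys_mult mpolys_single)
    moreover have deg: "2 + total_degree s \<le> total_degree t"
      if t: "t \<in> Poly_Mapping.keys (Poly_Mapping.single s c * f)" for t
    proof -
      obtain u v where "t = u + v" "u \<in> Poly_Mapping.keys (Poly_Mapping.single s c)"
        "v \<in> Poly_Mapping.keys f"
        using subsetD[OF keys_mult t] by blast
      then show ?thesis
        using f by (auto simp: degree_two_ideal_def total_degree_add split: if_splits)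
    qed
    moreover have "(\<Sum>e\<in>T. x e * Poly_Mapping.lookup (Poly_Mapping.single s c * f) (d e)) = 0"
    proof (cases "s = 0")
      case True
      have "(\<Sum>e\<in>T. x e * Poly_Mapping.lookup (Poly_Mapping.single s c * f) (d e)) =
          c * (\<Sum>e\<in>T. x e * Poly_Mapping.lookup f (d e))"
        by (simp add: True lookup_const_mult sum_distrib_left mult.left_commute)
      then show ?thesis using f by (simp add: degree_two_ideal_def)
    next
      case False
      then have "total_degree s > 0" using total_degree_eq_0[of s] by simp
      then have "Poly_Mapping.lookup (Poly_Mapping.single s c * f) (d e) = 0" if "e \<in> T" for e
        using deg[of "d e"] d[OF that] by (auto simp: in_keys_iff)
      then show ?thesis by simp
    qed
    moreover have "2 \<le> total_degree t" if "t \<in> Poly_Mapping.keys (Poly_Mapping.single s c * f)" for t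
      using deg[OF that] by linarith
    ultimately show ?case by (auto simp: degree_two_ideal_def)
  next
    case zero
    show ?case by (simp add: degree_two_ideal_def mpolys_0)
  next
    case (add a b)
    then show ?case using \<open>\<And>a b. a \<in> ?I \<Longrightarrow> b \<in> ?I \<Longrightarrow> a + b \<in> ?I\<close> by (simp add: distrib_right)
  qed
qed (auto simp: degree_two_ideal_def mpolys_0)

lemma simple_graph_edgeD:
  assumes "simple_graph V E" "{i, j} \<in> E" shows "i \<in> V" "j \<in> V" "i \<noteq> j"
proof -
  have "{i, j} \<in> {{u, v} | u v. u \<in> V \<and> v \<in> V \<and> u \<noteq> v}"
    using assms unfolding simple_graph_def by (rule subsetD)
  then show "i \<in> V" "j \<in> V" "i \<noteq> j" by (auto simp: doubleton_eq_iff)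
qed

lemma minor_closed:
  assumes "simple_graph {1..n} E" "e \<in> minor_index m E"
  shows "minor e \<in> mpolys (grid m n)"
proof -
  obtain k l i j where e: "e = (k, l, i, j)" "1 \<le> k" "k < l" "l \<le> m" "{i, j} \<in> E"
    using assms(2) by (auto simp: minor_index_def)
  then have "i \<in> {1..n}" "j \<in> {1..n}"
    using simple_graph_edgeD[OF assms(1)] by auto
  with e show ?thesis by (auto simp: minor_def grid_def intro!: mpolys_closed)
qed

lemma total_degree_diagonal_monomial: "total_degree (diagonal_monomial e) = 2"
  by (auto simp: diagonal_monomial_def total_degree_add total_degree_single split: prod.split)

text \<open>With fewer generators than minors, some nonzero functional \<open>x\<close> on
  degree-two coefficients kills all generators. It then kills the whole ideal, but its value on the
  minor \<open>e\<close> is \<open>x e\<close>.\<close>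

lemma card_le_generators:
  assumes E: "simple_graph {1..n} E" and S: "S \<subseteq> carrier (poly_ring m n)" "finite S"
    and gen: "genideal (poly_ring m n) S = (gen_binomial_edge_ideal m n E :: ('k::field) mpoly set)"
    and fin: "finite (minor_index m E)"
  shows "card (minor_index m E) \<le> card S"
proof (rule ccontr)
  interpret cring "poly_ring m n :: 'k mpoly ring" by (rule poly_ring_cring)
  let ?T = "minor_index m E" and ?J = "gen_binomial_edge_ideal m n E :: 'k mpoly set"
  assume "\<not> card ?T \<le> card S"
  then obtain x where x: "\<exists>e\<in>?T. x e \<noteq> 0"
    "\<forall>s\<in>S. (\<Sum>e\<in>?T. Poly_Mapping.lookup s (diagonal_monomial e) * x e) = 0"
    using homogeneous_system_nontrivial_solution[OF S(2) fin,
        of "\<lambda>s e. Poly_Mapping.lookup s (diagonal_monomial e)"] by auto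
  have minors: "minor ` ?T \<subseteq> carrier (poly_ring m n :: 'k mpoly ring)"
    using minor_closed[OF E] by (auto simp: poly_ring_simps)
  \<comment> \<open>The case \<open>x = 0\<close> comes first: it shows that the arbitrary
    generators in \<open>S\<close> have no terms of degree below two.\<close>
  have "?J \<subseteq> degree_two_ideal m n ?T diagonal_monomial (\<lambda>_. 0)"
    unfolding gen_binomial_edge_ideal_eq
    by (intro genideal_minimal ideal_degree_two_ideal total_degree_diagonal_monomial)
       (use minors in \<open>auto simp: degree_two_ideal_def keys_minor_degree poly_ring_simps\<close>)
  then have "S \<subseteq> degree_two_ideal m n ?T diagonal_monomial (\<lambda>_. 0)"
    using genideal_self[OF S(1)] gen by auto
  then have "S \<subseteq> degree_two_ideal m n ?T diagonal_monomial x"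
    using x(2) by (auto simp: degree_two_ideal_def mult.commute)
  then have "?J \<subseteq> degree_two_ideal m n ?T diagonal_monomial x"
    unfolding gen[symmetric]
    by (intro genideal_minimal ideal_degree_two_ideal total_degree_diagonal_monomial)
  moreover have "minor e \<in> ?J" if "e \<in> ?T" for e
    unfolding gen_binomial_edge_ideal_eq using genideal_self[OF minors] that by auto
  ultimately have "(\<Sum>e'\<in>?T. x e' * Poly_Mapping.lookup (minor e :: 'k mpoly) (diagonal_monomial e')) = 0"
    if "e \<in> ?T" for e
    using that unfolding degree_two_ideal_def by blast
  moreover have "(\<Sum>e'\<in>?T. x e' * Poly_Mapping.lookup (minor e :: 'k mpoly) (diagonal_monomial e')) = x e"
    if e: "e \<in> ?T" for e
  proof -
    have "(\<Sum>e'\<in>?T. x e' * Poly_Mapping.lookup (minor e :: 'k mpoly) (diagonal_monomial e')) =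
        (\<Sum>e'\<in>?T. if e' = e then x e else 0)"
      by (rule sum.cong) (auto simp: lookup_minor[OF e])
    then show ?thesis using e fin by simp
  qed
  ultimately show False using x(1) by auto
qed

lemma min_num_gens_gen_binomial_edge_ideal:
  assumes E: "simple_graph {1..n} E"
  shows "min_num_gens (poly_ring m n) (gen_binomial_edge_ideal m n E :: ('k::field) mpoly set) =
    card (minor_index m E)"
proof -
  let ?T = "minor_index m E" and ?J = "gen_binomial_edge_ideal m n E :: 'k mpoly set"
  let ?P = "\<lambda>k. \<exists>S. S \<subseteq> carrier (poly_ring m n) \<and> finite S \<and> card S = k \<and>
    genideal (poly_ring m n) S = ?J"
  have "?T \<subseteq> {1..m} \<times> {1..m} \<times> {1..n} \<times> {1..n}"
  proof
    fix e assume "e \<in> ?T"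
    then obtain k l i j where e: "e = (k, l, i, j)" "1 \<le> k" "k < l" "l \<le> m" "{i, j} \<in> E"
      by (auto simp: minor_index_def)
    then show "e \<in> {1..m} \<times> {1..m} \<times> {1..n} \<times> {1..n}"
      using simple_graph_edgeD(1,2)[OF E e(5)] by auto
  qed
  then have fin: "finite ?T" by (rule finite_subset) simp
  have P: "?P (card (minor ` ?T :: 'k mpoly set))"
    using minor_closed[OF E, of _ m] fin
    by (intro exI[of _ "minor ` ?T"]) (auto simp: gen_binomial_edge_ideal_eq poly_ring_simps)
  have "(LEAST k. ?P k) \<le> card (minor ` ?T :: 'k mpoly set)" by (rule Least_le[of ?P, OF P])
  also have "\<dots> \<le> card ?T" by (rule card_image_le[OF fin])
  finally have "(LEAST k. ?P k) \<le> card ?T" .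
  moreover have "card ?T \<le> (LEAST k. ?P k)"
  proof -
    have "?P (LEAST k. ?P k)" by (rule LeastI[of ?P, OF P])
    then obtain S where "S \<subseteq> carrier (poly_ring m n :: 'k mpoly ring)" "finite S"
      "card S = (LEAST k. ?P k)" "genideal (poly_ring m n) S = ?J" by blast
    then show ?thesis using card_le_generators[OF E _ _ _ fin, of S] by simp
  qed
  ultimately show ?thesis by (simp add: min_num_gens_def)
qed

section \<open>The height of binomial edge ideals\<close>

abbreviation adj :: "'a set set \<Rightarrow> ('a \<times> 'a) set" where
  "adj E \<equiv> {(a, b). {a, b} \<in> E}"

text \<open>The edges of \<open>G - S\<close>.\<close>

definition avoid :: "'a set set \<Rightarrow> 'a set \<Rightarrow> 'a set set" where
  "avoid E S = {e \<in> E. e \<inter> S = {}}"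

lemma single_one_power:
  "(Poly_Mapping.single s 1 :: 'a::comm_monoid_add \<Rightarrow>\<^sub>0 'k::field) ^ n = Poly_Mapping.single (\<Sum>i<n. s) 1"
  by (induction n) (simp_all add: mult_single add.commute)

text \<open>The map of exponent vectors induced by substituting a monomial with exponents
  \<open>g v\<close> for each variable \<open>v\<close>; the inner sum is a multiple of
  \<open>g v\<close>.\<close>

definition monomial_subst :: "('v \<Rightarrow> ('w \<Rightarrow>\<^sub>0 nat)) \<Rightarrow> ('v \<Rightarrow>\<^sub>0 nat) \<Rightarrow> ('w \<Rightarrow>\<^sub>0 nat)" where
  "monomial_subst g t = (\<Sum>v\<in>Poly_Mapping.keys t. \<Sum>i<Poly_Mapping.lookup t v. g v)"

lemma lookup_monomial_subst:
  assumes "finite A" "Poly_Mapping.keys t \<subseteq> A"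
  shows "Poly_Mapping.lookup (monomial_subst g t) w =
    (\<Sum>v\<in>A. Poly_Mapping.lookup t v * Poly_Mapping.lookup (g v) w)"
proof -
  have "Poly_Mapping.lookup (monomial_subst g t) w =
      (\<Sum>v\<in>Poly_Mapping.keys t. Poly_Mapping.lookup t v * Poly_Mapping.lookup (g v) w)"
    by (simp add: monomial_subst_def lookup_sum)
  also have "\<dots> = (\<Sum>v\<in>A. Poly_Mapping.lookup t v * Poly_Mapping.lookup (g v) w)"
    by (rule sum.mono_neutral_left) (use assms in \<open>auto simp: in_keys_iff\<close>)
  finally show ?thesis .
qed

lemma const_hom: "mpoly_eval (\<lambda>a :: 'k::field. Poly_Mapping.single 0 a :: 'k mpoly)"
  by unfold_locales (simp_all add: single_add mult_single)

text \<open>Distinct monomials of \<open>p\<close> have distinct images, so nothing cancels.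
  Algebraic independence is thereby reduced to injectivity of an additive map on exponents.\<close>

lemma eval_monomials_injective:
  fixes p :: "('k::field) mpoly" and h :: "nat \<times> nat \<Rightarrow> 'k mpoly"
  assumes h: "\<And>v. v \<in> Y \<Longrightarrow> h v = Poly_Mapping.single (g v) 1"
    and inj: "inj_on (monomial_subst g) {t. Poly_Mapping.keys t \<subseteq> Y}"
    and p: "p \<in> mpolys Y" "mpoly_eval.eval (Poly_Mapping.single 0) h p = 0"
  shows "p = 0"
proof (rule poly_mapping_eqI)
  interpret mpoly_eval "\<lambda>a :: 'k. Poly_Mapping.single 0 a :: 'k mpoly" h by (rule const_hom)
  fix t0
  show "Poly_Mapping.lookup p t0 = Poly_Mapping.lookup 0 t0"
  proof (rule ccontr)
    assume "Poly_Mapping.lookup p t0 \<noteq> Poly_Mapping.lookup 0 t0"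
    then have t0: "t0 \<in> Poly_Mapping.keys p" by (simp add: in_keys_iff)
    have keys: "Poly_Mapping.keys t \<subseteq> Y" if "t \<in> Poly_Mapping.keys p" for t
      using p(1) that by (auto simp: mpolys_def)
    have prod_single: "(\<Prod>v\<in>A. Poly_Mapping.single (f v) (1 :: 'k)) = Poly_Mapping.single (sum f A) 1"
      for A and f :: "nat \<times> nat \<Rightarrow> ((nat \<times> nat) \<Rightarrow>\<^sub>0 nat)"
      by (induction A rule: infinite_finite_induct) (simp_all add: mult_single)
    have mon: "eval_mon t = Poly_Mapping.single (monomial_subst g t) 1"
      if t: "t \<in> Poly_Mapping.keys p" for t
    proof -
      have "eval_mon t = (\<Prod>v\<in>Poly_Mapping.keys t. Poly_Mapping.single (\<Sum>i<Poly_Mapping.lookup t v. g v) 1)"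
        unfolding eval_mon_def using keys[OF t]
        by (intro prod.cong refl) (auto simp: h single_one_power subset_iff)
      then show ?thesis by (simp add: prod_single monomial_subst_def)
    qed
    have "0 = Poly_Mapping.lookup (eval p) (monomial_subst g t0)" using p(2) by simp
    also have "\<dots> = (\<Sum>t\<in>Poly_Mapping.keys p. if monomial_subst g t = monomial_subst g t0
        then Poly_Mapping.lookup p t else 0)"
      by (simp add: eval_def lookup_sum mon mult_single lookup_single when_def)
    also have "\<dots> = (\<Sum>t\<in>Poly_Mapping.keys p. if t = t0 then Poly_Mapping.lookup p t else 0)"
      using inj keys t0 by (intro sum.cong refl) (auto dest: inj_onD)
    also have "\<dots> = Poly_Mapping.lookup p t0" using t0 by simp
    finally show False using t0 by (simp add: in_keys_iff)
  qed
qed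

text \<open>With \<open>r = rep j\<close> representing the component of \<open>j\<close>, the \<open>j\<close>-th column becomes the multiple by
  \<open>x\<^bsub>1 j\<^esub>\<close> of \<open>(1, x\<^bsub>2 r\<^esub>, \<dots>, x\<^bsub>m r\<^esub>)\<close>.\<close>

definition component_subst :: "nat set \<Rightarrow> (nat \<Rightarrow> nat) \<Rightarrow> nat \<times> nat \<Rightarrow> ('k::field) mpoly" where
  "component_subst S rep = (\<lambda>(k, j). if j \<in> S then 0 else if k = 1 then mvar (1, j)
     else mvar (1, j) * mvar (k, rep j))"

definition component_prime :: "nat \<Rightarrow> nat \<Rightarrow> nat set \<Rightarrow> (nat \<Rightarrow> nat) \<Rightarrow> ('k::field) mpoly set" where
  "component_prime m n S rep =
     {p \<in> mpolys (grid m n). mpoly_eval.eval (Poly_Mapping.single 0) (component_subst S rep) p = 0}"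

text \<open>The order on index pairs from \<open>Product_Lexorder\<close> makes \<open>mpoly\<close> an instance of \<open>idom\<close>.\<close>

lemma primeideal_component_prime: "primeideal (component_prime m n S rep) (poly_ring m n)"
proof -
  interpret mpoly_eval "\<lambda>a :: 'k::field. Poly_Mapping.single 0 a :: 'k mpoly" "component_subst S rep"
    by (rule const_hom)
  show ?thesis
    by (intro primeideal_poly_ringI ideal_poly_ringI)
       (auto simp: component_prime_def eval_simps intro: mpolys_closed)
qed

text \<open>An edge of \<open>G - S\<close> joins columns that become multiples of one vector, and
  an edge meeting \<open>S\<close> involves a zero column.\<close>

lemma minor_in_component_prime:
  assumes E: "simple_graph {1..n} E" and e: "e \<in> minor_index m E"
    and rep: "\<And>i j. {i, j} \<in> E \<Longrightarrow> i \<notin> S \<Longrightarrow> j \<notin> S \<Longrightarrow> rep i = rep j"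
  shows "minor e \<in> component_prime m n S rep"
proof -
  interpret mpoly_eval "\<lambda>a :: 'k::field. Poly_Mapping.single 0 a :: 'k mpoly" "component_subst S rep"
    by (rule const_hom)
  obtain k l i j where e': "e = (k, l, i, j)" "1 \<le> k" "k < l" "{i, j} \<in> E"
    using e by (auto simp: minor_index_def)
  then show ?thesis
    using minor_closed[OF E e] rep[of i j]
    by (auto simp: component_prime_def minor_def eval_simps)
       (auto simp: component_subst_def ac_simps)
qed

text \<open>Independent modulo the component prime are the first entry of every column outside
  \<open>S\<close> and the other \<open>m - 1\<close> entries of the columns in \<open>R\<close>;
  these form the set \<open>Y\<close>.\<close>

lemma ideal_height_le_components:
  assumes E: "simple_graph {1..n} E" and S: "S \<subseteq> {1..n}" and R: "R \<subseteq> {1..n} - S" and m: "m \<ge> 1"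
    and rep: "\<And>i j. {i, j} \<in> E \<Longrightarrow> i \<notin> S \<Longrightarrow> j \<notin> S \<Longrightarrow> rep i = rep j"
    and repR: "\<And>r. r \<in> R \<Longrightarrow> rep r = r"
  shows "ideal_height (poly_ring m n) (gen_binomial_edge_ideal m n E :: ('k::field) mpoly set) \<le>
    enat (m * n - (n - card S + (m - 1) * card R))"
proof -
  interpret cring "poly_ring m n :: 'k mpoly ring" by (rule poly_ring_cring)
  let ?P = "component_prime m n S rep :: 'k mpoly set"
  define Y where "Y = {1} \<times> ({1..n} - S) \<union> {2..m} \<times> R"
  have "finite R" using R finite_subset by blast
  then have "card Y = card ({1::nat} \<times> ({1..n} - S)) + card ({2..m} \<times> R)"
    unfolding Y_def by (intro card_Un_disjoint) auto
  also have "\<dots> = n - card S + (m - 1) * card R"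
    using S by (simp add: card_cartesian_product card_Diff_subset finite_subset)
  finally have cardY: "card Y = n - card S + (m - 1) * card R" .
  have Y: "Y \<subseteq> grid m n" using R m by (auto simp: Y_def grid_def)
  have "gen_binomial_edge_ideal m n E \<subseteq> ?P"
    unfolding gen_binomial_edge_ideal_eq
    by (intro genideal_minimal primeideal_poly_ringD(1)[OF primeideal_component_prime])
       (auto intro: minor_in_component_prime[OF E] rep)
  then have "ideal_height (poly_ring m n) (gen_binomial_edge_ideal m n E :: 'k mpoly set) \<le>
      prime_height (poly_ring m n) ?P"
    unfolding ideal_height_def using primeideal_component_prime by (intro Inf_lower CollectI) blast
  also have "\<dots> \<le> enat (m * n - card Y)"
  proof (rule prime_height_le_of_independent_variables[OF Y])
    \<comment> \<open>The exponents of the images of the variables in \<open>Y\<close>: beyond the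
      first row only columns with \<open>rep r = r\<close> occur, so \<open>rep\<close>
      disappears.\<close>
    define g :: "nat \<times> nat \<Rightarrow> ((nat \<times> nat) \<Rightarrow>\<^sub>0 nat)" where
      "g = (\<lambda>(k, j). if k = 1 then Poly_Mapping.single (1, j) 1
         else Poly_Mapping.single (1, j) 1 + Poly_Mapping.single (k, j) 1)"
    have g1: "Poly_Mapping.lookup (g v) w = (if v = w then 1 else 0)" if "fst w \<noteq> 1" for v w
      using that by (cases v; cases w) (auto simp: g_def lookup_add lookup_single when_def)
    have g2: "Poly_Mapping.lookup (g v) (1, j) = (if snd v = j then 1 else 0)" for v j
      by (cases v) (auto simp: g_def lookup_add lookup_single when_def)
    have "inj_on (monomial_subst g) {t. Poly_Mapping.keys t \<subseteq> Y}"
    proof (rule inj_onI)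
      fix s t :: "(nat \<times> nat) \<Rightarrow>\<^sub>0 nat" assume eq: "monomial_subst g s = monomial_subst g t"
      have sums: "(\<Sum>v\<in>A. Poly_Mapping.lookup s v * Poly_Mapping.lookup (g v) w) =
          (\<Sum>v\<in>A. Poly_Mapping.lookup t v * Poly_Mapping.lookup (g v) w)"
        if "finite A" "Poly_Mapping.keys s \<subseteq> A" "Poly_Mapping.keys t \<subseteq> A" for A w
        using lookup_monomial_subst[of A s g w] lookup_monomial_subst[of A t g w] eq that by simp
      \<comment> \<open>The exponent map is triangular: a variable outside the first row occurs only
        in its own image, which recovers its exponent at once.\<close>
      have row: "Poly_Mapping.lookup s w = Poly_Mapping.lookup t w" if "fst w \<noteq> 1" for w
      proof -
        let ?A = "insert w (Poly_Mapping.keys s \<union> Poly_Mapping.keys t)"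
        have "(\<Sum>v\<in>?A. Poly_Mapping.lookup s v * Poly_Mapping.lookup (g v) w) =
            (\<Sum>v\<in>?A. Poly_Mapping.lookup t v * Poly_Mapping.lookup (g v) w)"
          by (rule sums) auto
        then show ?thesis by (simp add: g1[OF that] if_distrib[of "\<lambda>x. _ * x"] cong: if_cong)
      qed
      \<comment> \<open>The variable \<open>(1, j)\<close> occurs in the images of the whole column
        \<open>j\<close>, but the contributions of the other rows are already known to
        agree.\<close>
      have "Poly_Mapping.lookup s (1, j) = Poly_Mapping.lookup t (1, j)" for j
      proof -
        let ?A = "insert (1, j) (Poly_Mapping.keys s \<union> Poly_Mapping.keys t)"
        let ?B = "?A - {(1, j)}"
        have split: "(\<Sum>v\<in>?A. Poly_Mapping.lookup u v * Poly_Mapping.lookup (g v) (1, j)) =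
            Poly_Mapping.lookup u (1, j) + (\<Sum>v\<in>?B. Poly_Mapping.lookup u v * Poly_Mapping.lookup (g v) (1, j))"
          for u :: "(nat \<times> nat) \<Rightarrow>\<^sub>0 nat"
          by (subst sum.remove[of _ "(1, j)"]) (auto simp: g2[unfolded One_nat_def])
        have "(\<Sum>v\<in>?B. Poly_Mapping.lookup s v * Poly_Mapping.lookup (g v) (1, j)) =
            (\<Sum>v\<in>?B. Poly_Mapping.lookup t v * Poly_Mapping.lookup (g v) (1, j))"
          by (rule sum.cong) (auto simp: g2[unfolded One_nat_def] intro!: row)
        moreover have "(\<Sum>v\<in>?A. Poly_Mapping.lookup s v * Poly_Mapping.lookup (g v) (1, j)) =
            (\<Sum>v\<in>?A. Poly_Mapping.lookup t v * Poly_Mapping.lookup (g v) (1, j))"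
          by (rule sums) auto
        ultimately show ?thesis by (simp only: split)
      qed
      then show "s = t" using row by (intro poly_mapping_eqI) (metis prod.collapse)
    qed
    moreover have "component_subst S rep v = Poly_Mapping.single (g v) (1::'k)" if "v \<in> Y" for v
      using that R repR by (auto simp: Y_def component_subst_def g_def mvar_def mult_single)
    ultimately show "?P \<inter> mpolys Y \<subseteq> {0}"
      using eval_monomials_injective[of Y "component_subst S rep" g] by (auto simp: component_prime_def)
  qed
  finally show ?thesis by (simp add: cardY)
qed

text \<open>Modulo \<open>P\<close> proportionality of columns passes along walks in
  \<open>G - S\<close>, so every column outside \<open>S\<close> is proportional to that of a
  representative in \<open>R\<close>. The eliminated variables are both entries of the columns in
  \<open>S\<close> and one entry of each remaining column outside \<open>R\<close>.\<close>

lemma prime_height_ge_components: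
  fixes P :: "('k::field) mpoly set"
  assumes E: "simple_graph {1..n} E" and P: "primeideal P (poly_ring 2 n)"
    and J: "gen_binomial_edge_ideal 2 n E \<subseteq> P"
    and S: "S = {j \<in> {1..n}. mvar (1, j) \<in> P \<and> mvar (2, j) \<in> P}"
    and R: "R \<subseteq> {1..n} - S" "\<And>j. j \<in> {1..n} - S \<Longrightarrow> \<exists>r\<in>R. (r, j) \<in> (adj (avoid E S))\<^sup>*"
  shows "enat (n + card S - card R) \<le> prime_height (poly_ring 2 n) P"
proof -
  interpret cring "poly_ring 2 n :: 'k mpoly ring" by (rule poly_ring_cring)
  note PD = primeideal_poly_ringD[OF P] ideal_poly_ringD[OF primeideal_poly_ringD(1)[OF P]]
  let ?x = "\<lambda>j. mvar (1, j) :: 'k mpoly" and ?y = "\<lambda>j. mvar (2, j) :: 'k mpoly"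
  define rel where "rel = (\<lambda>i j. ?x i * ?y j - ?x j * ?y i)"
  have xy: "?x j \<in> mpolys (grid 2 n)" "?y j \<in> mpolys (grid 2 n)" if "j \<in> {1..n}" for j
    using that by (auto intro!: mpolys_mvar simp: grid_def)
  have rel_closed: "rel i j \<in> mpolys (grid 2 n)" if "i \<in> {1..n}" "j \<in> {1..n}" for i j
    using xy that unfolding rel_def by (intro mpolys_diff mpolys_mult)
  have minors: "minor ` minor_index 2 E \<subseteq> P"
    using J genideal_self[of "minor ` minor_index 2 E"] minor_closed[OF E, of _ 2]
    unfolding gen_binomial_edge_ideal_eq poly_ring_simps by blast
  have lt: "rel i j \<in> P" if "{i, j} \<in> E" "i < j" for i j
    using minors that unfolding minor_index_def minor_def rel_def
    by (auto simp: image_subset_iff)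
  have edge: "rel i j \<in> P" if ij: "{i, j} \<in> E" for i j
  proof -
    consider "i < j" | "j < i" using simple_graph_edgeD(3)[OF E ij] by linarith
    then show ?thesis
    proof cases
      case 2
      then have "- rel j i \<in> P" using lt[of j i] ij PD(8) by (simp add: insert_commute)
      then show ?thesis by (simp add: rel_def)
    qed (use lt ij in blast)
  qed
  have reach: "j \<in> {1..n} - S \<and> rel i j \<in> P"
    if "(i, j) \<in> (adj (avoid E S))\<^sup>*" and i: "i \<in> {1..n} - S" for i j
    using that(1)
  proof (induction rule: rtrancl_induct)
    case base
    then show ?case using i PD(5) by (simp add: rel_def)
  next
    case (step j l)
    have jl: "{j, l} \<in> E" "l \<in> {1..n} - S" "j \<in> {1..n} - S" "rel i j \<in> P" "rel j l \<in> P"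
      using step edge[of j l] simple_graph_edgeD[OF E, of j l] by (auto simp: avoid_def)
    have il: "rel i l \<in> mpolys (grid 2 n)" using i jl by (intro rel_closed) auto
    \<comment> \<open>Expansions of 3 by 3 determinants with a repeated row. As \<open>j\<close> is
      outside \<open>S\<close>, one of the two multipliers on the left is outside \<open>P\<close>
      and can be cancelled.\<close>
    have "?x j * rel i l = ?x i * rel j l + ?x l * rel i j"
      "?y j * rel i l = ?y l * rel i j + ?y i * rel j l"
      by (simp_all add: rel_def algebra_simps)
    then have "?x j * rel i l \<in> P" "?y j * rel i l \<in> P"
      using jl i xy by (auto intro!: PD(6,7))
    then have "rel i l \<in> P"
      using PD(3)[OF xy(1)[of j] il] PD(3)[OF xy(2)[of j] il] jl(3) S by auto
    then show ?case using jl by simp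
  qed
  obtain r where r: "\<And>j. j \<in> {1..n} - S \<Longrightarrow> r j \<in> R \<and> (r j, j) \<in> (adj (avoid E S))\<^sup>*"
    using R(2) by metis
  \<comment> \<open>In \<open>rel (r j) j\<close> the coefficient of an entry of column
    \<open>j\<close> is, up to sign, the entry of column \<open>r j\<close> in the opposite row; the
    row is chosen to make this coefficient a nonmember of \<open>P\<close>.\<close>
  define row where "row = (\<lambda>j. if ?x (r j) \<in> P then 1 else 2 :: nat)"
  define X where "X = {1, 2} \<times> S \<union> (\<lambda>j. (row j, j)) ` ({1..n} - S - R)"
  have fin: "finite S" "finite R" "S \<subseteq> {1..n}" using S R(1) finite_subset[of R "{1..n}"] by auto
  have cardU: "card X = 2 * card S + card ({1..n} - S - R)"
  proof -
    have "card X = card ({1::nat, 2} \<times> S) + card ((\<lambda>j. (row j, j)) ` ({1..n} - S - R))"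
      unfolding X_def using fin by (intro card_Un_disjoint) auto
    then show ?thesis by (simp add: card_cartesian_product card_image inj_on_def)
  qed
  have "card ({1..n} - S - R) = n - card S - card R"
    using fin R(1) by (simp add: card_Diff_subset)
  moreover have "card S + card R \<le> n"
  proof -
    have "card (S \<union> R) \<le> card {1..n}" using fin R(1) by (intro card_mono) auto
    moreover have "card (S \<union> R) = card S + card R" using fin R(1) by (intro card_Un_disjoint) auto
    ultimately show ?thesis by simp
  qed
  ultimately have cardX: "card X = n + card S - card R" using cardU by simp
  have "enat (card X) \<le> prime_height (poly_ring 2 n) P"
  proof (rule prime_height_of_linear_relations[OF _ _ P])
    show "finite X" using fin by (simp add: X_def)
    show "X \<subseteq> grid 2 n" using fin(3) by (auto simp: X_def grid_def row_def)
    fix v assume "v \<in> X"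
    then consider "v \<in> {1, 2} \<times> S" | j where "j \<in> {1..n} - S - R" "v = (row j, j)"
      unfolding X_def by blast
    then show "\<exists>a b. a \<in> mpolys (grid 2 n - X) \<and> b \<in> mpolys (grid 2 n - X) \<and> a \<notin> P \<and> a * mvar v + b \<in> P"
    proof cases
      case 1
      then have "mvar v \<in> P" using S by auto
      then show ?thesis
        using PD(2) by (intro exI[of _ 1] exI[of _ 0]) (auto intro: mpolys_closed)
    next
      case 2
      let ?r = "r j"
      have rj: "?r \<in> R" "?r \<in> {1..n} - S" "rel ?r j \<in> P"
        using r[of j] 2 R(1) reach[of ?r j] by auto
      have vars: "mvar (k, ?r) \<in> mpolys (grid 2 n - X)" if "k = 1 \<or> k = 2" for k
        using rj that by (intro mpolys_mvar) (auto simp: grid_def X_def)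
      have other: "mvar (3 - row j, j) \<in> mpolys (grid 2 n - X)"
        using 2 by (intro mpolys_mvar) (auto simp: grid_def X_def row_def)
      show ?thesis
      proof (cases "?x ?r \<in> P")
        case True
        have "?y ?r * mvar v + - (?x ?r * ?y j) = - rel ?r j"
          using 2(2) True by (simp add: rel_def row_def)
        moreover have "?y ?r \<notin> P" using True rj S by auto
        ultimately show ?thesis
          using vars other True PD(8)[OF rj(3)]
          by (intro exI[of _ "?y ?r"] exI[of _ "- (?x ?r * ?y j)"])
             (auto simp: row_def intro!: mpolys_uminus mpolys_mult)
      next
        case False
        have "?x ?r * mvar v + - (?x j * ?y ?r) = rel ?r j"
          using 2(2) False by (simp add: rel_def row_def)
        then show ?thesis
          using vars other False rj(3)
          by (intro exI[of _ "?x ?r"] exI[of _ "- (?x j * ?y ?r)"])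
             (auto simp: row_def intro!: mpolys_uminus mpolys_mult)
      qed
    qed
  qed
  then show ?thesis by (simp add: cardX)
qed

text \<open>The prime dictates its own set \<open>S\<close>, so representatives are required for
  every \<open>S\<close>.\<close>

lemma ideal_height_ge_components:
  assumes E: "simple_graph {1..n} E"
    and R: "\<And>S. S \<subseteq> {1..n} \<Longrightarrow> \<exists>R\<subseteq>{1..n} - S. card R \<le> card S + c \<and>
      (\<forall>j\<in>{1..n} - S. \<exists>r\<in>R. (r, j) \<in> (adj (avoid E S))\<^sup>*)"
  shows "enat (n - c) \<le>
    ideal_height (poly_ring 2 n) (gen_binomial_edge_ideal 2 n E :: ('k::field) mpoly set)"
  unfolding ideal_height_def
proof (rule Inf_greatest, safe)
  fix P :: "'k mpoly set"
  assume P: "primeideal P (poly_ring 2 n)" "gen_binomial_edge_ideal 2 n E \<subseteq> P"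
  define S where "S = {j \<in> {1..n}. mvar (1, j) \<in> P \<and> mvar (2, j) \<in> P}"
  have "S \<subseteq> {1..n}" by (auto simp: S_def)
  then obtain R where "R \<subseteq> {1..n} - S" "card R \<le> card S + c"
    "\<forall>j\<in>{1..n} - S. \<exists>r\<in>R. (r, j) \<in> (adj (avoid E S))\<^sup>*"
    using R[of S] by blast
  then have "enat (n + card S - card R) \<le> prime_height (poly_ring 2 n) P"
    by (intro prime_height_ge_components[OF E P S_def]) auto
  moreover have "n - c \<le> n + card S - card R" using \<open>card R \<le> card S + c\<close> by linarith
  ultimately show "enat (n - c) \<le> prime_height (poly_ring 2 n) P"
    using order_trans enat_ord_simps(1) by blast
qed

section \<open>Components and redundant edges\<close>

definition component :: "'a set set \<Rightarrow> 'a \<Rightarrow> 'a set" where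
  "component F x = (adj F)\<^sup>* `` {x}"

definition ncomp :: "'a set \<Rightarrow> 'a set set \<Rightarrow> nat" where
  "ncomp V F = card (component F ` V)"

text \<open>For an edge \<open>{a, b}\<close>: it is not a bridge, equivalently it lies on a
  cycle.\<close>

definition redundant :: "'a set set \<Rightarrow> 'a \<Rightarrow> 'a \<Rightarrow> bool" where
  "redundant F a b \<longleftrightarrow> (a, b) \<in> (adj (F - {{a, b}}))\<^sup>*"

lemma reach_sym: "(x, y) \<in> (adj F)\<^sup>* \<Longrightarrow> (y, x) \<in> (adj F)\<^sup>*"
proof -
  have "sym (adj F)" by (auto simp: sym_def insert_commute)
  then show "(x, y) \<in> (adj F)\<^sup>* \<Longrightarrow> (y, x) \<in> (adj F)\<^sup>*"
    using sym_rtrancl by (blast dest: symD)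
qed

lemma reach_mono: "F \<subseteq> F' \<Longrightarrow> (x, y) \<in> (adj F)\<^sup>* \<Longrightarrow> (x, y) \<in> (adj F')\<^sup>*"
  using rtrancl_mono[of "adj F" "adj F'"] by auto

lemma reach_edge: "{x, y} \<in> F \<Longrightarrow> (x, y) \<in> (adj F)\<^sup>*"
  by auto

lemma component_self: "x \<in> component F x"
  by (simp add: component_def)

lemma component_eq_iff: "component F x = component F y \<longleftrightarrow> (x, y) \<in> (adj F)\<^sup>*"
proof
  assume "component F x = component F y"
  then show "(x, y) \<in> (adj F)\<^sup>*" using component_self[of y F] by (auto simp: component_def)
next
  assume "(x, y) \<in> (adj F)\<^sup>*"
  then show "component F x = component F y"
    using reach_sym[of x y F] by (auto simp: component_def intro: rtrancl_trans)
qed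

lemma component_eqI: "y \<in> component F x \<Longrightarrow> component F y = component F x"
  by (metis Image_singleton_iff component_def component_eq_iff)

lemma component_subset: "simple_graph V F \<Longrightarrow> x \<in> V \<Longrightarrow> component F x \<subseteq> V"
proof
  fix y assume F: "simple_graph V F" and x: "x \<in> V" and "y \<in> component F x"
  then have "(x, y) \<in> (adj F)\<^sup>*" by (simp add: component_def)
  then show "y \<in> V"
    using x by (induction rule: rtrancl_induct) (auto dest: simple_graph_edgeD[OF F])
qed

text \<open>A walk can be shortened until it uses the new edge at most once, in one of its two
  directions.\<close>

lemma reach_insert:
  assumes "(x, y) \<in> (adj (insert {a, b} F))\<^sup>*"
  shows "(x, y) \<in> (adj F)\<^sup>* \<or> (x, a) \<in> (adj F)\<^sup>* \<and> (b, y) \<in> (adj F)\<^sup>* \<or>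
    (x, b) \<in> (adj F)\<^sup>* \<and> (a, y) \<in> (adj F)\<^sup>*"
  using assms
proof (induction rule: rtrancl_induct)
  case (step y z)
  show ?case
  proof (cases "{y, z} \<in> F")
    case True
    then have "(y, z) \<in> adj F" by simp
    then show ?thesis using step.IH by (meson rtrancl.rtrancl_into_rtrancl)
  next
    case False
    then have "y = a \<and> z = b \<or> y = b \<and> z = a" using step.hyps by (auto simp: doubleton_eq_iff)
    then show ?thesis using step.IH by (elim disjE conjE) simp_all
  qed
qed auto

lemma component_insert:
  "component (insert {a, b} F) x =
    (if x \<in> component F a \<union> component F b then component F a \<union> component F b else component F x)"
proof -
  let ?G = "insert {a, b} F"
  have mono: "component F y \<subseteq> component ?G y" for y
    unfolding component_def using reach_mono[of F ?G] by blast
  have ab: "component ?G a = component ?G b"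
    unfolding component_eq_iff by (rule reach_edge) simp
  show ?thesis
  proof (cases "x \<in> component F a \<union> component F b")
    case True
    then have "x \<in> component ?G a" using mono[of a] mono[of b] ab by blast
    then have eq: "component ?G x = component ?G a" by (rule component_eqI)
    have "y \<in> component F a \<union> component F b" if "y \<in> component ?G a" for y
      using that reach_insert[of a y a b F] by (auto simp: component_def)
    then show ?thesis using True mono[of a] mono[of b] ab eq by auto
  next
    case False
    then have "(x, a) \<notin> (adj F)\<^sup>*" "(x, b) \<notin> (adj F)\<^sup>*"
      using reach_sym[of x] by (auto simp: component_def)
    then have "component ?G x \<subseteq> component F x"
      using reach_insert[of x _ a b F] by (auto simp: component_def)
    then show ?thesis using False mono[of x] by auto
  qed
qed

lemma ncomp_insert_connected: "(a, b) \<in> (adj F)\<^sup>* \<Longrightarrow> ncomp V (insert {a, b} F) = ncomp V F"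
proof -
  assume "(a, b) \<in> (adj F)\<^sup>*"
  then have "component F a = component F b" by (simp add: component_eq_iff)
  then have "component (insert {a, b} F) x = component F x" for x
    using component_eqI[of x F a] by (simp add: component_insert)
  then show ?thesis by (simp add: ncomp_def)
qed

lemma ncomp_insert_disconnected:
  assumes V: "finite V" "a \<in> V" "b \<in> V" and ab: "(a, b) \<notin> (adj F)\<^sup>*"
  shows "ncomp V F = Suc (ncomp V (insert {a, b} F))"
proof -
  let ?A = "component F a" and ?B = "component F b" and ?C = "component F ` V"
  have ne: "?A \<noteq> ?B" using ab by (simp add: component_eq_iff)
  have "component (insert {a, b} F) ` V = insert (?A \<union> ?B) (?C - {?A, ?B})"
  proof (intro equalityI subsetI)
    fix Z assume "Z \<in> component (insert {a, b} F) ` V"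
    then obtain x where x: "x \<in> V" "Z = component (insert {a, b} F) x" by blast
    show "Z \<in> insert (?A \<union> ?B) (?C - {?A, ?B})"
    proof (cases "x \<in> ?A \<union> ?B")
      case True
      then show ?thesis using x by (simp add: component_insert)
    next
      case False
      then have "component F x \<noteq> ?A" "component F x \<noteq> ?B" using component_self[of x F] by auto
      then show ?thesis using False x by (simp add: component_insert)
    qed
  next
    fix Z assume "Z \<in> insert (?A \<union> ?B) (?C - {?A, ?B})"
    then consider "Z = ?A \<union> ?B" | x where "x \<in> V" "Z = component F x" "Z \<noteq> ?A" "Z \<noteq> ?B" by blast
    then show "Z \<in> component (insert {a, b} F) ` V"
    proof cases
      case 1
      then show ?thesis
        using V component_self[of a F] by (intro image_eqI[of _ _ a]) (auto simp: component_insert)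
    next
      case 2
      then have "x \<notin> ?A \<union> ?B" using component_eqI[of x F] by blast
      then show ?thesis using 2 by (intro image_eqI[of _ _ x]) (simp_all add: component_insert)
    qed
  qed
  moreover have "?A \<union> ?B \<notin> ?C - {?A, ?B}"
  proof
    assume "?A \<union> ?B \<in> ?C - {?A, ?B}"
    then obtain x where x: "component F x = ?A \<union> ?B" "component F x \<noteq> ?A" by auto
    then have "a \<in> component F x" using component_self[of a F] by blast
    from component_eqI[OF this] x(2) show False by metis
  qed
  ultimately have "ncomp V (insert {a, b} F) = Suc (card (?C - {?A, ?B}))"
    using V(1) by (simp add: ncomp_def)
  also have "Suc (Suc (card (?C - {?A, ?B}))) = card ?C"
  proof -
    have "card ?C = card (?C - {?A, ?B}) + card {?A, ?B}"
      using V(1) card_Diff_subset[of "{?A, ?B}" ?C] card_mono[of ?C "{?A, ?B}"] V(2,3) by simp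
    then show ?thesis using ne by simp
  qed
  finally show ?thesis by (simp add: ncomp_def)
qed

lemma simple_graph_obtain:
  assumes "simple_graph V F" "e \<in> F"
  obtains a b where "e = {a, b}" "a \<in> V" "b \<in> V" "a \<noteq> b"
  using assms by (auto simp: simple_graph_def)

lemma simple_graph_mono: "simple_graph V F \<Longrightarrow> F' \<subseteq> F \<Longrightarrow> simple_graph V F'"
  by (auto simp: simple_graph_def)

lemma simple_graph_finite: "simple_graph V F \<Longrightarrow> finite V \<Longrightarrow> finite F"
  by (rule finite_subset[of _ "Pow V"]) (auto simp: simple_graph_def)

text \<open>Each new edge raises \<open>card F\<close> by one and lowers the number of components by
  at most one. Starting from no edges, the sum is \<open>card V\<close>.\<close>

lemma excess_mono:
  assumes V: "finite V" "simple_graph V F'" and "F \<subseteq> F'"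
  shows "card F + ncomp V F \<le> card F' + ncomp V F'"
proof -
  have fin: "finite F'" using simple_graph_finite V by blast
  have "card F + ncomp V F \<le> card (F \<union> G) + ncomp V (F \<union> G)" if "finite G" "G \<subseteq> F' - F" for G
    using that
  proof (induction G rule: finite_induct)
    case (insert e G)
    then have "e \<in> F'" by blast
    then obtain a b where e: "e = {a, b}" "a \<in> V" "b \<in> V"
      using simple_graph_obtain[OF V(2)] by metis
    have "finite (F \<union> G)" using fin \<open>F \<subseteq> F'\<close> insert finite_subset by blast
    then have "card (F \<union> insert e G) = Suc (card (F \<union> G))" using insert by auto
    moreover have "ncomp V (F \<union> G) \<le> Suc (ncomp V (F \<union> insert e G))"
      using ncomp_insert_connected[of a b "F \<union> G" V] ncomp_insert_disconnected[OF V(1) e(2,3), of "F \<union> G"]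
      by (cases "(a, b) \<in> (adj (F \<union> G))\<^sup>*") (auto simp: e(1))
    ultimately show ?case using insert by auto
  qed simp
  from this[of "F' - F"] show ?thesis using assms fin by (simp add: Un_absorb1)
qed

lemma component_empty: "component {} x = {x}"
  by (simp add: component_def)

lemma card_le_edges_plus_ncomp:
  assumes "finite V" "simple_graph V F"
  shows "card V \<le> card F + ncomp V F"
  using excess_mono[OF assms, of "{}"] by (simp add: ncomp_def component_empty card_image)

text \<open>A bridge of \<open>E\<close> joins different components of every subgraph not containing
  it, so each edge added on the way from \<open>F\<close> to \<open>E\<close> lowers the number of
  components by exactly one.\<close>

lemma excess_eq_of_not_redundant:
  assumes V: "finite V" "simple_graph V E" and "F \<subseteq> E"
    and nr: "\<And>a b. {a, b} \<in> E - F \<Longrightarrow> \<not> redundant E a b"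
  shows "card F + ncomp V F = card E + ncomp V E"
proof -
  have fin: "finite E" using simple_graph_finite V by blast
  have "card F + ncomp V F = card (F \<union> G) + ncomp V (F \<union> G)" if "finite G" "G \<subseteq> E - F" for G
    using that
  proof (induction G rule: finite_induct)
    case (insert e G)
    then have "e \<in> E" by blast
    then obtain a b where e: "e = {a, b}" "a \<in> V" "b \<in> V"
      using simple_graph_obtain[OF V(2)] by metis
    have "finite (F \<union> G)" using fin \<open>F \<subseteq> E\<close> insert finite_subset by blast
    then have "card (F \<union> insert e G) = Suc (card (F \<union> G))" using insert by auto
    moreover have "(a, b) \<notin> (adj (F \<union> G))\<^sup>*"
      using nr[of a b] e insert \<open>F \<subseteq> E\<close> reach_mono[of "F \<union> G" "E - {{a, b}}" a b]
      unfolding redundant_def by blast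
    then have "ncomp V (F \<union> G) = Suc (ncomp V (F \<union> insert e G))"
      using ncomp_insert_disconnected[OF V(1) e(2,3), of "F \<union> G"] by (simp add: e(1))
    ultimately show ?case using insert by auto
  qed simp
  from this[of "E - F"] show ?thesis using assms fin by (simp add: Un_absorb1)
qed

lemma ncomp_remove_redundant:
  assumes "{a, b} \<in> F" "redundant F a b"
  shows "ncomp V (F - {{a, b}}) = ncomp V F"
  using ncomp_insert_connected[of a b "F - {{a, b}}" V] assms
  by (simp add: redundant_def insert_absorb)

lemma ncomp_connected:
  assumes "connected_graph V E" shows "ncomp V E = 1"
proof -
  obtain v where v: "v \<in> V" using assms by (auto simp: connected_graph_def)
  then have "component E x = component E v" if "x \<in> V" for x
    using assms that by (simp add: component_eq_iff connected_graph_def)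
  then have "component E ` V = (\<lambda>_. component E v) ` V" by (rule image_cong[OF refl])
  then have "component E ` V = {component E v}" using v by (auto simp: image_constant_conv)
  then show ?thesis by (simp add: ncomp_def)
qed

lemma connected_remove_redundant:
  assumes "connected_graph V E" "{a, b} \<in> E" "redundant E a b"
  shows "connected_graph V (E - {{a, b}})"
proof -
  have "(x, y) \<in> (adj (E - {{a, b}}))\<^sup>*" if "(x, y) \<in> (adj E)\<^sup>*" for x y
  proof -
    let ?F = "E - {{a, b}}"
    have ab: "(a, b) \<in> (adj ?F)\<^sup>*" using assms(3) by (simp only: redundant_def)
    have "insert {a, b} ?F = E" using assms(2) by blast
    then have "(x, y) \<in> (adj (insert {a, b} ?F))\<^sup>*" using that by (simp only:)
    from reach_insert[OF this] show ?thesis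
      using rtrancl_trans[OF _ rtrancl_trans[OF ab]] rtrancl_trans[OF _ rtrancl_trans[OF reach_sym[OF ab]]]
      by (elim disjE conjE) assumption+
  qed
  then show ?thesis using assms(1) unfolding connected_graph_def by simp
qed

lemma ncomp_isolated:
  assumes "finite V" "v \<in> V" "\<And>e. e \<in> F \<Longrightarrow> v \<notin> e"
  shows "ncomp V F = Suc (ncomp (V - {v}) F)"
proof -
  have "y = v" if "(v, y) \<in> (adj F)\<^sup>*" for y
    using that by (cases rule: converse_rtranclE) (use assms(3) in auto)
  then have v: "component F v = {v}" using component_self[of v F] by (auto simp: component_def)
  have "component F v \<notin> component F ` (V - {v})"
    using component_self[of _ F] unfolding v by blast
  moreover have "component F ` V = insert (component F v) (component F ` (V - {v}))"
    using assms(2) by blast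
  ultimately show ?thesis using assms(1) by (simp add: ncomp_def)
qed

section \<open>Paths\<close>

definition path_edges :: "'a list \<Rightarrow> 'a set set" where
  "path_edges vs = {{vs ! i, vs ! Suc i} | i. Suc i < length vs}"

lemma path_on_iff: "path_on vs V E \<longleftrightarrow> vs \<noteq> [] \<and> distinct vs \<and> V = set vs \<and> E = path_edges vs"
  by (simp add: path_on_def path_edges_def)

lemma path_edges_single: "path_edges [a] = {}"
  by (simp add: path_edges_def)

lemma path_edges_Cons: "path_edges (a # b # vs) = insert {a, b} (path_edges (b # vs))"
proof -
  have "path_edges (a # b # vs) =
      (\<lambda>i. {(a # b # vs) ! i, (a # b # vs) ! Suc i}) ` {..<Suc (length vs)}"
    by (auto simp: path_edges_def)
  also have "\<dots> = insert {a, b} ((\<lambda>i. {(b # vs) ! i, (b # vs) ! Suc i}) ` {..<length vs})"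
    by (simp add: lessThan_Suc_eq_insert_0 image_image)
  also have "(\<lambda>i. {(b # vs) ! i, (b # vs) ! Suc i}) ` {..<length vs} = path_edges (b # vs)"
    by (auto simp: path_edges_def)
  finally show ?thesis .
qed

lemma simple_graph_path_edges: "distinct vs \<Longrightarrow> simple_graph (set vs) (path_edges vs)"
  unfolding simple_graph_def path_edges_def
proof safe
  fix i assume "distinct vs" "Suc i < length vs"
  then show "\<exists>u v. {vs ! i, vs ! Suc i} = {u, v} \<and> u \<in> set vs \<and> v \<in> set vs \<and> u \<noteq> v"
    by (intro exI[of _ "vs ! i"] exI[of _ "vs ! Suc i"]) (auto simp: nth_eq_iff_index_eq)
qed

lemma card_path_edges: "distinct vs \<Longrightarrow> vs \<noteq> [] \<Longrightarrow> Suc (card (path_edges vs)) = card (set vs)"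
proof (induction vs rule: induct_list012)
  case (3 a b vs)
  have "path_edges (b # vs) \<subseteq> Pow (set (b # vs))"
    using 3 simple_graph_path_edges[of "b # vs"] by (auto simp: simple_graph_def)
  then have "{a, b} \<notin> path_edges (b # vs)" "finite (path_edges (b # vs))"
    using 3 finite_subset by auto
  then show ?case using 3 by (simp add: path_edges_Cons)
qed (simp_all add: path_edges_single)

definition vdegree :: "'a set set \<Rightarrow> 'a \<Rightarrow> nat" where
  "vdegree F v = card {e \<in> F. v \<in> e}"

lemma sum_vdegree:
  assumes "finite V" "simple_graph V F" shows "(\<Sum>v\<in>V. vdegree F v) = 2 * card F"
proof -
  have fin: "finite F" using simple_graph_finite assms by blast
  have "(\<Sum>v\<in>V. vdegree F v) = (\<Sum>v\<in>V. \<Sum>e\<in>F. if v \<in> e then 1 else 0)"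
    using fin by (simp add: vdegree_def sum.If_cases Int_def)
  also have "\<dots> = (\<Sum>e\<in>F. \<Sum>v\<in>V. if v \<in> e then 1 else 0)" by (rule sum.swap)
  also have "\<dots> = (\<Sum>e\<in>F. 2)"
  proof (rule sum.cong[OF refl])
    fix e assume "e \<in> F"
    then obtain a b where e: "e = {a, b}" "a \<in> V" "b \<in> V" "a \<noteq> b"
      using simple_graph_obtain[OF assms(2)] by metis
    then have "V \<inter> e = {a, b}" by blast
    then show "(\<Sum>v\<in>V. if v \<in> e then 1 else 0) = (2::nat)"
      using assms(1) e(4) by (simp add: sum.If_cases)
  qed
  finally show ?thesis by simp
qed

lemma vdegree_mono: "finite F \<Longrightarrow> F' \<subseteq> F \<Longrightarrow> vdegree F' v \<le> vdegree F v"
  unfolding vdegree_def by (rule card_mono) auto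

lemma vdegree_remove: "finite F \<Longrightarrow> e \<in> F \<Longrightarrow> v \<in> e \<Longrightarrow> vdegree F v = Suc (vdegree (F - {e}) v)"
proof -
  assume "finite F" "e \<in> F" "v \<in> e"
  moreover have "{x \<in> F - {e}. v \<in> x} = {x \<in> F. v \<in> x} - {e}" by blast
  ultimately show ?thesis
    unfolding vdegree_def by (simp add: card_Suc_Diff1[of "{x \<in> F. v \<in> x}" e, symmetric] del: card_Suc_Diff1 card_Diff_insert)
qed

lemma exists_low_degree:
  assumes "finite V" "simple_graph V F" "card F < card V"
  shows "\<exists>v\<in>V. vdegree F v \<le> 1"
proof (rule ccontr)
  assume "\<not> ?thesis"
  then have "(\<Sum>v\<in>V. 2) \<le> (\<Sum>v\<in>V. vdegree F v)" by (intro sum_mono) (auto simp: not_le)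
  then show False using sum_vdegree[OF assms(1,2)] assms(3) by simp
qed

text \<open>Peeling off \<open>a\<close> lowers the degree of its only neighbour to at most one, so
  that the neighbour serves as the endpoint of what remains.\<close>

lemma path_with_endpoint_of_degrees:
  assumes "finite V" "simple_graph V F" "connected_graph V F" "a \<in> V" "vdegree F a \<le> 1"
    and "\<And>v. v \<in> V \<Longrightarrow> vdegree F v \<le> 2"
  shows "path_with_endpoint a V F"
  using assms
proof (induction "card V" arbitrary: V F a rule: less_induct)
  case less
  have fin: "finite F" using simple_graph_finite less.prems by blast
  show ?case
  proof (cases "V = {a}")
    case True
    then have "F = {}" using less.prems(2) by (auto simp: simple_graph_def)
    then show ?thesis using True
      unfolding path_with_endpoint_def path_on_iff by (intro exI[of _ "[a]"]) (simp add: path_edges_single)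
  next
    case False
    then obtain c where c: "c \<in> V" "c \<noteq> a" using less.prems(4) by blast
    have "(a, c) \<in> (adj F)\<^sup>*" using less.prems(3,4) c by (simp add: connected_graph_def)
    then obtain b where b: "{a, b} \<in> F"
      using c(2) by (cases rule: converse_rtranclE) auto
    note bV = simple_graph_edgeD[OF less.prems(2) b]
    have only: "e = {a, b}" if "e \<in> F" "a \<in> e" for e
    proof -
      have "{{a, b}, e} \<subseteq> {e \<in> F. a \<in> e}" using b that by auto
      then have "card {{a, b}, e} \<le> 1"
        using card_mono[of "{e \<in> F. a \<in> e}" "{{a, b}, e}"] fin less.prems(5) unfolding vdegree_def by simp
      then show ?thesis by (cases "e = {a, b}") auto
    qed
    let ?V = "V - {a}" and ?F = "F - {{a, b}}"
    have noa: "a \<notin> e" if "e \<in> ?F" for e using only that by blast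
    have sg: "simple_graph ?V ?F"
      unfolding simple_graph_def
    proof
      fix e assume e: "e \<in> ?F"
      then obtain u v where "e = {u, v}" "u \<in> V" "v \<in> V" "u \<noteq> v"
        using simple_graph_obtain[OF less.prems(2)] by (metis DiffD1)
      then show "e \<in> {{u, v} | u v. u \<in> ?V \<and> v \<in> ?V \<and> u \<noteq> v}" using noa[OF e] by blast
    qed
    \<comment> \<open>A walk can leave \<open>a\<close> only back to \<open>b\<close>, so detours
      through \<open>a\<close> may be cut out and the deletion of \<open>a\<close> disconnects
      nothing.\<close>
    have reach: "x = a \<or> (b, x) \<in> (adj ?F)\<^sup>*" if "(b, x) \<in> (adj F)\<^sup>*" for x
      using that
    proof (induction rule: rtrancl_induct)
      case (step y z)
      show ?case
      proof (cases "a \<in> {y, z}")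
        case True
        then have "{y, z} = {a, b}" using only step by auto
        then have "z = a \<or> z = b" by (auto simp: doubleton_eq_iff)
        then show ?thesis by auto
      next
        case False
        then have "(b, y) \<in> (adj ?F)\<^sup>*" "(y, z) \<in> adj ?F" using step by auto
        then show ?thesis using rtrancl_into_rtrancl[of b y "adj ?F" z] by simp
      qed
    qed simp
    have con: "connected_graph ?V ?F"
      unfolding connected_graph_def
    proof (intro conjI ballI)
      show "?V \<noteq> {}" using c by blast
      fix u v assume uv: "u \<in> ?V" "v \<in> ?V"
      then have "(b, u) \<in> (adj ?F)\<^sup>*" "(b, v) \<in> (adj ?F)\<^sup>*"
        using less.prems(3) bV(2) reach unfolding connected_graph_def by auto
      then show "(u, v) \<in> (adj ?F)\<^sup>*" using rtrancl_trans[OF reach_sym[of b u ?F]] by simp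
    qed
    have "vdegree ?F b \<le> 1"
      using vdegree_remove[OF fin b, of b] less.prems(6)[OF bV(2)] by simp
    moreover have "vdegree ?F v \<le> 2" if "v \<in> ?V" for v
      using vdegree_mono[OF fin, of ?F v] less.prems(6)[of v] that by auto
    moreover have "card ?V < card V" using less.prems(1,4) by (intro psubset_card_mono) auto
    ultimately have "path_with_endpoint b ?V ?F"
      using less.prems(1) bV by (intro less.hyps sg con) auto
    then obtain vs where vs: "vs \<noteq> []" "distinct vs" "?V = set vs" "?F = path_edges vs" "hd vs = b"
      unfolding path_with_endpoint_def path_on_iff by blast
    then obtain ws where ws: "vs = b # ws" by (cases vs) auto
    have "F = path_edges (a # vs)"
      using vs(4) b unfolding ws path_edges_Cons by blast
    moreover have "V = set (a # vs)" using vs(3) less.prems(4) by auto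
    moreover have "a \<notin> set vs" using vs(3) by blast
    ultimately show ?thesis
      unfolding path_with_endpoint_def path_on_iff using vs by (intro exI[of _ "a # vs"]) auto
  qed
qed

text \<open>Having fewer edges than vertices yields a vertex of degree at most one to start from and
  thereby excludes a cycle.\<close>

lemma path_graph_of_degrees:
  assumes "finite V" "simple_graph V F" "connected_graph V F" "card F < card V"
    and "\<And>v. v \<in> V \<Longrightarrow> vdegree F v \<le> 2"
  shows "path_graph V F"
proof -
  obtain a where "a \<in> V" "vdegree F a \<le> 1" using exists_low_degree assms by blast
  then show ?thesis
    using path_with_endpoint_of_degrees[of V F a] assms
    by (auto simp: path_graph_def path_with_endpoint_def)
qed

text \<open>A set meeting every component of the path without \<open>S\<close>: the first vertex of each of its segments.\<close>

lemma path_segment_starts: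
  assumes "vs \<noteq> []" "distinct vs" "path_edges vs \<subseteq> E"
  shows "\<exists>R\<subseteq>set vs - S. card R \<le> card (S \<inter> set vs) + (if hd vs \<in> S then 0 else 1) \<and>
    (hd vs \<notin> S \<longrightarrow> hd vs \<in> R) \<and> (\<forall>j\<in>set vs - S. \<exists>r\<in>R. (r, j) \<in> (adj (avoid E S))\<^sup>*)"
  using assms
proof (induction vs rule: induct_list012)
  case (2 a)
  show ?case by (intro exI[of _ "{a} - S"]) (auto simp: insert_Diff_if)
next
  case (3 a b vs)
  have ab: "a \<notin> set (b # vs)" "{a, b} \<in> E" "path_edges (b # vs) \<subseteq> E"
    using 3 by (auto simp: path_edges_Cons)
  then obtain R where R: "R \<subseteq> set (b # vs) - S"
    "card R \<le> card (S \<inter> set (b # vs)) + (if b \<in> S then 0 else 1)" "b \<notin> S \<longrightarrow> b \<in> R"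
    "\<forall>j\<in>set (b # vs) - S. \<exists>r\<in>R. (r, j) \<in> (adj (avoid E S))\<^sup>*"
    using "3.IH"(2) 3 by auto
  have fin: "finite R" using R(1) finite_subset by blast
  show ?case
  proof (cases "a \<in> S")
    case True
    then have "S \<inter> set (a # b # vs) = insert a (S \<inter> set (b # vs))" by auto
    then have "card (S \<inter> set (a # b # vs)) = Suc (card (S \<inter> set (b # vs)))" using ab(1) by auto
    then have "card R \<le> card (S \<inter> set (a # b # vs))" using R(2) by (simp split: if_splits)
    then show ?thesis using R True by (intro exI[of _ R]) auto
  next
    case False
    then have S: "S \<inter> set (a # b # vs) = S \<inter> set (b # vs)" by auto
    have step: "(a, b) \<in> (adj (avoid E S))\<^sup>*" if "b \<notin> S"
      using that ab(2) False by (intro reach_edge) (auto simp: avoid_def)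
    \<comment> \<open>If a segment starts at \<open>b\<close>, then \<open>a\<close> extends it and
      replaces \<open>b\<close> as its first vertex; otherwise \<open>b\<close> lies in
      \<open>S\<close> and \<open>a\<close> is a segment of its own.\<close>
    let ?R = "insert a (R - {b})"
    have "card ?R \<le> card (S \<inter> set (b # vs)) + 1"
    proof (cases "b \<in> S")
      case True
      then have "b \<notin> R" using R(1) by auto
      then show ?thesis using fin ab(1) R True by (auto simp: card_insert_if)
    next
      case b: False
      then have "Suc (card (R - {b})) = card R" using R(3) fin by (simp add: card_Suc_Diff1 del: card_Diff_insert)
      then show ?thesis using fin R(2) b by (simp add: card_insert_if del: card_Diff_insert)
    qed
    moreover have "\<exists>r\<in>?R. (r, j) \<in> (adj (avoid E S))\<^sup>*" if "j \<in> set (a # b # vs) - S" for j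
    proof (cases "j = a")
      case False
      then have j: "j \<in> set (b # vs) - S" using that by auto
      obtain r where r: "r \<in> R" "(r, j) \<in> (adj (avoid E S))\<^sup>*" using R(4) j by blast
      show ?thesis
      proof (cases "r = b")
        case True
        then have "b \<notin> S" using R(1) r by blast
        then have "(a, j) \<in> (adj (avoid E S))\<^sup>*" using rtrancl_trans[OF step, of j] r(2) True by simp
        then show ?thesis by blast
      qed (use r in blast)
    qed auto
    moreover have "?R \<subseteq> set (a # b # vs) - S" using R(1) False by auto
    ultimately show ?thesis using False unfolding S by (intro exI[of _ ?R]) simp
  qed
qed simp

section \<open>The structure of graphs with few components after vertex deletion\<close>

lemma simple_graph_avoid: "simple_graph V E \<Longrightarrow> simple_graph (V - S) (avoid E S)"
proof -
  assume E: "simple_graph V E"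
  show ?thesis
    unfolding simple_graph_def
  proof
    fix e assume e: "e \<in> avoid E S"
    then have "e \<in> E" by (simp add: avoid_def)
    then obtain u v where "e = {u, v}" "u \<in> V" "v \<in> V" "u \<noteq> v"
      using simple_graph_obtain[OF E] by metis
    moreover have "e \<inter> S = {}" using e by (simp add: avoid_def)
    ultimately show "e \<in> {{u, v} | u v. u \<in> V - S \<and> v \<in> V - S \<and> u \<noteq> v}" by blast
  qed
qed

lemma card_avoid_vertex: "finite E \<Longrightarrow> card (avoid E {v}) + vdegree E v = card E"
proof -
  assume "finite E"
  moreover have "E = avoid E {v} \<union> {e \<in> E. v \<in> e}" by (auto simp: avoid_def)
  moreover have "card (avoid E {v} \<union> {e \<in> E. v \<in> e}) = card (avoid E {v}) + card {e \<in> E. v \<in> e}"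
    using \<open>finite E\<close> by (intro card_Un_disjoint) (auto simp: avoid_def)
  ultimately show ?thesis by (simp add: vdegree_def)
qed

text \<open>Since the vertices are not adjacent, no edge is counted at both of them.\<close>

lemma card_avoid_two_vertices:
  assumes "simple_graph V E" "finite E" "u \<noteq> w" "{u, w} \<notin> E"
  shows "card (avoid E {u, w}) + vdegree E u + vdegree E w = card E"
proof -
  have "{e \<in> avoid E {u}. w \<in> e} = {e \<in> E. w \<in> e}"
  proof -
    have "u \<notin> e" if eE: "e \<in> E" and we: "w \<in> e" for e
    proof
      assume "u \<in> e"
      obtain a b where "e = {a, b}" using simple_graph_obtain[OF assms(1) eE] by metis
      then have "e = {u, w}" using \<open>u \<in> e\<close> we assms(3) by auto
      then show False using assms(4) eE by simp
    qed
    then show ?thesis by (auto simp: avoid_def)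
  qed
  moreover have "avoid (avoid E {u}) {w} = avoid E {u, w}" by (auto simp: avoid_def)
  moreover have "finite (avoid E {u})" using assms(2) by (simp add: avoid_def)
  ultimately show ?thesis
    using card_avoid_vertex[OF assms(2), of u] card_avoid_vertex[of "avoid E {u}" w]
    by (simp add: vdegree_def)
qed

lemma redundant_commute: "redundant E a b \<longleftrightarrow> redundant E b a"
  unfolding redundant_def insert_commute[of b a "{}"] by (rule iffI) (erule reach_sym)+

lemma redundant_triangle:
  assumes "{a, b} \<in> E" "{b, c} \<in> E" "{a, c} \<in> E" "a \<noteq> b" "b \<noteq> c" "a \<noteq> c"
  shows "redundant E a b"
proof -
  have "{a, c} \<noteq> {a, b}" "{c, b} \<noteq> {a, b}" using assms(4-6) by (simp_all add: doubleton_eq_iff)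
  then have "(a, c) \<in> adj (E - {{a, b}})" "(c, b) \<in> adj (E - {{a, b}})"
    using assms(2,3) by (simp_all add: insert_commute[of c b])
  then show ?thesis
    unfolding redundant_def by (rule rtrancl_trans[OF r_into_rtrancl r_into_rtrancl])
qed

section \<open>Components as graphs of their own\<close>

lemma simple_graph_component:
  assumes "simple_graph V F" shows "simple_graph C {e \<in> F. e \<subseteq> C}"
  unfolding simple_graph_def
proof
  fix e assume e: "e \<in> {e \<in> F. e \<subseteq> C}"
  then have "e \<in> F" by blast
  then obtain a b where "e = {a, b}" "a \<noteq> b" using simple_graph_obtain[OF assms] by metis
  then show "e \<in> {{u, v} | u v. u \<in> C \<and> v \<in> C \<and> u \<noteq> v}" using e by blast
qed

lemma connected_graph_component:
  "connected_graph (component F u) {e \<in> F. e \<subseteq> component F u}"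
proof -
  let ?C = "component F u" and ?F = "{e \<in> F. e \<subseteq> component F u}"
  have reach: "(u, x) \<in> (adj ?F)\<^sup>*" if "(u, x) \<in> (adj F)\<^sup>*" for x
    using that
  proof (induction rule: rtrancl_induct)
    case (step y z)
    have "(u, z) \<in> (adj F)\<^sup>*" using step by (rule_tac rtrancl_into_rtrancl)
    then have "{y, z} \<subseteq> ?C" using step.hyps(1) by (simp add: component_def)
    then have "(y, z) \<in> adj ?F" using step.hyps(2) by simp
    then show ?case by (rule rtrancl_into_rtrancl[OF step.IH])
  qed simp
  show ?thesis
    unfolding connected_graph_def
  proof (intro conjI ballI)
    show "?C \<noteq> {}" using component_self by (metis empty_iff)
    fix x y assume "x \<in> ?C" "y \<in> ?C"
    then have "(u, x) \<in> (adj ?F)\<^sup>*" "(u, y) \<in> (adj ?F)\<^sup>*"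
      using reach by (simp_all add: component_def)
    then show "(x, y) \<in> (adj ?F)\<^sup>*" using rtrancl_trans[OF reach_sym[of u x ?F]] by simp
  qed
qed

lemma edge_in_component:
  assumes "simple_graph V F" "e \<in> F" "x \<in> e" shows "e \<subseteq> component F x"
proof -
  obtain a b where e: "e = {a, b}" using simple_graph_obtain[OF assms(1,2)] by metis
  then have "(a, b) \<in> (adj F)\<^sup>*" using assms(2) by (intro reach_edge) simp
  then show ?thesis
    using e assms(3) reach_sym[of a b F] by (auto simp: component_def)
qed

text \<open>What follows the last edge of \<open>G\<close> on a walk starts in \<open>A\<close> and
  avoids \<open>G\<close>. Hence the ends of deleted edges meet every component that remains of a
  connected graph.\<close>

lemma reach_without_edges:
  assumes "(a, x) \<in> (adj E)\<^sup>*" "a \<in> A" "\<And>e. e \<in> G \<Longrightarrow> e \<subseteq> A"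
  shows "\<exists>a'\<in>A. x \<in> component (E - G) a'"
  using assms(1)
proof (induction rule: rtrancl_induct)
  case base
  then show ?case using assms(2) component_self by metis
next
  case (step y z)
  show ?case
  proof (cases "{y, z} \<in> G")
    case True
    then have "z \<in> A" using assms(3) by blast
    then show ?thesis using component_self by metis
  next
    case False
    obtain a' where "a' \<in> A" "(a', y) \<in> (adj (E - G))\<^sup>*" using step.IH by (auto simp: component_def)
    moreover have "(y, z) \<in> adj (E - G)" using False step.hyps(2) by simp
    ultimately have "(a', z) \<in> (adj (E - G))\<^sup>*" by (rule_tac rtrancl_into_rtrancl)
    then show ?thesis using \<open>a' \<in> A\<close> by (auto simp: component_def)
  qed
qed

lemma components_disjoint:
  "component F x \<noteq> component F y \<Longrightarrow> component F x \<inter> component F y = {}"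
  using component_eqI by (metis disjoint_iff)

lemma redundant_edge_of_cycle:
  assumes "is_cycle E vs"
  shows "{last vs, hd vs} \<in> E \<and> redundant E (last vs) (hd vs)"
proof -
  have vs: "length vs \<ge> 3" "distinct vs" and
    edge: "\<And>i. i < length vs \<Longrightarrow> {vs ! i, vs ! (Suc i mod length vs)} \<in> E"
    using assms by (auto simp: is_cycle_def)
  have ne: "vs \<noteq> []" using vs by auto
  have ends: "hd vs = vs ! 0" "last vs = vs ! (length vs - 1)"
    using ne by (simp_all add: hd_conv_nth last_conv_nth)
  let ?e = "{last vs, hd vs}"
  have "(vs ! 0, vs ! i) \<in> (adj (E - {?e}))\<^sup>*" if "i < length vs" for i
    using that
  proof (induction i)
    case (Suc i)
    \<comment> \<open>With at least three vertices, no pair of consecutive entries coincides with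
      the closing edge.\<close>
    have "{vs ! i, vs ! Suc i} \<noteq> ?e"
    proof -
      have "vs ! Suc i \<noteq> vs ! 0" "vs ! i = vs ! 0 \<longleftrightarrow> i = 0"
        "vs ! Suc i = vs ! (length vs - 1) \<longleftrightarrow> Suc i = length vs - 1"
        using Suc.prems vs ne by (simp_all add: nth_eq_iff_index_eq)
      then show ?thesis using vs(1) unfolding ends doubleton_eq_iff by linarith
    qed
    then have "(vs ! i, vs ! Suc i) \<in> adj (E - {?e})" using edge[of i] Suc.prems by simp
    then show ?case using rtrancl_into_rtrancl[OF Suc.IH] Suc.prems by simp
  qed simp
  then have "(hd vs, last vs) \<in> (adj (E - {?e}))\<^sup>*" using ne unfolding ends by simp
  then have "redundant E (last vs) (hd vs)" unfolding redundant_def by (rule reach_sym)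
  moreover have "?e \<in> E"
    using edge[of "length vs - 1"] ne unfolding ends by simp
  ultimately show ?thesis by blast
qed

lemma cycle_of_redundant_edge:
  assumes "simple_graph V E" "{a, b} \<in> E" "redundant E a b"
  shows "\<exists>vs. is_cycle E vs"
proof -
  define r where "r = (\<lambda>x y. {x, y} \<in> E - {{a, b}})"
  have "{(x, y). r x y} = adj (E - {{a, b}})" by (simp add: r_def)
  then have "r\<^sup>*\<^sup>* a b"
    using assms(3) unfolding redundant_def by (simp add: rtranclp_rtrancl_eq)
  then obtain xs0 where "rtrancl_path r a xs0 b" by (auto simp: rtranclp_eq_rtrancl_path)
  then obtain xs where xs: "rtrancl_path r a xs b" "distinct (a # xs)"
    by (rule rtrancl_path_distinct)
  have ab: "a \<noteq> b" using simple_graph_edgeD[OF assms(1,2)] by simp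
  then have ne: "xs \<noteq> []" using xs(1) by (auto elim: rtrancl_path.cases)
  have last: "last xs = b" using rtrancl_path_last[OF xs(1) ne] .
  have step: "r ((a # xs) ! i) (xs ! i)" if "i < length xs" for i
    using rtrancl_path_nth[OF xs(1) that] .
  \<comment> \<open>A single step would be the removed edge itself, so the path has an inner vertex
    and closes up to a genuine cycle.\<close>
  have "length xs \<noteq> 1"
    using step[of 0] last by (auto simp: length_Suc_conv r_def)
  then have len: "length (a # xs) \<ge> 3" using ne by (cases xs; cases "tl xs") auto
  have "{(a # xs) ! i, (a # xs) ! (Suc i mod length (a # xs))} \<in> E" if "i < length (a # xs)" for i
  proof (cases "i = length xs")
    case True
    then have "(a # xs) ! i = b" using last ne by (simp add: last_conv_nth nth_Cons')
    then show ?thesis using True assms(2) by (simp add: insert_commute)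
  next
    case False
    then show ?thesis using step[of i] that by (simp add: r_def)
  qed
  then show ?thesis unfolding is_cycle_def using len xs(2) by blast
qed

lemma avoid_empty: "avoid E {} = E"
  by (simp add: avoid_def)

text \<open>The last assumption says that \<open>|E| - 1\<close> is at most the height bound given by \<open>S\<close>.\<close>

locale few_components_graph =
  fixes V :: "'a set" and E :: "'a set set"
  assumes finite_V: "finite V" and simple: "simple_graph V E" and connected: "connected_graph V E"
    and few: "S \<subseteq> V \<Longrightarrow> ncomp (V - S) (avoid E S) + card E \<le> card V + card S + 1"
begin

lemma finite_E: "finite E"
  using simple_graph_finite[OF simple finite_V] .

lemma card_E_le: "card E \<le> card V"
  using few[of "{}"] ncomp_connected[OF connected] by (simp add: avoid_empty)

lemma card_V_le: "card V \<le> card E + 1"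
  using card_le_edges_plus_ncomp[OF finite_V simple] ncomp_connected[OF connected] by simp

text \<open>\<open>G - v\<close> has at least \<open>(n - 1) - (|E| - deg v)\<close> components,
  while \<open>few\<close> permits at most \<open>n + 2 - |E|\<close>.\<close>

lemma vdegree_le: "v \<in> V \<Longrightarrow> vdegree E v \<le> 3"
proof -
  assume v: "v \<in> V"
  have "card (V - {v}) \<le> card (avoid E {v}) + ncomp (V - {v}) (avoid E {v})"
    using finite_V by (intro card_le_edges_plus_ncomp simple_graph_avoid simple) simp
  moreover have "Suc (card (V - {v})) = card V" using finite_V v by (simp add: card_Suc_Diff1 del: card_Diff_insert)
  ultimately show ?thesis
    using few[of "{v}"] v card_avoid_vertex[OF finite_E, of v] by simp
qed

text \<open>Deleting two non-adjacent vertices of degree three removes six edges and leaves at least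
  \<open>n + 4 - |E|\<close> components, one more than \<open>few\<close> permits.\<close>

lemma high_degree_adjacent:
  assumes "u \<in> V" "w \<in> V" "u \<noteq> w" "vdegree E u \<ge> 3" "vdegree E w \<ge> 3"
  shows "{u, w} \<in> E"
proof (rule ccontr)
  assume "{u, w} \<notin> E"
  have "card (V - {u, w}) \<le> card (avoid E {u, w}) + ncomp (V - {u, w}) (avoid E {u, w})"
    using finite_V by (intro card_le_edges_plus_ncomp simple_graph_avoid simple) simp
  moreover have "card (V - {u, w}) = card V - 2"
    using assms finite_V by (simp add: card_Diff_subset)
  moreover have "ncomp (V - {u, w}) (avoid E {u, w}) + card E \<le> card V + 2 + 1"
    using few[of "{u, w}"] assms by simp
  ultimately show False
    using card_avoid_two_vertices[OF simple finite_E assms(3) \<open>{u, w} \<notin> E\<close>] assms(4,5) by linarith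
qed

text \<open>Deleting a vertex of degree three already exhausts the bound \<open>few\<close>, and a
  cycle avoiding it would force one more component. So every cycle passes through
  \<open>w\<close>.\<close>

lemma not_redundant_avoiding:
  assumes "w \<in> V" "vdegree E w \<ge> 3" "{a, b} \<in> avoid E {w}"
  shows "\<not> redundant (avoid E {w}) a b"
proof
  assume r: "redundant (avoid E {w}) a b"
  let ?F = "avoid E {w}"
  have fin: "finite ?F" using finite_E by (simp add: avoid_def)
  have sg: "simple_graph (V - {w}) (?F - {{a, b}})"
    by (rule simple_graph_mono[OF simple_graph_avoid[OF simple]]) blast
  have "card (V - {w}) \<le> card (?F - {{a, b}}) + ncomp (V - {w}) (?F - {{a, b}})"
    using finite_V by (intro card_le_edges_plus_ncomp sg) simp
  moreover have "Suc (card (V - {w})) = card V"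
    using finite_V assms(1) by (simp add: card_Suc_Diff1 del: card_Diff_insert)
  moreover have "Suc (card (?F - {{a, b}})) = card ?F"
    using fin assms(3) by (simp add: card_Suc_Diff1 del: card_Diff_insert)
  moreover have "ncomp (V - {w}) (?F - {{a, b}}) = ncomp (V - {w}) ?F"
    by (rule ncomp_remove_redundant[OF assms(3) r])
  moreover have "ncomp (V - {w}) ?F + card E \<le> card V + 2" using few[of "{w}"] assms(1) by simp
  ultimately show False using card_avoid_vertex[OF finite_E, of w] assms(2) by linarith
qed

text \<open>If all edges at \<open>w\<close> other than \<open>wx\<close> were bridges, deleting
  them would keep edges plus components at \<open>n + 1\<close>; but what is left has
  \<open>n - 2\<close> edges and at most two components. The freedom in \<open>x\<close> allows a
  redundant edge different from a prescribed one.\<close>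

lemma redundant_at_high_degree:
  assumes E: "card E = card V" and w: "w \<in> V" "vdegree E w \<ge> 3" and x: "{w, x} \<in> E"
  shows "\<exists>y. {w, y} \<in> E \<and> {w, y} \<noteq> {w, x} \<and> redundant E w y"
proof (rule ccontr)
  assume none: "\<not> ?thesis"
  let ?F = "avoid E {w}"
  have xV: "x \<in> V" "w \<noteq> x" using simple_graph_edgeD[OF simple x] by auto
  have sub: "insert {w, x} ?F \<subseteq> E" using x by (auto simp: avoid_def)
  have "\<not> redundant E a b" if ab: "{a, b} \<in> E - insert {w, x} ?F" for a b
  proof -
    have "w \<in> {a, b}" using ab by (auto simp: avoid_def)
    then consider "a = w" | "b = w" by blast
    then show ?thesis
    proof cases
      case 1
      then show ?thesis using none ab by blast
    next
      case 2
      then have "{w, a} \<in> E" "{w, a} \<noteq> {w, x}" using ab by (auto simp: insert_commute)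
      then have "\<not> redundant E w a" using none by blast
      then show ?thesis using 2 redundant_commute by metis
    qed
  qed
  then have "card (insert {w, x} ?F) + ncomp V (insert {w, x} ?F) = card E + ncomp V E"
    by (rule excess_eq_of_not_redundant[OF finite_V simple sub])
  moreover have "card (insert {w, x} ?F) = Suc (card ?F)"
    using finite_E by (simp add: avoid_def)
  moreover have "(w, x) \<notin> (adj ?F)\<^sup>*"
  proof
    assume "(w, x) \<in> (adj ?F)\<^sup>*"
    then show False using xV(2) by (cases rule: converse_rtranclE) (auto simp: avoid_def)
  qed
  then have "ncomp V ?F = Suc (ncomp V (insert {w, x} ?F))"
    by (rule ncomp_insert_disconnected[OF finite_V w(1) xV(1)])
  moreover have "ncomp V ?F = Suc (ncomp (V - {w}) ?F)"
    by (rule ncomp_isolated[OF finite_V w(1)]) (auto simp: avoid_def)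
  moreover have "ncomp (V - {w}) ?F \<le> 2" using few[of "{w}"] w(1) E by simp
  ultimately show False
    using card_avoid_vertex[OF finite_E, of w] vdegree_le[OF w(1)] w(2) E ncomp_connected[OF connected]
    by linarith
qed

text \<open>If \<open>uw\<close> were a bridge, another edge \<open>wx\<close> would lie on a cycle.
  That cycle stays on the side of \<open>w\<close> and misses \<open>u\<close>, although every cycle
  passes through the vertex \<open>u\<close> of degree three.\<close>

lemma redundant_between_high_degree:
  assumes E: "card E = card V" and u: "u \<in> V" "vdegree E u \<ge> 3" and w: "w \<in> V" "vdegree E w \<ge> 3"
    and "u \<noteq> w"
  shows "redundant E u w"
proof (rule ccontr)
  assume "\<not> redundant E u w"
  then have not_reach: "(w, u) \<notin> (adj (E - {{w, u}}))\<^sup>*"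
    using redundant_commute[of E u w] by (simp only: redundant_def simp_thms)
  have uw: "{w, u} \<in> E" using high_degree_adjacent[OF w(1) u(1)] assms by blast
  obtain x where x: "{w, x} \<in> E" "{w, x} \<noteq> {w, u}" "redundant E w x"
    using redundant_at_high_degree[OF E w uw] by blast
  let ?e = "{w, u}" and ?f = "{w, x}"
  have xV: "x \<in> V" "w \<noteq> x" "u \<noteq> x" using simple_graph_edgeD[OF simple x(1)] x(2) by auto
  \<comment> \<open>Otherwise deleting both edges would leave three components; but deleting the
    redundant \<open>wx\<close> separates nothing, and the second deletion adds at most one
    component.\<close>
  have "(w, x) \<in> (adj (E - {?e} - {?f}))\<^sup>*"
  proof (rule ccontr)
    assume "(w, x) \<notin> (adj (E - {?e} - {?f}))\<^sup>*"
    then have "ncomp V (E - {?e} - {?f}) = Suc (ncomp V (insert ?f (E - {?e} - {?f})))"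
      by (rule ncomp_insert_disconnected[OF finite_V w(1) xV(1)])
    moreover have "insert ?f (E - {?e} - {?f}) = E - {?e}" using x by blast
    moreover have "ncomp V (E - {?e}) = Suc (ncomp V (insert ?e (E - {?e})))"
      by (rule ncomp_insert_disconnected[OF finite_V w(1) u(1) not_reach])
    moreover have "insert ?e (E - {?e}) = E" using uw by blast
    moreover have "card (E - {?e} - {?f}) + ncomp V (E - {?e} - {?f}) \<le> card (E - {?f}) + ncomp V (E - {?f})"
      by (intro excess_mono[OF finite_V simple_graph_mono[OF simple]]) auto
    moreover have "ncomp V (E - {?f}) = ncomp V E"
      by (rule ncomp_remove_redundant[OF x(1,3)])
    moreover have "Suc (card (E - {?e} - {?f})) = card (E - {?f})"
    proof -
      have "E - {?e} - {?f} = E - {?f} - {?e}" by blast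
      moreover have "?e \<in> E - {?f}" using uw x(2) by blast
      ultimately show ?thesis
        using finite_E by (simp only: card_Suc_Diff1 finite_Diff)
    qed
    ultimately show False by simp
  qed
  \<comment> \<open>The name \<open>f\<close> shields the edge \<open>wx\<close> from the induction,
    which generalises over the endpoint \<open>x\<close> of the walk.\<close>
  moreover define f where "f = ?f"
  ultimately have "(w, x) \<in> (adj (E - {?e} - {f}))\<^sup>*" by (simp only:)
  then have "(w, x) \<in> (adj (E - {?e}))\<^sup>* \<and> (w, x) \<in> (adj (avoid E {u} - {f}))\<^sup>*"
  proof (induction rule: rtrancl_induct)
    case (step y z)
    then have yz: "{y, z} \<in> E - {?e} - {f}" by simp
    then have "(y, z) \<in> adj (E - {?e})" by simp
    then have wz: "(w, z) \<in> (adj (E - {?e}))\<^sup>*" by (rule rtrancl_into_rtrancl[OF conjunct1[OF step.IH]])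
    \<comment> \<open>The walk never meets \<open>u\<close>, since \<open>w\<close> cannot reach
      \<open>u\<close> without the assumed bridge \<open>uw\<close>.\<close>
    have "z \<noteq> u" using not_reach wz by metis
    moreover have "y \<noteq> u" using not_reach conjunct1[OF step.IH] by metis
    ultimately have "(y, z) \<in> adj (avoid E {u} - {f})" using yz by (simp add: avoid_def)
    then have "(w, z) \<in> (adj (avoid E {u} - {f}))\<^sup>*"
      by (rule rtrancl_into_rtrancl[OF conjunct2[OF step.IH]])
    with wz show ?case by (rule conjI)
  qed simp
  then have "redundant (avoid E {u}) w x" unfolding redundant_def f_def by (rule conjunct2)
  moreover have "{w, x} \<in> avoid E {u}" using x(1) xV \<open>u \<noteq> w\<close> by (simp add: avoid_def)
  ultimately show False using not_redundant_avoiding[OF u] by blast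
qed

end

lemma card_edge_le_one_component:
  assumes "finite V" "simple_graph V F" "u \<in> V"
  shows "card (component F u) \<le> Suc (card {e \<in> F. e \<subseteq> component F u})"
proof -
  have "finite (component F u)"
    using component_subset[OF assms(2,3)] assms(1) finite_subset by blast
  then show ?thesis
    using card_le_edges_plus_ncomp[OF _ simple_graph_component[OF assms(2)], of "component F u"]
      ncomp_connected[OF connected_graph_component[of F u]] by simp
qed

context few_components_graph
begin

text \<open>Deleting the edge keeps the graph connected, leaves \<open>n - 1\<close> edges, and
  lowers the degree of every vertex of degree three.\<close>

lemma path_plus_edge_of_redundant_edge:
  assumes E: "card E = card V" and uw: "{u, w} \<in> E" "redundant E u w"
    and high: "\<And>v. v \<in> V \<Longrightarrow> vdegree E v \<ge> 3 \<Longrightarrow> v \<in> {u, w}"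
  shows "path_plus_edge V E"
proof -
  let ?F = "E - {{u, w}}"
  note uwV = simple_graph_edgeD[OF simple uw(1)]
  have F: "simple_graph V ?F" by (rule simple_graph_mono[OF simple]) blast
  have "vdegree ?F v \<le> 2" if v: "v \<in> V" for v
  proof (cases "v \<in> {u, w}")
    case True
    then show ?thesis using vdegree_remove[OF finite_E uw(1)] vdegree_le[OF v] by fastforce
  next
    case False
    then show ?thesis
      using high[OF v] vdegree_mono[OF finite_E, of ?F v] by fastforce
  qed
  moreover have "card ?F < card V" using E uw(1) finite_E card_Diff1_less by metis
  ultimately have "path_graph V ?F"
    using path_graph_of_degrees[OF finite_V F connected_remove_redundant[OF connected uw]] by blast
  moreover have "E = insert {u, w} ?F" using uw(1) by blast
  ultimately show ?thesis unfolding path_plus_edge_def using uwV by blast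
qed

text \<open>Without the triangle there are \<open>n - 3\<close> edges and hence at least three
  components, each meeting a corner. So every corner has a component to itself, and the degrees make
  it a path starting there.\<close>

lemma triangle_with_paths_of_high_degree:
  assumes E: "card E = card V"
    and abc: "a \<in> V" "b \<in> V" "c \<in> V" "a \<noteq> b" "b \<noteq> c" "a \<noteq> c"
    and deg: "vdegree E a \<ge> 3" "vdegree E b \<ge> 3" "vdegree E c \<ge> 3"
  shows "triangle_with_paths V E"
proof -
  let ?T = "{{a, b}, {b, c}, {a, c}}"
  let ?F = "E - ?T"
  have edges: "{a, b} \<in> E" "{b, c} \<in> E" "{a, c} \<in> E"
    using high_degree_adjacent abc deg by auto
  have ne: "{a, b} \<noteq> {b, c}" "{a, b} \<noteq> {a, c}" "{b, c} \<noteq> {a, c}"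
    using abc by (auto simp: doubleton_eq_iff)
  have F: "simple_graph V ?F" by (rule simple_graph_mono[OF simple]) blast
  \<comment> \<open>A fourth vertex \<open>v\<close> of degree three would form a triangle with
    \<open>b\<close> and \<open>c\<close>, a cycle avoiding \<open>a\<close>.\<close>
  have low: "vdegree ?F v \<le> 2" if v: "v \<in> V" "v \<notin> {a, b, c}" for v
  proof -
    have "vdegree E v < 3"
    proof (rule ccontr)
      assume "\<not> vdegree E v < 3"
      then have "{b, v} \<in> E" "{c, v} \<in> E"
        using high_degree_adjacent[of b v] high_degree_adjacent[of c v] abc deg v by auto
      then have "{b, c} \<in> avoid E {a}" "{c, v} \<in> avoid E {a}" "{b, v} \<in> avoid E {a}"
        using edges abc v by (auto simp: avoid_def)
      moreover from this have "redundant (avoid E {a}) b c"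
        by (rule redundant_triangle) (use abc v in auto)
      ultimately show False using not_redundant_avoiding[OF abc(1) deg(1)] by blast
    qed
    then show ?thesis using vdegree_mono[OF finite_E, of ?F v] by fastforce
  qed
  have corner: "vdegree ?F x \<le> 1" if x: "x \<in> V" "e \<in> E" "f \<in> E" "e \<noteq> f" "x \<in> e" "x \<in> f" "e \<in> ?T" "f \<in> ?T"
    for x e f
  proof -
    have "vdegree E x = Suc (vdegree (E - {e}) x)" using vdegree_remove[OF finite_E x(2,5)] .
    also have "vdegree (E - {e}) x = Suc (vdegree (E - {e} - {f}) x)"
      using vdegree_remove[of "E - {e}" f x] finite_E x by blast
    finally have "vdegree (E - {e} - {f}) x \<le> 1" using vdegree_le[OF x(1)] by simp
    moreover have "vdegree ?F x \<le> vdegree (E - {e} - {f}) x"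
      using finite_E x(7,8) by (intro vdegree_mono) auto
    ultimately show ?thesis by simp
  qed
  have corners: "vdegree ?F a \<le> 1" "vdegree ?F b \<le> 1" "vdegree ?F c \<le> 1"
    using corner[of a "{a, b}" "{a, c}"] corner[of b "{a, b}" "{b, c}"] corner[of c "{b, c}" "{a, c}"]
      abc edges ne by simp_all
  have deg2: "vdegree ?F v \<le> 2" if "v \<in> V" for v
    using low[OF that] corners by (cases "v \<in> {a, b, c}") auto
  have cover: "\<exists>v\<in>{a, b, c}. x \<in> component ?F v" if "x \<in> V" for x
    by (rule reach_without_edges[of a]) (use connected that abc in \<open>auto simp: connected_graph_def\<close>)
  have comps: "component ?F ` V \<subseteq> {component ?F a, component ?F b, component ?F c}"
  proof
    fix Z assume "Z \<in> component ?F ` V"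
    then obtain x where x: "x \<in> V" "Z = component ?F x" by blast
    obtain v where v: "v \<in> {a, b, c}" "x \<in> component ?F v" using cover[OF x(1)] by blast
    then show "Z \<in> {component ?F a, component ?F b, component ?F c}"
      using x(2) component_eqI[OF v(2)] by auto
  qed
  have "card E = card ?F + 3"
  proof -
    have "card ?F = card E - card ?T"
      using edges by (intro card_Diff_subset) auto
    moreover have "card ?T \<le> card E" using edges finite_E by (intro card_mono) auto
    ultimately show ?thesis using ne by simp
  qed
  then have "3 \<le> ncomp V ?F" using card_le_edges_plus_ncomp[OF finite_V F] E by simp
  also have "\<dots> \<le> card {component ?F a, component ?F b, component ?F c}"
    unfolding ncomp_def using comps by (intro card_mono) auto
  finally have three: "3 \<le> card {component ?F a, component ?F b, component ?F c}" .
  have "x \<noteq> y \<and> y \<noteq> z \<and> x \<noteq> z" if "3 \<le> card {x, y, z}" for x y z :: "'a set"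
    using that by (auto simp: card_insert_if split: if_splits)
  from this[OF three] have distinct: "component ?F a \<noteq> component ?F b"
      "component ?F b \<noteq> component ?F c" "component ?F a \<noteq> component ?F c"
    by simp_all
  let ?C = "component ?F" and ?D = "\<lambda>x. {e \<in> ?F. e \<subseteq> component ?F x}"
  have disj: "?C a \<inter> ?C b = {}" "?C b \<inter> ?C c = {}" "?C a \<inter> ?C c = {}"
    using components_disjoint[of ?F a b] components_disjoint[of ?F b c] components_disjoint[of ?F a c]
      distinct by simp_all
  have pth: "path_with_endpoint x (?C x) (?D x)" if x: "x \<in> {a, b, c}" for x
  proof (rule path_with_endpoint_of_degrees)
    have xV: "x \<in> V" using x abc by blast
    have CV: "?C x \<subseteq> V" by (rule component_subset[OF F xV])
    have finF: "finite ?F" using finite_E by simp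
    show "finite (?C x)" using CV finite_V finite_subset by blast
    show "simple_graph (?C x) (?D x)" by (rule simple_graph_component[OF F])
    show "connected_graph (?C x) (?D x)" by (rule connected_graph_component)
    show "x \<in> ?C x" by (rule component_self)
    have "vdegree (?D x) v \<le> vdegree ?F v" for v by (rule vdegree_mono[OF finF]) blast
    note le = order_trans[OF this]
    show "vdegree (?D x) x \<le> 1" using x corners by (intro le) blast
    show "vdegree (?D x) v \<le> 2" if "v \<in> ?C x" for v using deg2 CV that by (intro le) blast
  qed
  have self: "a \<in> ?C a" "b \<in> ?C b" "c \<in> ?C c" by (simp_all add: component_self)
  have sub: "?C a \<subseteq> V" "?C b \<subseteq> V" "?C c \<subseteq> V" using component_subset[OF F] abc by blast+
  have FE: "?F = ?D a \<union> ?D b \<union> ?D c"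
  proof
    show "?F \<subseteq> ?D a \<union> ?D b \<union> ?D c"
    proof
      fix e assume e: "e \<in> ?F"
      obtain p q where pq: "e = {p, q}" "p \<in> V" using simple_graph_obtain[OF F e] by metis
      obtain v where v: "v \<in> {a, b, c}" "p \<in> ?C v" using cover[OF pq(2)] by blast
      have "e \<subseteq> ?C p" using edge_in_component[OF F e] pq by blast
      then have "e \<subseteq> ?C v" using component_eqI[OF v(2)] by simp
      then show "e \<in> ?D a \<union> ?D b \<union> ?D c" using v(1) e by blast
    qed
  qed blast
  let ?V1 = "{a, b, c} \<union> ?C a" and ?V2 = "{a, b, c} \<union> ?C a \<union> ?C b"
  have "attach_path a {a, b, c} ?T ?V1 (?T \<union> ?D a)"
    unfolding attach_path_def
    by (intro conjI exI[of _ "?C a"] exI[of _ "?D a"] pth) (use self disj in auto)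
  moreover have "attach_path b ?V1 (?T \<union> ?D a) ?V2 (?T \<union> ?D a \<union> ?D b)"
    unfolding attach_path_def
    by (intro conjI exI[of _ "?C b"] exI[of _ "?D b"] pth) (use self disj in auto)
  moreover have "attach_path c ?V2 (?T \<union> ?D a \<union> ?D b) V E"
    unfolding attach_path_def
  proof (intro conjI exI[of _ "?C c"] exI[of _ "?D c"] pth)
    show "?V2 \<inter> ?C c = {c}" using self disj by auto
    show "V = ?V2 \<union> ?C c" using cover abc sub by blast
    have "E = ?T \<union> ?F" using edges by blast
    then show "E = ?T \<union> ?D a \<union> ?D b \<union> ?D c" using FE by (metis Un_assoc)
  qed auto
  ultimately show ?thesis
    unfolding triangle_with_paths_def using abc(4-6) by blast
qed

lemma unicyclic_structure:
  assumes E: "card E = card V"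
  shows "\<not> tree_graph V E" "path_plus_edge V E \<or> triangle_with_paths V E"
proof -
  \<comment> \<open>If all edges were bridges, edges plus components would equal \<open>n\<close>,
    as for the edgeless graph, instead of \<open>n + 1\<close>.\<close>
  have "\<exists>a b. {a, b} \<in> E \<and> redundant E a b"
  proof (rule ccontr)
    assume "\<not> ?thesis"
    then have "card ({} :: 'a set set) + ncomp V {} = card E + ncomp V E"
      by (intro excess_eq_of_not_redundant[OF finite_V simple]) auto
    then show False using E ncomp_connected[OF connected] by (simp add: ncomp_def component_empty card_image)
  qed
  then obtain a b where ab: "{a, b} \<in> E" "redundant E a b" by blast
  show "\<not> tree_graph V E"
    using cycle_of_redundant_edge[OF simple ab] by (simp add: tree_graph_def)
  let ?H = "\<lambda>v. v \<in> V \<and> vdegree E v \<ge> 3"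
  show "path_plus_edge V E \<or> triangle_with_paths V E"
  proof (cases "\<exists>w. ?H w")
    case False
    then show ?thesis using path_plus_edge_of_redundant_edge[OF E ab] by blast
  next
    case True
    then obtain w where w: "w \<in> V" "vdegree E w \<ge> 3" by blast
    show ?thesis
    proof (cases "\<exists>u. ?H u \<and> u \<noteq> w")
      case True
      then obtain u where u: "u \<in> V" "vdegree E u \<ge> 3" "u \<noteq> w" by blast
      show ?thesis
      proof (cases "\<exists>x. ?H x \<and> x \<noteq> u \<and> x \<noteq> w")
        case True
        then show ?thesis using triangle_with_paths_of_high_degree[OF E] u w by metis
      next
        case False
        have "{u, w} \<in> E" using high_degree_adjacent u w by blast
        moreover have "redundant E u w" using redundant_between_high_degree[OF E] u w by blast
        ultimately show ?thesis using path_plus_edge_of_redundant_edge[OF E] False by blast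
      qed
    next
      case False
      have "{e \<in> E. w \<in> e} \<noteq> {}" using w(2) unfolding vdegree_def by (intro notI) simp
      then obtain e where e: "e \<in> E" "w \<in> e" by blast
      obtain p q where "e = {p, q}" using simple_graph_obtain[OF simple e(1)] by metis
      then obtain x where "{w, x} \<in> E" using e by (auto simp: insert_commute)
      then obtain y where "{w, y} \<in> E" "redundant E w y"
        using redundant_at_high_degree[OF E w] by blast
      then show ?thesis using path_plus_edge_of_redundant_edge[OF E] False by blast
    qed
  qed
qed

lemma tree_structure:
  assumes E: "card E < card V" and V: "card V \<ge> 2"
  shows "tree_graph V E" "two_paths_plus_edge V E"
proof -
  have E1: "card V = Suc (card E)" using E card_V_le by simp
  have nr: "\<not> redundant E a b" if ab: "{a, b} \<in> E" for a b
  proof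
    assume "redundant E a b"
    then have "ncomp V (E - {{a, b}}) = 1"
      using ncomp_remove_redundant[OF ab, of V] ncomp_connected[OF connected] by simp
    moreover have "Suc (card (E - {{a, b}})) = card E"
      using ab finite_E by (simp add: card_Suc_Diff1 del: card_Diff_insert)
    ultimately show False
      using card_le_edges_plus_ncomp[OF finite_V simple_graph_mono[OF simple, of "E - {{a, b}}"]] E by auto
  qed
  show "tree_graph V E"
    unfolding tree_graph_def using simple connected redundant_edge_of_cycle nr by blast
  let ?H = "\<lambda>v. v \<in> V \<and> vdegree E v \<ge> 3"
  have "\<exists>u w. {u, w} \<in> E \<and> (\<forall>v. ?H v \<longrightarrow> v \<in> {u, w})"
  proof (cases "\<exists>w. ?H w")
    case False
    have "E \<noteq> {}" using E1 V by auto
    then obtain e where "e \<in> E" by blast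
    then obtain u w where "{u, w} \<in> E" using simple_graph_obtain[OF simple] by metis
    then show ?thesis using False by blast
  next
    case True
    then obtain w where w: "w \<in> V" "vdegree E w \<ge> 3" by blast
    show ?thesis
    proof (cases "\<exists>u. ?H u \<and> u \<noteq> w")
      case True
      then obtain u where u: "u \<in> V" "vdegree E u \<ge> 3" "u \<noteq> w" by blast
      have uw: "{u, w} \<in> E" using high_degree_adjacent u w by blast
      \<comment> \<open>A third vertex of degree three would close a triangle, whose edges are
        redundant.\<close>
      have "v \<in> {u, w}" if v: "?H v" for v
      proof (rule ccontr)
        assume "v \<notin> {u, w}"
        then have "redundant E u w"
          using high_degree_adjacent[of u v] high_degree_adjacent[of w v] u w v uw
          by (intro redundant_triangle[of u w E v]) auto
        then show False using nr uw by blast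
      qed
      then show ?thesis using uw by blast
    next
      case False
      have "{e \<in> E. w \<in> e} \<noteq> {}" using w(2) unfolding vdegree_def by (intro notI) simp
      then obtain e where e: "e \<in> E" "w \<in> e" by blast
      obtain p q where "e = {p, q}" using simple_graph_obtain[OF simple e(1)] by metis
      then obtain x where "{w, x} \<in> E" using e by (auto simp: insert_commute)
      then show ?thesis using False by blast
    qed
  qed
  then obtain u w where uw: "{u, w} \<in> E" and high: "\<And>v. ?H v \<Longrightarrow> v \<in> {u, w}" by blast
  note uwV = simple_graph_edgeD[OF simple uw]
  let ?F = "E - {{u, w}}"
  let ?C = "component ?F" and ?D = "\<lambda>x. {e \<in> ?F. e \<subseteq> component ?F x}"
  have F: "simple_graph V ?F" by (rule simple_graph_mono[OF simple]) blast
  have finF: "finite ?F" using finite_E by simp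
  have deg2: "vdegree ?F v \<le> 2" if v: "v \<in> V" for v
  proof (cases "v \<in> {u, w}")
    case True
    then show ?thesis using vdegree_remove[OF finite_E uw] vdegree_le[OF v] by fastforce
  next
    case False
    then show ?thesis using high[of v] v vdegree_mono[OF finite_E, of ?F v] by fastforce
  qed
  have cover: "\<exists>v\<in>{u, w}. x \<in> ?C v" if "x \<in> V" for x
    by (rule reach_without_edges[of u]) (use connected that uwV in \<open>auto simp: connected_graph_def\<close>)
  have "?C u \<noteq> ?C w" using nr[OF uw] unfolding component_eq_iff redundant_def .
  then have disj: "?C u \<inter> ?C w = {}" by (rule components_disjoint)
  have sub: "?C u \<subseteq> V" "?C w \<subseteq> V" using component_subset[OF F] uwV by blast+
  have V_eq: "V = ?C u \<union> ?C w" using cover sub by blast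
  have finC: "finite (?C u)" "finite (?C w)" using sub finite_V finite_subset by blast+
  have cardV: "card V = card (?C u) + card (?C w)"
    using card_Un_disjoint[OF finC disj] V_eq by simp
  have D_disj: "?D u \<inter> ?D w = {}"
  proof (rule ccontr)
    assume "?D u \<inter> ?D w \<noteq> {}"
    then obtain e where e: "e \<in> ?F" "e \<subseteq> ?C u \<inter> ?C w" by blast
    then show False using simple_graph_obtain[OF F e(1)] disj by (metis insert_not_empty subset_empty)
  qed
  have F_eq: "?F = ?D u \<union> ?D w"
  proof
    show "?F \<subseteq> ?D u \<union> ?D w"
    proof
      fix e assume e: "e \<in> ?F"
      obtain p q where pq: "e = {p, q}" "p \<in> V" using simple_graph_obtain[OF F e] by metis
      obtain v where v: "v \<in> {u, w}" "p \<in> ?C v" using cover[OF pq(2)] by blast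
      have "e \<subseteq> ?C p" using edge_in_component[OF F e] pq by blast
      then have "e \<subseteq> ?C v" using component_eqI[OF v(2)] by simp
      then show "e \<in> ?D u \<union> ?D w" using v(1) e by blast
    qed
  qed blast
  have "finite (?D u)" "finite (?D w)" using finF by simp_all
  then have "card (?D u \<union> ?D w) = card (?D u) + card (?D w)" using D_disj by (intro card_Un_disjoint)
  then have "card ?F = card (?D u) + card (?D w)" using F_eq by simp
  moreover have "Suc (card ?F) = card E" using uw finite_E by (simp add: card_Suc_Diff1 del: card_Diff_insert)
  moreover have "card (?C u) \<le> Suc (card (?D u))" "card (?C w) \<le> Suc (card (?D w))"
    by (rule card_edge_le_one_component[OF finite_V F uwV(1)])
       (rule card_edge_le_one_component[OF finite_V F uwV(2)])
  \<comment> \<open>The two components have \<open>n\<close> vertices and \<open>n - 2\<close> edges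
    in total, so both connectivity bounds are equalities.\<close>
  ultimately have less: "card (?D u) < card (?C u)" "card (?D w) < card (?C w)"
    using cardV E1 by linarith+
  have pth: "path_graph (?C x) (?D x)" if "card (?D x) < card (?C x)" "?C x \<subseteq> V" for x
  proof (rule path_graph_of_degrees)
    show "finite (?C x)" using that(2) finite_V finite_subset by blast
    show "simple_graph (?C x) (?D x)" by (rule simple_graph_component[OF F])
    show "connected_graph (?C x) (?D x)" by (rule connected_graph_component)
    have "vdegree (?D x) v \<le> vdegree ?F v" for v by (rule vdegree_mono[OF finF]) blast
    then show "vdegree (?D x) v \<le> 2" if "v \<in> ?C x" for v
      using deg2 \<open>?C x \<subseteq> V\<close> that by (meson order_trans subsetD)
  qed (rule that(1))
  have "E = insert {u, w} (?D u \<union> ?D w)" using uw F_eq by blast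
  then show "two_paths_plus_edge V E"
    unfolding two_paths_plus_edge_def
    using pth[OF less(1) sub(1)] pth[OF less(2) sub(2)] disj V_eq component_self[of u ?F] component_self[of w ?F]
    by blast
qed

end

section \<open>The characterisation\<close>

lemma card_minor_index:
  assumes "simple_graph V E" "finite E"
  shows "card (minor_index m E) = card {(k, l). 1 \<le> k \<and> k < l \<and> l \<le> m} * card E"
proof -
  let ?K = "{(k, l). 1 \<le> k \<and> k < l \<and> l \<le> m}"
  \<comment> \<open>Minimum and maximum recover an edge and supply the order \<open>i < j\<close> of
    its ends.\<close>
  let ?f = "\<lambda>((k, l), e). (k, l, Min e, Max e)"
  have ordered: "\<exists>i j. e = {i, j} \<and> i < j" if e: "e \<in> E" for e
  proof -
    obtain a b where ab: "e = {a, b}" "a \<noteq> b" using simple_graph_obtain[OF assms(1) e] by metis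
    then have "a < b \<or> b < a" by linarith
    then show ?thesis using ab(1) by (metis insert_commute)
  qed
  have MinMax: "e = {Min e, Max e} \<and> Min e < Max e" if "e \<in> E" for e
    using ordered[OF that] by auto
  have inj: "inj_on ?f (?K \<times> E)"
  proof (rule inj_onI)
    fix x y assume xy: "x \<in> ?K \<times> E" "y \<in> ?K \<times> E" "?f x = ?f y"
    obtain k l e where x: "x = ((k, l), e)" by (metis prod.exhaust)
    obtain k' l' e' where y: "y = ((k', l'), e')" by (metis prod.exhaust)
    have "e \<in> E" "e' \<in> E" "Min e = Min e'" "Max e = Max e'" "k = k'" "l = l'"
      using xy unfolding x y by auto
    then have "e = e'" using MinMax by metis
    then show "x = y" using \<open>k = k'\<close> \<open>l = l'\<close> by (simp add: x y)
  qed
  have "?f ` (?K \<times> E) = minor_index m E"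
  proof (intro equalityI subsetI)
    fix z assume "z \<in> ?f ` (?K \<times> E)"
    then obtain k l e where "z = (k, l, Min e, Max e)" "(k, l) \<in> ?K" "e \<in> E" by auto
    then show "z \<in> minor_index m E" using MinMax[of e] by (auto simp: minor_index_def)
  next
    fix z assume "z \<in> minor_index m E"
    then obtain k l i j where z: "z = (k, l, i, j)" "(k, l) \<in> ?K" "{i, j} \<in> E" "i < j"
      by (auto simp: minor_index_def)
    then have "z = ?f ((k, l), {i, j})" by simp
    moreover have "((k, l), {i, j}) \<in> ?K \<times> E" using z(2,3) by simp
    ultimately show "z \<in> ?f ` (?K \<times> E)" by (rule image_eqI)
  qed
  then have "card (minor_index m E) = card (?K \<times> E)" using card_image[OF inj] by (simp only:)
  then show ?thesis by (simp only: card_cartesian_product)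
qed

lemma card_minor_index_2:
  assumes "simple_graph V E" "finite E" shows "card (minor_index 2 E) = card E"
proof -
  have "{(k, l). 1 \<le> k \<and> k < l \<and> l \<le> 2} = {(1::nat, 2::nat)}" by auto
  then show ?thesis using card_minor_index[OF assms, of 2] by simp
qed

lemma card_minor_index_ge:
  assumes "simple_graph V E" "finite E" "m \<ge> 3" shows "m * card E \<le> card (minor_index m E)"
proof -
  let ?K = "{(k, l). 1 \<le> k \<and> k < l \<and> l \<le> m}"
  \<comment> \<open>The \<open>m - 1\<close> pairs \<open>(1, l)\<close> together with
    \<open>(2, 3)\<close> are \<open>m\<close> distinct row pairs; the last one requires a third
    row.\<close>
  have "m = card (insert (2, 3) ((\<lambda>l. (1::nat, l)) ` {2..m}))"
    using assms(3) by (subst card_insert_disjoint) (auto simp: card_image inj_on_def)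
  also have "\<dots> \<le> card ?K"
  proof (rule card_mono)
    show "finite ?K" by (rule finite_subset[of _ "{1..m} \<times> {1..m}"]) auto
  qed (use assms(3) in auto)
  finally show ?thesis using card_minor_index[OF assms(1,2), of m] by simp
qed

lemma ideal_height_le_ncomp:
  assumes E: "simple_graph {1..n} E" and S: "S \<subseteq> {1..n}"
  shows "ideal_height (poly_ring 2 n) (gen_binomial_edge_ideal 2 n E :: ('k::field) mpoly set) \<le>
    enat (n + card S - ncomp ({1..n} - S) (avoid E S))"
proof -
  let ?F = "avoid E S"
  define rep where "rep x = (LEAST y. y \<in> component ?F x)" for x
  have rep: "rep x \<in> component ?F x" for x
    unfolding rep_def by (rule LeastI[of _ x]) (rule component_self)
  have rep_eq: "rep x = rep y" if "component ?F x = component ?F y" for x y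
    using that by (simp add: rep_def)
  let ?R = "rep ` ({1..n} - S)"
  have "card ?R = ncomp ({1..n} - S) ?F"
  proof -
    have "?R = (\<lambda>C. LEAST y. y \<in> C) ` component ?F ` ({1..n} - S)"
      by (simp add: image_image rep_def)
    moreover have "inj_on (\<lambda>C. LEAST y. y \<in> C) (component ?F ` ({1..n} - S))"
    proof (rule inj_onI)
      fix C D assume "C \<in> component ?F ` ({1..n} - S)" "D \<in> component ?F ` ({1..n} - S)"
        and eq: "(LEAST y. y \<in> C) = (LEAST y. y \<in> D)"
      then obtain x y where xy: "C = component ?F x" "D = component ?F y" by blast
      then have "rep x = rep y" using eq by (simp add: rep_def)
      then show "C = D"
        using component_eqI[OF rep[of x]] component_eqI[OF rep[of y]] xy by simp
    qed
    ultimately show ?thesis by (simp add: card_image ncomp_def)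
  qed
  moreover have "ideal_height (poly_ring 2 n) (gen_binomial_edge_ideal 2 n E :: 'k mpoly set) \<le>
    enat (2 * n - (n - card S + (2 - 1) * card ?R))"
  proof (rule ideal_height_le_components[OF E S, where rep = rep])
    show "?R \<subseteq> {1..n} - S"
      using rep component_subset[OF simple_graph_avoid[OF E]] by blast
    show "rep i = rep j" if "{i, j} \<in> E" "i \<notin> S" "j \<notin> S" for i j
      using that by (intro rep_eq) (auto simp: component_eq_iff avoid_def)
    show "rep r = r" if r: "r \<in> ?R" for r
    proof -
      obtain x where "r = rep x" using r by blast
      then show ?thesis using rep_eq[OF component_eqI[OF rep[of x]]] by simp
    qed
  qed simp
  moreover have "card S \<le> n" using card_mono[OF _ S] by simp
  then have "2 * n - (n - card S + (2 - 1) * card ?R) = n + card S - card ?R" by simp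
  ultimately show ?thesis by simp
qed

text \<open>Empty \<open>S\<close> and the single representative \<open>1\<close> give the prime of
  the rank-one matrices; the bound equals \<open>(m - 1) * (n - 1)\<close>.\<close>

lemma ideal_height_le_connected:
  assumes "simple_graph {1..n} E" "n \<ge> 1" "m \<ge> 1"
  shows "ideal_height (poly_ring m n) (gen_binomial_edge_ideal m n E :: ('k::field) mpoly set) \<le>
    enat (m * n - (n + (m - 1)))"
  using ideal_height_le_components[OF assms(1), of "{}" "{1}" m "\<lambda>_. 1"] assms(2,3) by simp

section \<open>Edge counts and component representatives for the graphs in the
  classification\<close>

lemma disjoint_edge_sets:
  assumes "simple_graph V E" "simple_graph W F" "V \<inter> W \<subseteq> {x}" shows "E \<inter> F = {}"
proof (rule ccontr)
  assume "E \<inter> F \<noteq> {}"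
  then obtain e where e: "e \<in> E" "e \<in> F" by blast
  obtain a b where ab: "e = {a, b}" "a \<in> V" "b \<in> V" "a \<noteq> b"
    using simple_graph_obtain[OF assms(1) e(1)] .
  obtain c d where "e = {c, d}" "c \<in> W" "d \<in> W" using simple_graph_obtain[OF assms(2) e(2)] .
  then have "e \<subseteq> W" by blast
  then have "e \<subseteq> {x}" using assms(3) ab(1-3) by blast
  then show False using ab(1,4) by blast
qed

lemma path_graph_card: "path_graph V E \<Longrightarrow> Suc (card E) = card V"
  unfolding path_graph_def path_on_iff using card_path_edges by blast

lemma path_graph_simple: "path_graph V E \<Longrightarrow> simple_graph V E"
  unfolding path_graph_def path_on_iff using simple_graph_path_edges by blast

lemma path_graph_finite: "path_graph V E \<Longrightarrow> finite V"
  unfolding path_graph_def path_on_iff by blast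

lemma path_graph_cover:
  assumes "path_graph V F" "F \<subseteq> E"
  shows "\<exists>R\<subseteq>V - S. card R \<le> card (S \<inter> V) + 1 \<and> (\<forall>j\<in>V - S. \<exists>r\<in>R. (r, j) \<in> (adj (avoid E S))\<^sup>*)"
proof -
  obtain vs where vs: "vs \<noteq> []" "distinct vs" "V = set vs" "F = path_edges vs"
    using assms(1) unfolding path_graph_def path_on_iff by blast
  obtain R where R: "R \<subseteq> set vs - S"
    "card R \<le> card (S \<inter> set vs) + (if hd vs \<in> S then 0 else 1)"
    "\<forall>j\<in>set vs - S. \<exists>r\<in>R. (r, j) \<in> (adj (avoid E S))\<^sup>*"
    using path_segment_starts[OF vs(1,2), of E S] assms(2) unfolding vs(4) by metis
  have "card R \<le> card (S \<inter> set vs) + 1" using R(2) by (simp split: if_splits)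
  then show ?thesis unfolding vs(3) using R(1,3) by blast
qed

lemma two_paths_plus_edge_card:
  assumes "two_paths_plus_edge V E" shows "Suc (card E) = card V"
proof -
  obtain V1 E1 V2 E2 u v where P: "path_graph V1 E1" "path_graph V2 E2" "V1 \<inter> V2 = {}"
    "u \<in> V1" "v \<in> V2" "V = V1 \<union> V2" "E = insert {u, v} (E1 \<union> E2)"
    using assms unfolding two_paths_plus_edge_def by metis
  note fin = P(1,2)[THEN path_graph_finite]
  note finE = simple_graph_finite[OF path_graph_simple[OF P(1)] fin(1)]
    simple_graph_finite[OF path_graph_simple[OF P(2)] fin(2)]
  have "{u, v} \<notin> E1" using simple_graph_edgeD(2)[OF path_graph_simple[OF P(1)]] P(3,5) by blast
  moreover have "{u, v} \<notin> E2" using simple_graph_edgeD(1)[OF path_graph_simple[OF P(2)]] P(3,4) by blast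
  moreover have "E1 \<inter> E2 = {}"
    using disjoint_edge_sets[OF path_graph_simple path_graph_simple, OF P(1,2)] P(3) by simp
  then have "card (E1 \<union> E2) = card E1 + card E2" using finE by (intro card_Un_disjoint)
  moreover have "card V = card V1 + card V2" unfolding P(6) by (rule card_Un_disjoint[OF fin P(3)])
  ultimately show ?thesis using P(7) finE path_graph_card[OF P(1)] path_graph_card[OF P(2)] by simp
qed

text \<open>Each path leaves at most one more segment than it loses vertices, and the joining edge
  can only merge segments.\<close>

lemma two_paths_plus_edge_cover:
  assumes "two_paths_plus_edge V E" "finite S"
  shows "\<exists>R\<subseteq>V - S. card R \<le> card S + 2 \<and> (\<forall>j\<in>V - S. \<exists>r\<in>R. (r, j) \<in> (adj (avoid E S))\<^sup>*)"
proof -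
  obtain V1 E1 V2 E2 u v where P: "path_graph V1 E1" "path_graph V2 E2" "V1 \<inter> V2 = {}"
    "V = V1 \<union> V2" "E = insert {u, v} (E1 \<union> E2)"
    using assms(1) unfolding two_paths_plus_edge_def by metis
  obtain R1 where R1: "R1 \<subseteq> V1 - S" "card R1 \<le> card (S \<inter> V1) + 1"
    "\<forall>j\<in>V1 - S. \<exists>r\<in>R1. (r, j) \<in> (adj (avoid E S))\<^sup>*"
    using path_graph_cover[OF P(1), of E S] P(5) by blast
  obtain R2 where R2: "R2 \<subseteq> V2 - S" "card R2 \<le> card (S \<inter> V2) + 1"
    "\<forall>j\<in>V2 - S. \<exists>r\<in>R2. (r, j) \<in> (adj (avoid E S))\<^sup>*"
    using path_graph_cover[OF P(2), of E S] P(5) by blast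
  have "card (R1 \<union> R2) \<le> card R1 + card R2" by (rule card_Un_le)
  moreover have "card (S \<inter> V1) + card (S \<inter> V2) \<le> card S"
  proof -
    have "card (S \<inter> V1 \<union> S \<inter> V2) = card (S \<inter> V1) + card (S \<inter> V2)"
      using assms(2) P(3) by (intro card_Un_disjoint) auto
    moreover have "card (S \<inter> V1 \<union> S \<inter> V2) \<le> card S" using assms(2) by (intro card_mono) auto
    ultimately show ?thesis by simp
  qed
  ultimately have "card (R1 \<union> R2) \<le> card S + 2" using R1(2) R2(2) by linarith
  moreover have "R1 \<union> R2 \<subseteq> V - S" using R1(1) R2(1) P(4) by blast
  moreover have "\<forall>j\<in>V - S. \<exists>r\<in>R1 \<union> R2. (r, j) \<in> (adj (avoid E S))\<^sup>*"
    using R1(3) R2(3) unfolding P(4) by (metis Diff_iff Un_iff)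
  ultimately show ?thesis by (intro exI[of _ "R1 \<union> R2"] conjI)
qed

lemma path_plus_edge_card:
  assumes "path_plus_edge V E" shows "card E = card V"
proof -
  obtain E0 u v where P: "path_graph V E0" "{u, v} \<notin> E0" "E = insert {u, v} E0"
    using assms unfolding path_plus_edge_def by metis
  have "finite E0" using simple_graph_finite[OF path_graph_simple path_graph_finite] P(1) by blast
  then show ?thesis using P path_graph_card[OF P(1)] by simp
qed

lemma path_plus_edge_cover:
  assumes "path_plus_edge V E" "finite S"
  shows "\<exists>R\<subseteq>V - S. card R \<le> card S + 1 \<and> (\<forall>j\<in>V - S. \<exists>r\<in>R. (r, j) \<in> (adj (avoid E S))\<^sup>*)"
proof -
  obtain E0 u v where P: "path_graph V E0" "E = insert {u, v} E0"
    using assms unfolding path_plus_edge_def by metis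
  have "E0 \<subseteq> E" using P(2) by blast
  moreover have "card (S \<inter> V) \<le> card S" using assms(2) by (intro card_mono) auto
  ultimately show ?thesis using path_graph_cover[OF P(1), of E S] by (meson add_le_mono1 order_trans)
qed

text \<open>A path glued on at an endpoint brings as many edges as new vertices, so the balance of
  the triangle persists.\<close>

lemma attach_path_card:
  assumes "attach_path v V E V' E'" "finite V" "simple_graph V E"
  shows "finite V'" "simple_graph V' E'" "card E' + card V = card E + card V'"
proof -
  obtain W F where P: "path_with_endpoint v W F" "V \<inter> W = {v}" "V' = V \<union> W" "E' = E \<union> F"
    using assms(1) unfolding attach_path_def by blast
  have pth: "path_graph W F" using P(1) unfolding path_with_endpoint_def path_graph_def by blast
  note W = path_graph_finite[OF pth] path_graph_simple[OF pth] path_graph_card[OF pth]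
  show "finite V'" using assms(2) W(1) P(3) by simp
  show "simple_graph V' E'" using assms(3) W(2) unfolding P(3,4) simple_graph_def by blast
  have "E \<inter> F = {}" using disjoint_edge_sets[OF assms(3) W(2)] P(2) by blast
  then have "card E' = card E + card F"
    unfolding P(4) using simple_graph_finite[OF assms(3,2)] simple_graph_finite[OF W(2,1)]
    by (intro card_Un_disjoint)
  moreover have "card V' + 1 = card V + card W"
    using card_Un_Int[OF assms(2) W(1)] P(2,3) by simp
  ultimately show "card E' + card V = card E + card V'" using W(3) by linarith
qed

lemma triangle_with_paths_card:
  assumes "triangle_with_paths V E" shows "card E = card V"
proof -
  obtain a b c V1 E1 V2 E2 where abc: "a \<noteq> b" "b \<noteq> c" "a \<noteq> c"
    and 1: "attach_path a {a, b, c} {{a, b}, {b, c}, {a, c}} V1 E1"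
    and 2: "attach_path b V1 E1 V2 E2" and 3: "attach_path c V2 E2 V E"
    using assms unfolding triangle_with_paths_def by metis
  have "simple_graph {a, b, c} {{a, b}, {b, c}, {a, c}}"
    unfolding simple_graph_def using abc by blast
  note A = attach_path_card[OF 1 _ this]
  have fin: "finite {a, b, c}" by simp
  note B = attach_path_card[OF 2 A(1)[OF fin] A(2)[OF fin]]
  note C = attach_path_card[OF 3 B(1,2)]
  have "card {{a, b}, {b, c}, {a, c}} = 3" "card {a, b, c} = 3"
    using abc by (simp_all add: doubleton_eq_iff)
  then show ?thesis using A(3)[OF fin] B(3) C(3) by linarith
qed

text \<open>The extra representative is charged to the endpoint \<open>v\<close> and contained in
  \<open>R\<close> whenever \<open>v\<close> is outside \<open>S\<close>, so that the endpoints of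
  several paths can later share one.\<close>

lemma path_with_endpoint_cover:
  assumes "path_with_endpoint v W F" "F \<subseteq> E"
  shows "\<exists>R\<subseteq>W - S. card R \<le> card (S \<inter> W) + card ({v} - S) \<and> {v} - S \<subseteq> R \<and>
    (\<forall>j\<in>W - S. \<exists>r\<in>R. (r, j) \<in> (adj (avoid E S))\<^sup>*)"
proof -
  obtain vs where vs: "vs \<noteq> []" "distinct vs" "W = set vs" "F = path_edges vs" "hd vs = v"
    using assms(1) unfolding path_with_endpoint_def path_on_iff by blast
  obtain R where R: "R \<subseteq> W - S" "card R \<le> card (S \<inter> W) + (if v \<in> S then 0 else 1)"
    "v \<notin> S \<longrightarrow> v \<in> R" "\<forall>j\<in>W - S. \<exists>r\<in>R. (r, j) \<in> (adj (avoid E S))\<^sup>*"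
    using path_segment_starts[OF vs(1,2), of E S] assms(2) unfolding vs(3,4) vs(5)[symmetric] by metis
  have "card R \<le> card (S \<inter> W) + card ({v} - S)" "{v} - S \<subseteq> R"
    using R(2,3) by (auto simp: insert_Diff_if)
  then show ?thesis using R(1,4) by (intro exI[of _ R] conjI)
qed

text \<open>The path segments starting at vertices of the triangle outside \<open>S\<close> lie in one component.\<close>

lemma triangle_with_paths_cover:
  assumes "triangle_with_paths V E" "finite S"
  shows "\<exists>R\<subseteq>V - S. card R \<le> card S + 1 \<and> (\<forall>j\<in>V - S. \<exists>r\<in>R. (r, j) \<in> (adj (avoid E S))\<^sup>*)"
proof -
  obtain a b c V1 E1 V2 E2 where abc: "a \<noteq> b" "b \<noteq> c" "a \<noteq> c"
    and 1: "attach_path a {a, b, c} {{a, b}, {b, c}, {a, c}} V1 E1"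
    and 2: "attach_path b V1 E1 V2 E2" and 3: "attach_path c V2 E2 V E"
    using assms unfolding triangle_with_paths_def by metis
  obtain A FA where A: "path_with_endpoint a A FA" "{a, b, c} \<inter> A = {a}" "V1 = {a, b, c} \<union> A"
    "E1 = {{a, b}, {b, c}, {a, c}} \<union> FA" using 1 unfolding attach_path_def by metis
  obtain B FB where B: "path_with_endpoint b B FB" "V1 \<inter> B = {b}" "V2 = V1 \<union> B" "E2 = E1 \<union> FB"
    using 2 unfolding attach_path_def by metis
  obtain C FC where C: "path_with_endpoint c C FC" "V2 \<inter> C = {c}" "V = V2 \<union> C" "E = E2 \<union> FC"
    using 3 unfolding attach_path_def by metis
  have sub: "FA \<subseteq> E" "FB \<subseteq> E" "FC \<subseteq> E" and tri: "{a, b} \<in> E" "{b, c} \<in> E" "{a, c} \<in> E"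
    unfolding A(4) B(4) C(4) by auto
  have mem: "a \<in> A" "b \<in> B" "c \<in> C" using A(2) B(2) C(2) by auto
  have "a \<notin> B" "a \<notin> C" "b \<notin> C" using A(3) B(2,3) C(2) abc by auto
  then have disj: "A \<inter> B = {}" "A \<inter> C = {}" "B \<inter> C = {}"
    using A(2,3) B(2,3) C(2) abc by auto
  have V: "V = A \<union> B \<union> C" using A(3) B(3) C(3) mem by blast
  obtain RA where RA: "RA \<subseteq> A - S" "card RA \<le> card (S \<inter> A) + card ({a} - S)" "{a} - S \<subseteq> RA"
    "\<forall>j\<in>A - S. \<exists>r\<in>RA. (r, j) \<in> (adj (avoid E S))\<^sup>*"
    using path_with_endpoint_cover[OF A(1) sub(1), of S] by blast
  obtain RB where RB: "RB \<subseteq> B - S" "card RB \<le> card (S \<inter> B) + card ({b} - S)" "{b} - S \<subseteq> RB"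
    "\<forall>j\<in>B - S. \<exists>r\<in>RB. (r, j) \<in> (adj (avoid E S))\<^sup>*"
    using path_with_endpoint_cover[OF B(1) sub(2), of S] by blast
  obtain RC where RC: "RC \<subseteq> C - S" "card RC \<le> card (S \<inter> C) + card ({c} - S)" "{c} - S \<subseteq> RC"
    "\<forall>j\<in>C - S. \<exists>r\<in>RC. (r, j) \<in> (adj (avoid E S))\<^sup>*"
    using path_with_endpoint_cover[OF C(1) sub(3), of S] by blast
  let ?R = "RA \<union> RB \<union> RC" and ?H = "{a, b, c} - S"
  have R_sub: "?R \<subseteq> V - S" "?H \<subseteq> ?R" using RA(1,3) RB(1,3) RC(1,3) V by blast+
  have reach: "\<exists>r\<in>?R. (r, j) \<in> (adj (avoid E S))\<^sup>*" if jV: "j \<in> V - S" for j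
  proof -
    consider "j \<in> A - S" | "j \<in> B - S" | "j \<in> C - S" using jV V by blast
    then show ?thesis
    proof cases
      case 1
      then obtain r where "r \<in> RA" "(r, j) \<in> (adj (avoid E S))\<^sup>*" using RA(4) by metis
      then show ?thesis by (intro bexI[of _ r]) simp_all
    next
      case 2
      then obtain r where "r \<in> RB" "(r, j) \<in> (adj (avoid E S))\<^sup>*" using RB(4) by metis
      then show ?thesis by (intro bexI[of _ r]) simp_all
    next
      case 3
      then obtain r where "r \<in> RC" "(r, j) \<in> (adj (avoid E S))\<^sup>*" using RC(4) by metis
      then show ?thesis by (intro bexI[of _ r]) simp_all
    qed
  qed
  have cardR: "card ?R \<le> card S + card ?H"
  proof -
    have "card ?R \<le> card RA + card RB + card RC"
      using card_Un_le[of "RA \<union> RB" RC] card_Un_le[of RA RB] by linarith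
    also have "\<dots> \<le> (card (S \<inter> A) + card (S \<inter> B) + card (S \<inter> C)) +
        (card ({a} - S) + card ({b} - S) + card ({c} - S))"
      using RA(2) RB(2) RC(2) by linarith
    also have "card (S \<inter> A) + card (S \<inter> B) + card (S \<inter> C) = card (S \<inter> A \<union> S \<inter> B \<union> S \<inter> C)"
      using assms(2) disj by (subst card_Un_disjoint; (subst card_Un_disjoint)?) auto
    also have "\<dots> \<le> card S" using assms(2) by (intro card_mono) auto
    also have "card ({a} - S) + card ({b} - S) + card ({c} - S) = card ?H"
      using abc by (simp add: insert_Diff_if)
    finally show ?thesis by simp
  qed
  show ?thesis
  proof (cases "?H = {}")
    case True
    then have "card ?R \<le> card S + 1" using cardR by (simp only: card.empty)
    then show ?thesis using R_sub(1) reach by (intro exI[of _ ?R] conjI ballI)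
  next
    case False
    then obtain h where h: "h \<in> ?H" by blast
    \<comment> \<open>The surviving corners are pairwise adjacent, so one of them represents them
      all, which lowers \<open>card S + card ?H\<close> to \<open>card S + 1\<close>.\<close>
    let ?R' = "insert h (?R - ?H)"
    have joined: "(h, r) \<in> (adj (avoid E S))\<^sup>*" if r: "r \<in> ?H" for r
    proof (cases "h = r")
      case False
      then have "{h, r} \<in> E" using h r tri by (auto simp: insert_commute)
      then have "{h, r} \<in> avoid E S" using h r by (auto simp: avoid_def)
      then show ?thesis by (rule reach_edge)
    qed simp
    show ?thesis
    proof (intro exI[of _ ?R'] conjI ballI)
      show "?R' \<subseteq> V - S" using R_sub h by blast
      have "finite ?R"
      proof -
        have "finite A" "finite B" "finite C"
          using A(1) B(1) C(1) unfolding path_with_endpoint_def path_on_iff by auto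
        then have "finite V" using V by simp
        then show ?thesis using R_sub(1) finite_subset[of ?R V] by blast
      qed
      then have "card (?R - ?H) + card ?H = card ?R"
        using R_sub(2) by (metis card_Diff_subset card_mono finite_subset le_add_diff_inverse2)
      moreover have "card ?R' \<le> Suc (card (?R - ?H))" by (rule card_insert_le_m1[of "Suc _", simplified]) simp
      ultimately show "card ?R' \<le> card S + 1" using cardR by linarith
    next
      fix j assume "j \<in> V - S"
      then obtain r where r: "r \<in> ?R" "(r, j) \<in> (adj (avoid E S))\<^sup>*" using reach by metis
      show "\<exists>r\<in>?R'. (r, j) \<in> (adj (avoid E S))\<^sup>*"
      proof (cases "r \<in> ?H")
        case True
        have "(h, j) \<in> (adj (avoid E S))\<^sup>*" by (rule rtrancl_trans[OF joined[OF True] r(2)])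
        then show ?thesis by (intro bexI[of _ h]) simp_all
      next
        case False
        then show ?thesis using r by (intro bexI[of _ r]) simp_all
      qed
    qed
  qed
qed

lemma ideal_height_ge_cover:
  assumes E: "simple_graph {1..n} E"
    and "\<And>S. finite S \<Longrightarrow> \<exists>R\<subseteq>{1..n} - S. card R \<le> card S + c \<and>
      (\<forall>j\<in>{1..n} - S. \<exists>r\<in>R. (r, j) \<in> (adj (avoid E S))\<^sup>*)"
  shows "enat (n - c) \<le>
    ideal_height (poly_ring 2 n) (gen_binomial_edge_ideal 2 n E :: ('k::field) mpoly set)"
  using assms(2) finite_subset[of _ "{1..n}"]
  by (intro ideal_height_ge_components[OF E]) auto

section \<open>The two implications\<close>

lemma almost_complete_intersection_if:
  assumes n: "n \<ge> 3" and E: "simple_graph {1..n} E" and con: "connected_graph {1..n} E"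
    and shape: "\<not> path_graph {1..n} E \<and> two_paths_plus_edge {1..n} E \<or>
      path_plus_edge {1..n} E \<or> triangle_with_paths {1..n} E"
  shows "almost_complete_intersection (poly_ring 2 n)
    (gen_binomial_edge_ideal 2 n E :: ('k::field) mpoly set)"
proof -
  let ?h = "ideal_height (poly_ring 2 n) (gen_binomial_edge_ideal 2 n E :: 'k mpoly set)"
  have finE: "finite E" using simple_graph_finite[OF E] by simp
  have mu: "min_num_gens (poly_ring 2 n) (gen_binomial_edge_ideal 2 n E :: 'k mpoly set) = card E"
    using min_num_gens_gen_binomial_edge_ideal[OF E, of 2] card_minor_index_2[OF E finE] by simp
  consider "\<not> path_graph {1..n} E" "two_paths_plus_edge {1..n} E" |
    "path_plus_edge {1..n} E \<or> triangle_with_paths {1..n} E" using shape by blast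
  \<comment> \<open>The bound \<open>card E \<ge> 1\<close> guards the truncated subtraction when
    \<open>1\<close> is added back.\<close>
  then have "?h = enat (card E - 1) \<and> card E \<ge> 1"
  proof cases
    case 1
    have cardE: "Suc (card E) = n" using two_paths_plus_edge_card[OF 1(2)] by simp
    \<comment> \<open>A connected graph with \<open>n - 1\<close> edges and all degrees at most two
      would be a path.\<close>
    have "\<exists>w\<in>{1..n}. \<not> vdegree E w \<le> 2"
      using path_graph_of_degrees[OF _ E con] cardE 1(1) by fastforce
    then obtain w where w: "w \<in> {1..n}" "vdegree E w \<ge> 3" by fastforce
    have "card ({1..n} - {w}) \<le> card (avoid E {w}) + ncomp ({1..n} - {w}) (avoid E {w})"
      by (intro card_le_edges_plus_ncomp simple_graph_avoid E) simp
    then have "n - 1 \<le> card (avoid E {w}) + ncomp ({1..n} - {w}) (avoid E {w})"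
      using w(1) by (simp add: card_Diff_subset)
    \<comment> \<open>\<open>G - w\<close> keeps at most \<open>n - 4\<close> edges on
      \<open>n - 1\<close> vertices and so has at least three components.\<close>
    then have "n + card {w} - ncomp ({1..n} - {w}) (avoid E {w}) \<le> n - 2"
      using card_avoid_vertex[OF finE, of w] w(2) cardE by simp
    then have "?h \<le> enat (n - 2)"
      using ideal_height_le_ncomp[OF E, of "{w}", where 'k = 'k] w(1)
      by (meson empty_subsetI enat_ord_simps(1) insert_subset order_trans)
    moreover have "enat (n - 2) \<le> ?h"
      by (rule ideal_height_ge_cover[OF E]) (rule two_paths_plus_edge_cover[OF 1(2)])
    ultimately have "?h = enat (n - 2)" by (rule antisym)
    then show ?thesis using cardE n by auto
  next
    case 2
    have cardE: "card E = n" using 2 path_plus_edge_card triangle_with_paths_card by fastforce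
    have "?h \<le> enat (n - 1)" using ideal_height_le_connected[OF E, of 2, where 'k = 'k] n by simp
    moreover have "enat (n - 1) \<le> ?h"
      by (rule ideal_height_ge_cover[OF E])
         (use 2 path_plus_edge_cover triangle_with_paths_cover in metis)
    ultimately have "?h = enat (n - 1)" by (rule antisym)
    then show ?thesis using cardE n by auto
  qed
  then show ?thesis
    unfolding almost_complete_intersection_def mu by (simp add: one_enat_def)
qed

lemma almost_complete_intersection_only_if:
  assumes m: "m \<ge> 2" and n: "n \<ge> 3" and E: "simple_graph {1..n} E" and con: "connected_graph {1..n} E"
    and aci: "almost_complete_intersection (poly_ring m n)
      (gen_binomial_edge_ideal m n E :: ('k::field) mpoly set)"
  shows "m = 2 \<and>
    ((tree_graph {1..n} E \<and> \<not> path_graph {1..n} E \<and> two_paths_plus_edge {1..n} E) \<or>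
     (\<not> tree_graph {1..n} E \<and> (path_plus_edge {1..n} E \<or> triangle_with_paths {1..n} E)))"
proof -
  let ?h = "ideal_height (poly_ring m n) (gen_binomial_edge_ideal m n E :: 'k mpoly set)"
  have finE: "finite E" using simple_graph_finite[OF E] by simp
  have eq: "enat (card (minor_index m E)) = ?h + 1"
    using aci unfolding almost_complete_intersection_def min_num_gens_gen_binomial_edge_ideal[OF E] .
  have upper: "card (minor_index m E) \<le> k + 1" if "?h \<le> enat k" for k
  proof -
    have "enat (card (minor_index m E)) \<le> enat k + 1" unfolding eq using that by (rule add_right_mono)
    then show ?thesis by (simp add: one_enat_def)
  qed
  have n_le: "n \<le> card E + 1"
    using card_le_edges_plus_ncomp[OF _ E] ncomp_connected[OF con] by simp
  have m2: "m = 2"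
  proof (rule ccontr)
    assume "m \<noteq> 2"
    then have m3: "m \<ge> 3" using m by simp
    have "m * (n - 1) \<le> m * card E" using n_le by (intro mult_le_mono2) simp
    also have "\<dots> \<le> card (minor_index m E)" by (rule card_minor_index_ge[OF E finE m3])
    also have "\<dots> \<le> m * n - (n + (m - 1)) + 1"
      using ideal_height_le_connected[OF E, of m, where 'k = 'k] n m by (intro upper) simp
    finally have le: "m * (n - 1) \<le> m * n - (n + (m - 1)) + 1" .
    \<comment> \<open>In terms of \<open>n' = n - 1\<close> the inequality reads
      \<open>m * n' \<le> m * n' - n' + 1\<close>, which forces \<open>n' \<le> 1\<close>.\<close>
    obtain n' where n': "n = Suc n'" using n by (cases n) auto
    have "m * n' \<le> m * n' - n' + 1" using le n' m3 by simp
    moreover have "n' \<le> m * n'" using m3 by simp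
    ultimately show False using n n' by arith
  qed
  have cardE: "card (minor_index m E) = card E" unfolding m2 by (rule card_minor_index_2[OF E finE])
  interpret few_components_graph "{1..n}" E
  proof
    fix S assume S: "S \<subseteq> {1..n}"
    have finS: "finite S" using S finite_subset by blast
    have "card E \<le> n + card S - ncomp ({1..n} - S) (avoid E S) + 1"
      unfolding cardE[symmetric] by (rule upper) (unfold m2, rule ideal_height_le_ncomp[OF E S])
    \<comment> \<open>This keeps the subtraction of natural numbers from truncating, so that the
      component count can be moved to the other side.\<close>
    moreover have "ncomp ({1..n} - S) (avoid E S) \<le> n"
      unfolding ncomp_def using card_image_le[of "{1..n} - S" "component (avoid E S)"] 
        card_mono[of "{1..n}" "{1..n} - S"] by simp
    ultimately show "ncomp ({1..n} - S) (avoid E S) + card E \<le> card {1..n} + card S + 1" by simp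
  qed (rule finite_atLeastAtMost E con)+
  show ?thesis
  proof (cases "card E = card {1..n}")
    case True
    then show ?thesis using unicyclic_structure m2 by blast
  next
    case False
    then have less: "card E < card {1..n}" using card_E_le by simp
    have "\<not> path_graph {1..n} E"
    proof
      assume P: "path_graph {1..n} E"
      \<comment> \<open>For a path every \<open>S\<close> leaves at most \<open>card S + 1\<close>
        components, so the height would be at least \<open>n - 1\<close> and the number of
        generators at least \<open>n\<close>, exceeding the number of edges.\<close>
      have "enat (n - 1) \<le> ideal_height (poly_ring 2 n) (gen_binomial_edge_ideal 2 n E :: 'k mpoly set)"
      proof (rule ideal_height_ge_cover[OF E])
        fix S :: "nat set" assume "finite S"
        then have "card (S \<inter> {1..n}) \<le> card S" by (intro card_mono) auto
        then show "\<exists>R\<subseteq>{1..n} - S. card R \<le> card S + 1 \<and>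
            (\<forall>j\<in>{1..n} - S. \<exists>r\<in>R. (r, j) \<in> (adj (avoid E S))\<^sup>*)"
          using path_graph_cover[OF P subset_refl, of S] by (meson add_le_mono1 order_trans)
      qed
      then have "enat (n - 1) + 1 \<le> enat (card E)" using eq cardE m2 by (metis add_right_mono)
      then have "n - 1 + 1 \<le> card E" by (simp add: one_enat_def)
      then show False using less n by simp
    qed
    then show ?thesis using tree_structure[OF less] n m2 by simp
  qed
qed

theorem theorem2p4:
  fixes m n :: nat
    and E :: "nat set set"
  assumes "m \<ge> 2"
    and "n \<ge> 3"
    and "simple_graph {1..n} E"
    and "connected_graph {1..n} E"
  shows "almost_complete_intersection (poly_ring m n)
           (gen_binomial_edge_ideal m n E :: ('k::field) mpoly set)
         \<longleftrightarrow>
         m = 2 \<and>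
         ((tree_graph {1..n} E \<and> \<not> path_graph {1..n} E \<and> two_paths_plus_edge {1..n} E) \<or>
          (\<not> tree_graph {1..n} E \<and>
             (path_plus_edge {1..n} E \<or> triangle_with_paths {1..n} E)))"
  using almost_complete_intersection_only_if[OF assms] almost_complete_intersection_if[OF assms(2-4)]
  by blast

end
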